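(* For $i=1,2$ let $\phi_i$ be a Dirichlet series belonging to the class $\mathcal A$ with parameter $r_i>0$ (see context), with dual series $\psi_i$, where $\phi_1(s)=\sum_{n\ge1}a_1(n)\lambda_n^{-s}$, $\psi_1(s)=\sum_{n\ge1}b_1(n)\mu_n^{-s}$, $\phi_2(s)=\sum_{n\ge1}a_2(n)\lambda_n'^{-s}$, $\psi_2(s)=\sum_{n\ge1}b_2(n)\mu_n'^{-s}$. Let $\rho_1$, $\rho_2$ be the residues of $\phi_1$, $\phi_2$ at $s=r_1$, $s=r_2$ respectively. Then the formula $$\Gamma(s)\,\mathcal Z_2(s;a_1,a_2;\lambda,\lambda')=-\phi_2(0)\Gamma(s)\phi_1(s)+\rho_1\Gamma(r_1)\Gamma(s-r_1)\phi_2(s-r_1)+2\sum_{m,n=1}^\infty b_1(m)a_2(n)\left(\frac{\mu_m}{\lambda_n'}\right)^{\frac{s-r_1}{2}}K_{r_1-s}\left(2\sqrt{\mu_m\lambda_n'}\right)$$ provides the analytic continuation of $\mathcal Z_2(s;a_1,a_2;\lambda,\lambda')$ to $\mathbb C$ as a meromorphic function whose only possible singularity is a simple pole at $s=r_1+r_2$, with residue $$\frac{\Gamma(r_1)\Gamma(r_2)}{\Gamma(r_1+r_2)}\rho_1\rho_2 .$$ Moreover, this continuation satisfies the functional equation $$\Gamma(s)\,\mathcal Z_2(s;a_1,a_2;\lambda,\lambda')=\Gamma(r_1+r_2-s)\,\mathcal Z_2(r_1+r_2-s;b_1,b_2;\mu,\mu').$$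
   Context: Hecke pair with parameter $r>0$: $(\lambda_n)_{n\ge1}$, $(\mu_n)_{n\ge1}$ are sequences of positive numbers strictly increasing to $\infty$; $(a(n))_{n\ge1}$, $(b(n))_{n\ge1}$ are complex sequences, not identically zero; $\phi(s)=\sum_{n\ge1}a(n)\lambda_n^{-s}$ and $\psi(s)=\sum_{n\ge1}b(n)\mu_n^{-s}$ have finite abscissas of absolute convergence $\sigma_a$, $\sigma_b$; and there is a meromorphic function $\chi$ on $\mathbb C$ such that (1) $\chi(s)=\Gamma(s)\phi(s)$ for $\mathrm{Re}(s)>\sigma_a$ and $\chi(s)=\Gamma(r-s)\psi(r-s)$ for $\mathrm{Re}(s)<r-\sigma_b$; (2) $\lim_{|\mathrm{Im}(s)|\to\infty}\chi(s)=0$ uniformly in every strip $\sigma_1\le\mathrm{Re}(s)\le\sigma_2$; (3) the singularities of $\chi$ are at most poles and are confined to some compact set. Class $\mathcal A$: $\phi$ belongs to $\mathcal A$ (with parameter $r$ and dual series $\psi$) if $(\phi,\psi)$ is a Hecke pair with parameter $r$; $\phi$ and $\psi$ have analytic continuations to $\mathbb C$, analytic except for possible simple poles at $s=r$ with residues $\rho$ and $\rho^\star$ respectively (residue $0$ if there is no pole); and the coefficients are extended to $n=0$ by $a(0):=-\phi(0)$, $b(0):=-\psi(0)$. Also $\lambda_0=\mu_0=0$ by convention. Diagonal Epstein zeta function: with $\sigma_a=\max\{\sigma_{a_1},\sigma_{a_2}\}$ ($\sigma_{a_i}$ the abscissa of absolute convergence of $\phi_i$), for $\mathrm{Re}(s)>2\sigma_a$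 $$\mathcal Z_2(s;a_1,a_2;\lambda,\lambda')=\sum_{\substack{m,n\ge0\\(m,n)\ne(0,0)}}\frac{a_1(m)a_2(n)}{(\lambda_m+\lambda_n')^s},$$ and $\mathcal Z_2(s;b_1,b_2;\mu,\mu')$ is defined analogously from $\psi_1,\psi_2$. $K_\nu$ is the modified Bessel function of the second kind. *)

theory Defs
  imports "HOL-Complex_Analysis.Complex_Analysis"
begin

text \<open>
  Coefficients and exponents are functions on \<open>nat\<close>. A Dirichlet series uses the indices
  \<open>n \<ge> 1\<close> only; the values at index \<open>0\<close> enter through the conventions in \<open>class_A\<close>.
  Sums are unconditional (\<open>infsum\<close>), which for complex terms means absolutely convergent.
\<close>

definition dirichlet_term :: "(nat \<Rightarrow> complex) \<Rightarrow> (nat \<Rightarrow> real) \<Rightarrow> complex \<Rightarrow> nat \<Rightarrow> complex" where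
  "dirichlet_term a lam s n = a n * of_real (lam n) powr (- s)"

definition dirichlet_series :: "(nat \<Rightarrow> complex) \<Rightarrow> (nat \<Rightarrow> real) \<Rightarrow> complex \<Rightarrow> complex" where
  "dirichlet_series a lam s = (\<Sum>\<^sub>\<infinity>n\<in>{1..}. dirichlet_term a lam s n)"

definition abs_conv_abscissa :: "(nat \<Rightarrow> complex) \<Rightarrow> (nat \<Rightarrow> real) \<Rightarrow> ereal" where
  "abs_conv_abscissa a lam =
     Inf {ereal (Re s) | s. (\<lambda>n. norm (dirichlet_term a lam s n)) summable_on {1..}}"

text \<open>Meaningful only when the abscissa is finite, which \<open>hecke_pair\<close> requires.\<close>

definition abscissa :: "(nat \<Rightarrow> complex) \<Rightarrow> (nat \<Rightarrow> real) \<Rightarrow> real" where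
  "abscissa a lam = real_of_ereal (abs_conv_abscissa a lam)"

definition exponent_seq :: "(nat \<Rightarrow> real) \<Rightarrow> bool" where
  "exponent_seq lam \<longleftrightarrow>
     (\<forall>n\<ge>1. 0 < lam n) \<and> strict_mono_on {1..} lam \<and> filterlim lam at_top sequentially"

text \<open>
  \<open>X\<close> is the meromorphic function through which the two Dirichlet series are related. The
  identities for it are identities of meromorphic functions; poles of \<open>Gamma\<close>, where the
  library sets \<open>Gamma\<close> to \<open>0\<close>, are therefore left out.
\<close>

definition hecke_pair ::
  "real \<Rightarrow> (nat \<Rightarrow> complex) \<Rightarrow> (nat \<Rightarrow> real) \<Rightarrow> (nat \<Rightarrow> complex) \<Rightarrow> (nat \<Rightarrow> real) \<Rightarrow> bool" where
  "hecke_pair r a lam b mu \<longleftrightarrow>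
     0 < r \<and> exponent_seq lam \<and> exponent_seq mu \<and>
     (\<exists>n\<ge>1. a n \<noteq> 0) \<and> (\<exists>n\<ge>1. b n \<noteq> 0) \<and>
     \<bar>abs_conv_abscissa a lam\<bar> \<noteq> \<infinity> \<and> \<bar>abs_conv_abscissa b mu\<bar> \<noteq> \<infinity> \<and>
     (\<exists>X. X meromorphic_on UNIV \<and>
        (\<forall>s. Re s > abscissa a lam \<and> s \<notin> \<int>\<^sub>\<le>\<^sub>0 \<longrightarrow>
           X s = Gamma s * dirichlet_series a lam s) \<and>
        (\<forall>s. Re s < r - abscissa b mu \<and> of_real r - s \<notin> \<int>\<^sub>\<le>\<^sub>0 \<longrightarrow>
           X s = Gamma (of_real r - s) * dirichlet_series b mu (of_real r - s)) \<and>
        (\<forall>\<sigma>1 \<sigma>2. \<forall>\<epsilon>>0. \<exists>T. \<forall>s. \<sigma>1 \<le> Re s \<and> Re s \<le> \<sigma>2 \<and> T \<le> \<bar>Im s\<bar> \<longrightarrow> norm (X s) < \<epsilon>) \<and>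
        (\<exists>K. compact K \<and> X analytic_on (- K)))"

text \<open>
  \<open>nicely_meromorphic_on\<close> excludes arbitrary values at removable singularities, so such a
  continuation of a function given on a right half-plane is unique.
\<close>

definition meromorphic_continuation ::
  "(complex \<Rightarrow> complex) \<Rightarrow> (complex \<Rightarrow> complex) \<Rightarrow> real \<Rightarrow> bool" where
  "meromorphic_continuation F f c \<longleftrightarrow>
     F nicely_meromorphic_on UNIV \<and> (\<forall>s. Re s > c \<longrightarrow> F s = f s)"

definition only_possible_pole_simple_at :: "(complex \<Rightarrow> complex) \<Rightarrow> complex \<Rightarrow> bool" where
  "only_possible_pole_simple_at F p \<longleftrightarrow>
     F analytic_on (- {p}) \<and> (is_pole F p \<longrightarrow> zorder F p = - 1)"

text \<open>
  \<open>\<phi>\<close> and \<open>\<psi>\<close> denote the continued functions. Their residues at \<open>r\<close> are \<open>residue \<phi> r\<close> and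
  \<open>residue \<psi> r\<close>, which vanish if there is no pole.
\<close>

definition class_A ::
  "real \<Rightarrow> (nat \<Rightarrow> complex) \<Rightarrow> (nat \<Rightarrow> real) \<Rightarrow> (complex \<Rightarrow> complex) \<Rightarrow>
     (nat \<Rightarrow> complex) \<Rightarrow> (nat \<Rightarrow> real) \<Rightarrow> (complex \<Rightarrow> complex) \<Rightarrow> bool" where
  "class_A r a lam \<phi> b mu \<psi> \<longleftrightarrow>
     hecke_pair r a lam b mu \<and>
     meromorphic_continuation \<phi> (dirichlet_series a lam) (abscissa a lam) \<and>
     meromorphic_continuation \<psi> (dirichlet_series b mu) (abscissa b mu) \<and>
     only_possible_pole_simple_at \<phi> (of_real r) \<and>
     only_possible_pole_simple_at \<psi> (of_real r) \<and>
     a 0 = - \<phi> 0 \<and> b 0 = - \<psi> 0 \<and> lam 0 = 0 \<and> mu 0 = 0"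

definition epstein_term ::
  "(nat \<Rightarrow> complex) \<Rightarrow> (nat \<Rightarrow> complex) \<Rightarrow> (nat \<Rightarrow> real) \<Rightarrow> (nat \<Rightarrow> real) \<Rightarrow>
     complex \<Rightarrow> nat \<times> nat \<Rightarrow> complex" where
  "epstein_term a1 a2 lam lam' s =
     (\<lambda>(m, n). a1 m * a2 n / of_real (lam m + lam' n) powr s)"

text \<open>The series itself, meaningful in its half-plane of convergence.\<close>

definition epstein_series ::
  "(nat \<Rightarrow> complex) \<Rightarrow> (nat \<Rightarrow> complex) \<Rightarrow> (nat \<Rightarrow> real) \<Rightarrow> (nat \<Rightarrow> real) \<Rightarrow> complex \<Rightarrow> complex" where
  "epstein_series a1 a2 lam lam' s =
     (\<Sum>\<^sub>\<infinity>p \<in> UNIV - {(0, 0)}. epstein_term a1 a2 lam lam' s p)"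

text \<open>
  The modified Bessel function of the second kind \<open>K\<^sub>\<nu>(x)\<close> of complex order \<open>\<nu>\<close> at \<open>x > 0\<close>, as
  the integral of \<open>exp (- x cosh t) cosh (\<nu> t)\<close> over \<open>t \<ge> 0\<close>.
\<close>

definition bessel_K :: "complex \<Rightarrow> real \<Rightarrow> complex" where
  "bessel_K \<nu> x =
     (LBINT t:{0..}. of_real (exp (- x * cosh t)) * cosh (\<nu> * of_real t))"

definition bessel_term ::
  "real \<Rightarrow> (nat \<Rightarrow> complex) \<Rightarrow> (nat \<Rightarrow> complex) \<Rightarrow> (nat \<Rightarrow> real) \<Rightarrow> (nat \<Rightarrow> real) \<Rightarrow>
     complex \<Rightarrow> nat \<times> nat \<Rightarrow> complex" where
  "bessel_term r b a mu lam s =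
     (\<lambda>(m, n). b m * a n * of_real (mu m / lam n) powr ((s - of_real r) / 2)
               * bessel_K (of_real r - s) (2 * sqrt (mu m * lam n)))"

end

theory Submission
  imports Defs
begin

text \<open>
  Put \<open>f i z = (\<Sum>n\<ge>0. a i n * exp (- lam i n * z))\<close> and \<open>g i\<close> likewise for \<open>b i\<close>, \<open>mu i\<close>. A Hecke pair
  satisfies \<open>f i z = z powr (- r i) * g i (1 / z)\<close>. Now \<open>Gamma s\<close> times the Epstein series is the
  Mellin transform of \<open>f 1 * f 2 - a 1 0 * a 2 0\<close>, and replacing \<open>f 1 x\<close> by \<open>x powr (- r 1) * g 1 (1 / x)\<close> in
  \<open>a 2 0 * (f 1 - a 1 0) + f 1 * (f 2 - a 2 0)\<close> splits it into the three terms of the formula; the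
  products of exponentials integrate to Bessel functions. Each term is meromorphic in the plane and
  is carried by \<open>s \<mapsto> r 1 + r 2 - s\<close> to a term of the same formula for the pair of dual series taken in
  the opposite order, which gives the functional equation. Substituting \<open>x = exp t\<close> turns Mellin
  transforms into two-sided Laplace transforms.
\<close>

subsection \<open>Two-sided Laplace transforms\<close>

text \<open>The decay required of a Hecke pair comes without a rate, so by itself it gives no
  integrable bound on vertical lines for a Mellin inversion. It does give boundedness in strips, and
  the modular relation is built on that: Liouville's theorem compares Laplace transforms, and the
  Weierstrass approximation theorem recovers the functions from them. The formula has to hold on the
  whole half-plane \<open>Re s > 2 * max (abscissa a1 lam) (abscissa a2 lam')\<close>, where the
  shift by \<open>r1\<close> and the terms with one index 0 are delicate. Two facts settle this:
  abscissas are nonnegative, and the abscissa of \<open>\<phi>\<close> is at least \<open>r\<close>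
  as soon as \<open>b 0\<close> is nonzero, because \<open>\<phi>\<close> then has a pole at
  \<open>r\<close>. If \<open>b1 0 = 0\<close>, the shifted term is absent. Since
  \<open>Gamma\<close> has the value 0 at its poles, identities between completed functions may fail
  at isolated points. The continuation is therefore assembled from entire functions and explicit
  polar parts: the poles at \<open>r1\<close> cancel, and multiplication by \<open>rGamma\<close>
  removes the one at 0.\<close>

definition laplace :: "(real \<Rightarrow> complex) \<Rightarrow> complex \<Rightarrow> complex" where
  "laplace h s = (LINT t|lborel. exp (s * of_real t) * h t)"

lemma norm_exp_mult_of_real: "norm (exp (s * complex_of_real t)) = exp (Re s * t)"
  by (simp add: norm_exp_eq_Re)

lemma integrable_laplace:
  fixes h :: "real \<Rightarrow> complex"
  assumes [measurable]: "h \<in> borel_measurable lborel"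
    and "integrable lborel (\<lambda>t. exp (Re s * t) * norm (h t))"
  shows "integrable lborel (\<lambda>t. exp (s * of_real t) * h t)"
proof -
  have [measurable]: "(\<lambda>t. exp (s * complex_of_real t)) \<in> borel_measurable lborel"
    by (auto intro!: borel_measurable_continuous_onI continuous_intros)
  show ?thesis
    using assms(2) by (rule Bochner_Integration.integrable_bound)
      (auto simp: norm_mult norm_exp_mult_of_real)
qed

lemma norm_laplace_le:
  "norm (laplace h s) \<le> (LINT t|lborel. exp (Re s * t) * norm (h t))"
  unfolding laplace_def
  using integral_norm_bound[of lborel "\<lambda>t. exp (s * of_real t) * h t"]
  by (simp add: norm_mult norm_exp_mult_of_real)

lemma norm_exp_minus_one_le:
  fixes z :: complex
  shows "norm (exp z - 1) \<le> norm z * exp (norm z)"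
proof -
  have "norm (exp z - exp 0) \<le> exp (norm z) * norm (z - 0)"
  proof (rule field_differentiable_bound[where S = "cball 0 (norm z)" and f' = exp])
    fix w :: complex assume "w \<in> cball 0 (norm z)"
    then show "norm (exp w) \<le> exp (norm z)"
      using abs_Re_le_cmod[of w] by (auto simp: norm_exp_eq_Re)
  qed (auto intro!: derivative_eq_intros)
  then show ?thesis by (simp add: mult.commute)
qed

text \<open>Differentiation under the integral, by dominated convergence along sequences. For
  \<open>norm (z - s) < e\<close> the difference quotient of \<open>exp (z * t)\<close> is at most
  \<open>\<bar>t\<bar> * exp (e * \<bar>t\<bar>) * exp (Re s * t)\<close>, and the factor
  \<open>\<bar>t\<bar>\<close> is paid for by one more
  \<open>exp (e * \<bar>t\<bar>)\<close>.\<close>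

lemma laplace_has_field_derivative:
  fixes h :: "real \<Rightarrow> complex"
  assumes [measurable]: "h \<in> borel_measurable lborel"
    and int: "\<And>\<sigma>. \<alpha> < \<sigma> \<Longrightarrow> \<sigma> < \<beta> \<Longrightarrow> integrable lborel (\<lambda>t. exp (\<sigma> * t) * norm (h t))"
    and s: "\<alpha> < Re s" "Re s < \<beta>"
  shows "(laplace h has_field_derivative laplace (\<lambda>t. of_real t * h t) s) (at s)"
proof -
  \<comment> \<open>Each factor \<open>exp (e * \<bar>t\<bar>)\<close> moves the line of
    integrability by \<open>e\<close>. Two are spent, so a third of the distance to the boundary
    leaves room.\<close>
  define e where "e = min (Re s - \<alpha>) (\<beta> - Re s) / 3"
  have e: "0 < e" "\<alpha> < Re s - 2 * e" "Re s + 2 * e < \<beta>"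
    using s by (auto simp: e_def min_def field_simps)
  have [measurable]: "(\<lambda>t. exp (z * complex_of_real t)) \<in> borel_measurable lborel" for z
    by (auto intro!: borel_measurable_continuous_onI continuous_intros)
  define g where "g t = (1 / e) * ((exp ((Re s - 2 * e) * t) + exp ((Re s + 2 * e) * t)) * norm (h t))" for t
  have g: "integrable lborel g"
    unfolding g_def
    by (rule integrable_mult_right, subst distrib_right)
       (intro Bochner_Integration.integrable_add int; use e in linarith)
  have bound: "\<bar>t\<bar> * exp (Re s * t) * exp (e * \<bar>t\<bar>) * norm (h t) \<le> g t" for t
  proof -
    have "e * \<bar>t\<bar> \<le> exp (e * \<bar>t\<bar>)"
      using exp_ge_add_one_self[of "e * \<bar>t\<bar>"] by linarith
    then have "\<bar>t\<bar> \<le> (1 / e) * exp (e * \<bar>t\<bar>)" using e by (simp add: field_simps)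
    then have "\<bar>t\<bar> * (exp (Re s * t) * exp (e * \<bar>t\<bar>)) \<le> (1 / e) * exp (e * \<bar>t\<bar>) * (exp (Re s * t) * exp (e * \<bar>t\<bar>))"
      by (rule mult_right_mono) simp
    also have "\<dots> = (1 / e) * exp (Re s * t + 2 * e * \<bar>t\<bar>)"
      by (simp add: mult_exp_exp algebra_simps)
    also have "exp (Re s * t + 2 * e * \<bar>t\<bar>) \<le> exp ((Re s - 2 * e) * t) + exp ((Re s + 2 * e) * t)"
    proof (cases "t \<ge> 0")
      case True
      then have "exp (Re s * t + 2 * e * \<bar>t\<bar>) = exp ((Re s + 2 * e) * t)" by (simp add: algebra_simps)
      then show ?thesis using exp_gt_zero[of "(Re s - 2 * e) * t"] by linarith
    next
      case False
      then have "exp (Re s * t + 2 * e * \<bar>t\<bar>) = exp ((Re s - 2 * e) * t)" by (simp add: algebra_simps)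
      then show ?thesis using exp_gt_zero[of "(Re s + 2 * e) * t"] by linarith
    qed
    finally have "\<bar>t\<bar> * (exp (Re s * t) * exp (e * \<bar>t\<bar>)) \<le> (1 / e) * (exp ((Re s - 2 * e) * t) + exp ((Re s + 2 * e) * t))"
      using e by (simp add: divide_right_mono)
    from mult_right_mono[OF this, of "norm (h t)"] show ?thesis
      by (simp add: g_def mult_ac)
  qed
  have lapint: "integrable lborel (\<lambda>t. exp (z * of_real t) * h t)" if "norm (z - s) \<le> e" for z
  proof (rule integrable_laplace)
    have "\<bar>Re z - Re s\<bar> \<le> e" using that abs_Re_le_cmod[of "z - s"] by simp
    then show "integrable lborel (\<lambda>t. exp (Re z * t) * norm (h t))"
      using e by (intro int) (auto simp: abs_if split: if_splits)
  qed simp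
  show ?thesis
    unfolding has_field_derivative_iff tendsto_at_iff_sequentially
  proof (intro allI impI)
    fix X :: "nat \<Rightarrow> complex"
    assume X: "\<forall>i. X i \<in> UNIV - {s}" and lim: "X \<longlonglongrightarrow> s"
    \<comment> \<open>The domination holds only close to \<open>s\<close>, so the sequence is
      shifted by \<open>N\<close>; \<open>LIMSEQ_offset\<close> undoes this at the end.\<close>
    obtain N where N: "\<And>n. n \<ge> N \<Longrightarrow> norm (X n - s) < e"
      using lim e(1) by (auto simp: LIMSEQ_iff)
    define q where "q n t = (exp (X n * of_real t) * h t - exp (s * of_real t) * h t) / (X n - s)" for n t
    have "(\<lambda>n. LINT t|lborel. q (n + N) t) \<longlonglongrightarrow> (LINT t|lborel. exp (s * of_real t) * (of_real t * h t))"
    proof (rule integral_dominated_convergence[where w = g])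
      show "AE t in lborel. (\<lambda>n. q (n + N) t) \<longlonglongrightarrow> exp (s * of_real t) * (of_real t * h t)"
      proof (rule AE_I2)
        fix t
        have "((\<lambda>z. exp (z * of_real t) * h t) has_field_derivative exp (s * of_real t) * (of_real t * h t)) (at s)"
          by (auto intro!: derivative_eq_intros)
        then have "(\<lambda>n. q n t) \<longlonglongrightarrow> exp (s * of_real t) * (of_real t * h t)"
          using X lim unfolding has_field_derivative_iff tendsto_at_iff_sequentially q_def o_def by blast
        then show "(\<lambda>n. q (n + N) t) \<longlonglongrightarrow> exp (s * of_real t) * (of_real t * h t)"
          by (rule LIMSEQ_ignore_initial_segment)
      qed
      show "AE t in lborel. norm (q (n + N) t) \<le> g t" for n
      proof (rule AE_I2)
        fix t
        define d where "d = X (n + N) - s"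
        have d: "norm d < e" "d \<noteq> 0" using N[of "n + N"] X by (auto simp: d_def)
        have "q (n + N) t = exp (s * of_real t) * ((exp (d * of_real t) - 1) / d) * h t"
        proof -
          have "exp (X (n + N) * of_real t) = exp (s * of_real t) * exp (d * of_real t)"
            by (simp add: d_def mult_exp_exp algebra_simps)
          then show ?thesis
            using d(2) by (simp add: q_def d_def[symmetric] divide_simps) (simp add: algebra_simps)
        qed
        then have "norm (q (n + N) t) = exp (Re s * t) * (norm (exp (d * of_real t) - 1) / norm d) * norm (h t)"
          by (simp add: norm_mult norm_divide norm_exp_mult_of_real)
        also have "norm (exp (d * of_real t) - 1) / norm d \<le> \<bar>t\<bar> * exp (norm d * \<bar>t\<bar>)"
          using norm_exp_minus_one_le[of "d * of_real t"] d
          by (simp add: norm_mult field_simps)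
        also have "exp (norm d * \<bar>t\<bar>) \<le> exp (e * \<bar>t\<bar>)"
          using d by (simp add: mult_right_mono)
        finally have "norm (q (n + N) t) \<le> exp (Re s * t) * (\<bar>t\<bar> * exp (e * \<bar>t\<bar>)) * norm (h t)"
          by (simp add: mult_left_mono mult_right_mono)
        also have "\<dots> \<le> g t" using bound[of t] by (simp add: mult_ac)
        finally show "norm (q (n + N) t) \<le> g t" .
      qed
      show "q (n + N) \<in> borel_measurable lborel" for n
        unfolding q_def by measurable
    qed (use g in auto)
    moreover have "(LINT t|lborel. q (n + N) t) = (laplace h (X (n + N)) - laplace h s) / (X (n + N) - s)" for n
      using lapint[of "X (n + N)"] lapint[of s] N[of "n + N"] e
      by (simp add: q_def laplace_def)
    ultimately have "(\<lambda>n. (laplace h (X (n + N)) - laplace h s) / (X (n + N) - s)) \<longlonglongrightarrow> laplace (\<lambda>t. of_real t * h t) s"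
      by (simp add: laplace_def)
    then show "((\<lambda>y. (laplace h y - laplace h s) / (y - s)) \<circ> X) \<longlonglongrightarrow> laplace (\<lambda>t. of_real t * h t) s"
      unfolding o_def by (rule LIMSEQ_offset)
  qed
qed

lemma laplace_holomorphic:
  fixes h :: "real \<Rightarrow> complex"
  assumes "h \<in> borel_measurable lborel"
    and "\<And>\<sigma>. \<alpha> < \<sigma> \<Longrightarrow> \<sigma> < \<beta> \<Longrightarrow> integrable lborel (\<lambda>t. exp (\<sigma> * t) * norm (h t))"
  shows "laplace h holomorphic_on {s. \<alpha> < Re s \<and> Re s < \<beta>}"
  unfolding holomorphic_on_def
  using has_field_derivative_at_within[OF laplace_has_field_derivative[OF assms]]
  by (force simp: field_differentiable_def)

lemma laplace_entire:
  fixes h :: "real \<Rightarrow> complex"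
  assumes "h \<in> borel_measurable lborel"
    and "\<And>\<sigma>. integrable lborel (\<lambda>t. exp (\<sigma> * t) * norm (h t))"
  shows "laplace h holomorphic_on UNIV"
  unfolding holomorphic_on_def
proof
  fix s :: complex show "laplace h field_differentiable at s"
    unfolding field_differentiable_def
    using laplace_has_field_derivative[of h "Re s - 1" "Re s + 1" s] assms by auto
qed

subsection \<open>The Gamma function as a Laplace transform\<close>

text \<open>Euler's integral under the substitution \<open>u = exp t\<close>.\<close>

lemma gamma_exp_integral_real:
  fixes x :: real
  assumes "0 < x"
  shows "integrable lborel (\<lambda>t. exp (x * t) * exp (- exp t))"
    and "(LINT t|lborel. exp (x * t) * exp (- exp t)) = Gamma x"
proof -
  define f where "f u = u powr (x - 1) / exp u" for u :: real
  have *: "(\<lambda>u. complex_of_real u powr (complex_of_real x - 1) / of_real (exp u)) absolutely_integrable_on {0<..}"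
    using absolutely_integrable_Gamma_integral'[of "complex_of_real x"] assms by simp
  have fabs: "f absolutely_integrable_on {0<..}"
  proof -
    have "(\<lambda>u. norm (complex_of_real u powr (complex_of_real x - 1) / of_real (exp u))) absolutely_integrable_on {0<..}"
      using absolutely_integrable_norm[OF *] by (simp add: o_def)
    then show ?thesis
      unfolding set_integrable_def
      by (rule Bochner_Integration.integrable_cong[THEN iffD1, rotated -1])
         (auto simp: f_def norm_divide norm_powr_real_powr indicator_def)
  qed
  have "(f has_integral Gamma x) {0..}"
    using Gamma_integral_real[OF assms] by (simp add: f_def[abs_def])
  \<comment> \<open>The image of \<open>exp\<close> is the open half-line, so the endpoint 0 is
    dropped as a null set.\<close>
  then have "(f has_integral Gamma x) {0<..}"
    by (subst (asm) has_integral_spike_set_eq[where T = "{0<..}"])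
       (auto intro: negligible_subset[of "{0}"])
  then have fint: "integral {0<..} f = Gamma x" by (rule integral_unique)
  have img: "range (exp :: real \<Rightarrow> real) = {0<..}"
  proof (intro equalityI subsetI)
    fix y :: real assume "y \<in> {0<..}"
    then show "y \<in> range exp" by (intro image_eqI[of _ _ "ln y"]) auto
  qed auto
  have "(\<lambda>t. \<bar>exp t\<bar> * f (exp t)) absolutely_integrable_on UNIV \<and>
        integral UNIV (\<lambda>t. \<bar>exp t\<bar> * f (exp t)) = Gamma x"
    by (subst has_absolute_integral_change_of_variables_1'[where g = exp and g' = exp])
       (use fabs fint img in \<open>auto intro!: derivative_eq_intros simp: inj_on_def\<close>)
  also have "(\<lambda>t. \<bar>exp t\<bar> * f (exp t)) = (\<lambda>t. exp (x * t) * exp (- exp t))"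
    by (auto simp: f_def fun_eq_iff powr_def exp_minus exp_diff field_simps)
  finally have A: "(\<lambda>t. exp (x * t) * exp (- exp t)) absolutely_integrable_on UNIV"
      and B: "integral UNIV (\<lambda>t. exp (x * t) * exp (- exp t)) = Gamma x" by auto
  have m: "(\<lambda>t::real. exp (x * t) * exp (- exp t)) \<in> borel_measurable borel"
    by measurable
  show 1: "integrable lborel (\<lambda>t. exp (x * t) * exp (- exp t))"
    using A integrable_completion[of "\<lambda>t. exp (x * t) * exp (- exp t)" lborel] m
    by (simp add: set_integrable_def)
  show "(LINT t|lborel. exp (x * t) * exp (- exp t)) = Gamma x"
    using integral_lborel[OF 1] B by simp
qed

lemma integrable_exp_exp:
  fixes x l :: real
  assumes "0 < x" "0 < l"
  shows "integrable lborel (\<lambda>t. exp (x * t) * exp (- l * exp t))"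
proof -
  have "integrable lborel (\<lambda>t. exp (x * (ln l + 1 * t)) * exp (- exp (ln l + 1 * t)))"
    using lborel_integrable_real_affine[OF gamma_exp_integral_real(1)[OF assms(1)], of 1 "ln l"] by simp
  then have "integrable lborel (\<lambda>t. exp (- x * ln l) * (exp (x * (ln l + 1 * t)) * exp (- exp (ln l + 1 * t))))"
    by (rule integrable_mult_right)
  also have "(\<lambda>t. exp (- x * ln l) * (exp (x * (ln l + 1 * t)) * exp (- exp (ln l + 1 * t)))) =
             (\<lambda>t. exp (x * t) * exp (- l * exp t))"
    using assms by (auto simp: exp_add algebra_simps exp_minus fun_eq_iff)
  finally show ?thesis .
qed

lemma integrable_exp_mult_exp_exp:
  assumes "0 < Re s" "0 < l"
  shows "integrable lborel (\<lambda>t. exp (s * of_real t) * of_real (exp (- l * exp t)))"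
  by (rule integrable_laplace) (use integrable_exp_exp[OF assms] in auto)

text \<open>For \<open>l = 1\<close> and real \<open>s\<close> this is Euler's integral; both sides
  are holomorphic on the right half-plane, so the identity theorem reaches complex \<open>s\<close>.
  A general \<open>l\<close> is the translation \<open>t \<mapsto> ln l + t\<close>, which produces
  the power of \<open>l\<close>.\<close>

lemma laplace_exp_exp:
  assumes "0 < Re s" "0 < l"
  shows "laplace (\<lambda>t. of_real (exp (- l * exp t))) s = of_real l powr (- s) * Gamma s"
proof -
  have unit: "laplace (\<lambda>t. of_real (exp (- exp t))) z = Gamma z" if "0 < Re z" for z
  proof -
    define H where "H = {z :: complex. 0 < Re z}"
    have H: "open H" "connected H"
      by (auto simp: H_def open_halfspace_Re_gt convex_connected convex_halfspace_Re_gt)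
    have hol: "laplace (\<lambda>t. of_real (exp (- exp t))) holomorphic_on H"
      unfolding holomorphic_on_open[OF H(1)]
    proof
      fix z assume "z \<in> H"
      then show "\<exists>f'. (laplace (\<lambda>t. of_real (exp (- exp t))) has_field_derivative f') (at z)"
        using laplace_has_field_derivative[of "\<lambda>t. of_real (exp (- exp t))" 0 "Re z + 1" z]
              integrable_exp_exp[of _ 1]
        by (auto simp: H_def)
    qed
    have "Gamma holomorphic_on H"
      by (rule holomorphic_Gamma) (auto simp: H_def elim!: nonpos_Ints_cases)
    then have "(\<lambda>z. laplace (\<lambda>t. of_real (exp (- exp t))) z - Gamma z) holomorphic_on H"
      using hol by (intro holomorphic_on_diff)
    moreover have "(1::complex) islimpt (of_real ` {0<..})"
    proof -
      have "(\<lambda>n. complex_of_real (1 + inverse (real (Suc n)))) \<longlonglongrightarrow> of_real (1 + 0)"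
        by (intro tendsto_intros LIMSEQ_inverse_real_of_nat)
      then show ?thesis
        unfolding islimpt_sequential
        by (intro exI[of _ "\<lambda>n. complex_of_real (1 + inverse (real (Suc n)))"])
           (auto simp del: of_real_add intro!: imageI add_pos_pos)
    qed
    moreover have "laplace (\<lambda>t. of_real (exp (- exp t))) w - Gamma w = 0" if "w \<in> of_real ` {0<..}" for w
    proof -
      obtain x where x: "w = of_real x" "0 < x" using \<open>w \<in> _\<close> by auto
      have "laplace (\<lambda>t. of_real (exp (- exp t))) w = (LINT t|lborel. of_real (exp (x * t) * exp (- exp t)))"
        by (simp add: laplace_def x exp_of_real[symmetric] del: exp_of_real)
      also have "\<dots> = of_real (LINT t|lborel. exp (x * t) * exp (- exp t))"
        by (rule integral_complex_of_real)
      finally show ?thesis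
        using gamma_exp_integral_real(2)[OF x(2)] x by (simp add: Gamma_complex_of_real)
    qed
    moreover have "of_real ` {0<..} \<subseteq> H" "1 \<in> H" "z \<in> H"
      using that by (auto simp: H_def)
    ultimately have "laplace (\<lambda>t. of_real (exp (- exp t))) z - Gamma z = 0"
      using analytic_continuation[OF _ H] by blast
    then show ?thesis by simp
  qed
  have "Gamma s = (LINT t|lborel. exp (s * of_real t) * of_real (exp (- exp t)))"
    using unit[OF assms(1)] by (simp add: laplace_def)
  also have "\<dots> = (LINT t|lborel. exp (s * of_real (ln l + 1 * t)) * of_real (exp (- exp (ln l + 1 * t))))"
    by (subst lborel_integral_real_affine[where c = 1 and t = "ln l"]) auto
  also have "\<dots> = (LINT t|lborel. exp (s * of_real (ln l)) * (exp (s * of_real t) * of_real (exp (- l * exp t))))"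
    using assms(2) by (intro Bochner_Integration.integral_cong refl) (simp add: exp_add algebra_simps)
  also have "\<dots> = exp (s * of_real (ln l)) * laplace (\<lambda>t. of_real (exp (- l * exp t))) s"
    by (simp add: laplace_def)
  finally show ?thesis
    using assms(2) by (simp add: powr_def exp_minus Ln_of_real field_simps)
qed

subsection \<open>Unconditional sums\<close>

text \<open>Enumerating \<open>A\<close> reduces the exchange to ordinary series, and absolute
  convergence translates these back into unconditional sums. \<open>A\<close> is infinite so that
  the enumeration is a bijection with all of \<open>nat\<close>.\<close>

lemma integral_infsum:
  fixes f :: "'i \<Rightarrow> 'b \<Rightarrow> complex"
  assumes A: "countable A" "infinite A"
    and int: "\<And>i. i \<in> A \<Longrightarrow> integrable M (f i)"
    and pointwise: "\<And>t. t \<in> space M \<Longrightarrow> (\<lambda>i. norm (f i t)) summable_on A"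
    and total: "(\<lambda>i. LINT t|M. norm (f i t)) summable_on A"
  shows "integrable M (\<lambda>t. \<Sum>\<^sub>\<infinity>i\<in>A. f i t)"
    and "(\<lambda>i. LINT t|M. f i t) summable_on A"
    and "(LINT t|M. (\<Sum>\<^sub>\<infinity>i\<in>A. f i t)) = (\<Sum>\<^sub>\<infinity>i\<in>A. LINT t|M. f i t)"
proof -
  obtain g :: "nat \<Rightarrow> 'i" where g: "bij_betw g UNIV A"
    using A bij_betw_from_nat_into by blast
  have gA: "g n \<in> A" for n using g by (auto simp: bij_betw_def)
  have nn: "summable (\<lambda>n. norm (f (g n) t))" if "t \<in> space M" for t
    using pointwise[OF that] summable_on_reindex_bij_betw[OF g, of "\<lambda>i. norm (f i t)"]
      summable_on_imp_summable by blast
  have tot: "(\<lambda>n. LINT t|M. norm (f (g n) t)) summable_on UNIV"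
    using total summable_on_reindex_bij_betw[OF g, of "\<lambda>i. LINT t|M. norm (f i t)"] by simp
  then have tot': "summable (\<lambda>n. LINT t|M. norm (f (g n) t))"
    by (rule summable_on_imp_summable)
  have inf_eq: "(\<Sum>\<^sub>\<infinity>i\<in>A. f i t) = (\<Sum>n. f (g n) t)" if "t \<in> space M" for t
  proof -
    have "(\<Sum>\<^sub>\<infinity>i\<in>A. f i t) = (\<Sum>\<^sub>\<infinity>n. f (g n) t)"
      using infsum_reindex_bij_betw[OF g, of "\<lambda>i. f i t"] by simp
    also have "\<dots> = (\<Sum>n. f (g n) t)"
      using norm_summable_imp_has_sum[OF nn[OF that] summable_sums[OF summable_norm_cancel[OF nn[OF that]]]]
      by (rule infsumI)
    finally show ?thesis .
  qed
  have ae: "AE t in M. summable (\<lambda>n. norm (f (g n) t))" by (rule AE_I2) (rule nn)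
  note swap = integrable_suminf[OF int[OF gA] ae tot'] integral_suminf[OF int[OF gA] ae tot']
  show "integrable M (\<lambda>t. \<Sum>\<^sub>\<infinity>i\<in>A. f i t)"
    using swap(1) by (subst Bochner_Integration.integrable_cong[OF refl inf_eq]) auto
  have abs: "(\<lambda>n. norm (LINT t|M. f (g n) t)) summable_on UNIV"
    by (rule Infinite_Sum.abs_summable_on_comparison_test'[OF tot]) (rule integral_norm_bound)
  show "(\<lambda>i. LINT t|M. f i t) summable_on A"
    using summable_on_reindex_bij_betw[OF g, of "\<lambda>i. LINT t|M. f i t"] Infinite_Sum.abs_summable_summable[OF abs]
    by simp
  have "(LINT t|M. (\<Sum>\<^sub>\<infinity>i\<in>A. f i t)) = (LINT t|M. (\<Sum>n. f (g n) t))"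
    by (intro Bochner_Integration.integral_cong refl inf_eq)
  also have "\<dots> = (\<Sum>n. LINT t|M. f (g n) t)" by (rule swap(2))
  also have "\<dots> = (\<Sum>\<^sub>\<infinity>n. LINT t|M. f (g n) t)"
    using has_sum_imp_sums[OF has_sum_infsum[OF Infinite_Sum.abs_summable_summable[OF abs]]] sums_unique by metis
  also have "\<dots> = (\<Sum>\<^sub>\<infinity>i\<in>A. LINT t|M. f i t)"
    using infsum_reindex_bij_betw[OF g, of "\<lambda>i. LINT t|M. f i t"] by simp
  finally show "(LINT t|M. (\<Sum>\<^sub>\<infinity>i\<in>A. f i t)) = (\<Sum>\<^sub>\<infinity>i\<in>A. LINT t|M. f i t)" .
qed

lemma summable_on_product_real:
  fixes f :: "'a \<Rightarrow> real" and g :: "'b \<Rightarrow> real"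
  assumes f: "f summable_on A" "\<And>x. x \<in> A \<Longrightarrow> 0 \<le> f x"
    and g: "g summable_on B" "\<And>y. y \<in> B \<Longrightarrow> 0 \<le> g y"
  shows "(\<lambda>(x, y). f x * g y) summable_on A \<times> B"
proof (rule summable_on_SigmaI)
  show "((\<lambda>y. (case (x, y) of (x, y) \<Rightarrow> f x * g y)) has_sum f x * infsum g B) B" for x
    using has_sum_cmult_right[OF has_sum_infsum[OF g(1)], of "f x"] by simp
  show "(\<lambda>x. f x * infsum g B) summable_on A"
    using f(1) by (rule summable_on_cmult_left)
qed (use f g in auto)

lemma infsum_product_abs:
  fixes f :: "'a \<Rightarrow> complex" and g :: "'b \<Rightarrow> complex"
  assumes "(\<lambda>x. norm (f x)) summable_on A" "(\<lambda>y. norm (g y)) summable_on B"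
  shows "(\<Sum>\<^sub>\<infinity>(x, y)\<in>A \<times> B. f x * g y) = infsum f A * infsum g B"
proof -
  have "(\<lambda>p. norm (case p of (x, y) \<Rightarrow> f x * g y)) summable_on A \<times> B"
    using summable_on_product_real[OF assms(1) _ assms(2)]
    by (simp add: case_prod_unfold norm_mult)
  then have "(\<lambda>(x, y). f x * g y) summable_on A \<times> B"
    by (rule Infinite_Sum.abs_summable_summable)
  then have "(\<Sum>\<^sub>\<infinity>(x, y)\<in>A \<times> B. f x * g y) = (\<Sum>\<^sub>\<infinity>x\<in>A. \<Sum>\<^sub>\<infinity>y\<in>B. f x * g y)"
    by (rule infsum_Sigma'_banach[symmetric])
  also have "\<dots> = infsum f A * infsum g B"
    by (simp add: infsum_cmult_right' infsum_cmult_left')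
  finally show ?thesis .
qed

subsection \<open>Theta series\<close>

text \<open>Without the constant term the series decays exponentially at infinity, which the Laplace
  transforms rely on; the modular relation adds \<open>a 0\<close> back.\<close>

definition theta :: "(nat \<Rightarrow> complex) \<Rightarrow> (nat \<Rightarrow> real) \<Rightarrow> complex \<Rightarrow> complex" where
  "theta a lam z = (\<Sum>\<^sub>\<infinity>n\<in>{1..}. a n * exp (- of_real (lam n) * z))"

text \<open>From \<open>ln x \<le> x - 1\<close> at \<open>x = y / c\<close>; the point
  \<open>y = c\<close> is where \<open>y powr c * exp (- y)\<close> is largest.\<close>

lemma powr_mult_exp_minus_le:
  fixes c y :: real
  assumes "0 < c" "0 < y"
  shows "exp (- y) \<le> c powr c * y powr (- c)"
proof -
  have "ln (y / c) \<le> y / c - 1" using assms by (intro ln_le_minus_one) simp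
  then have "c * (ln y - ln c) \<le> c * (y / c - 1)"
    using assms by (intro mult_left_mono) (auto simp: ln_div)
  then have "- y \<le> c * ln c + - c * ln y"
    using assms by (simp add: algebra_simps)
  then have "exp (- y) \<le> exp (c * ln c + - c * ln y)" by simp
  also have "\<dots> = c powr c * y powr (- c)"
    using assms by (simp add: powr_def mult_exp_exp)
  finally show ?thesis .
qed

text \<open>Half of the exponential pays for the power, the other half keeps the decay.\<close>

lemma exp_minus_le_powr_exp:
  fixes c l l1 x :: real
  assumes "0 < c" "0 < l1" "l1 \<le> l" "0 < x"
  shows "exp (- l * x) \<le> (2 * c) powr c * x powr (- c) * exp (- (l1 / 2) * x) * l powr (- c)"
proof -
  have "exp (- (l * x / 2)) \<le> c powr c * (l * x / 2) powr (- c)"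
    using assms by (intro powr_mult_exp_minus_le) auto
  also have "\<dots> = (2 * c) powr c * x powr (- c) * l powr (- c)"
    using assms by (simp add: powr_mult powr_divide powr_minus field_simps)
  finally have 1: "exp (- (l * x / 2)) \<le> (2 * c) powr c * x powr (- c) * l powr (- c)" .
  have 2: "exp (- (l * x / 2)) \<le> exp (- (l1 / 2) * x)" using assms by simp
  have "exp (- l * x) = exp (- (l * x / 2)) * exp (- (l * x / 2))"
    by (simp add: mult_exp_exp)
  also have "\<dots> \<le> ((2 * c) powr c * x powr (- c) * l powr (- c)) * exp (- (l1 / 2) * x)"
    using 1 2 by (intro mult_mono) auto
  finally show ?thesis by (simp add: mult_ac)
qed

text \<open>The point \<open>c\<close> of absolute convergence is a parameter: two series can share
  one \<open>c\<close>, so that their powers of \<open>exp t\<close> cancel, and the same series can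
  be used at several points.\<close>

locale abs_dirichlet =
  fixes a :: "nat \<Rightarrow> complex" and lam :: "nat \<Rightarrow> real" and c :: real
  assumes lam1_pos: "0 < lam 1"
    and lam1_le: "n \<ge> 1 \<Longrightarrow> lam 1 \<le> lam n"
    and c_pos: "0 < c"
    and abs_summable: "(\<lambda>n. norm (a n) * lam n powr (- c)) summable_on {1..}"
begin

lemma lam_pos: "n \<ge> 1 \<Longrightarrow> 0 < lam n"
  using lam1_pos lam1_le[of n] by linarith

definition bnd :: real where
  "bnd = (2 * c) powr c * (\<Sum>\<^sub>\<infinity>n\<in>{1..}. norm (a n) * lam n powr (- c))"

lemma bnd_nonneg: "0 \<le> bnd"
  unfolding bnd_def by (intro mult_nonneg_nonneg infsum_nonneg) auto

lemma theta_term_le: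
  assumes "n \<ge> 1" "0 < x"
  shows "norm (a n) * exp (- lam n * x) \<le>
    (2 * c) powr c * x powr (- c) * exp (- (lam 1 / 2) * x) * (norm (a n) * lam n powr (- c))"
  using mult_left_mono[OF exp_minus_le_powr_exp[OF c_pos lam1_pos lam1_le[OF assms(1)] assms(2)], of "norm (a n)"]
  by (simp add: mult_ac)

lemma theta_abs_summable:
  assumes "0 < x"
  shows "(\<lambda>n. norm (a n) * exp (- lam n * x)) summable_on {1..}"
proof -
  have "(\<lambda>n. norm (norm (a n) * exp (- lam n * x))) summable_on {1..}"
    by (rule Infinite_Sum.abs_summable_on_comparison_test'[OF summable_on_cmult_right[OF abs_summable]])
       (use theta_term_le assms in auto)
  then show ?thesis by simp
qed

lemma norm_theta_term: "norm (a n * exp (- of_real (lam n) * z)) = norm (a n) * exp (- lam n * Re z)"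
  by (simp add: norm_mult norm_exp_eq_Re)

lemma theta_summable:
  assumes "0 < Re z"
  shows "(\<lambda>n. norm (a n * exp (- of_real (lam n) * z))) summable_on {1..}"
  unfolding norm_theta_term using assms by (rule theta_abs_summable)

lemma theta_abs_le:
  assumes "0 < x"
  shows "(\<Sum>\<^sub>\<infinity>n\<in>{1..}. norm (a n) * exp (- lam n * x)) \<le> bnd * x powr (- c) * exp (- (lam 1 / 2) * x)"
proof -
  have "(\<Sum>\<^sub>\<infinity>n\<in>{1..}. norm (a n) * exp (- lam n * x)) \<le>
     (\<Sum>\<^sub>\<infinity>n\<in>{1..}. ((2 * c) powr c * x powr (- c) * exp (- (lam 1 / 2) * x)) * (norm (a n) * lam n powr (- c)))"
    by (intro infsum_mono theta_abs_summable summable_on_cmult_right abs_summable theta_term_le)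
       (use assms in auto)
  also have "\<dots> = bnd * x powr (- c) * exp (- (lam 1 / 2) * x)"
    by (subst infsum_cmult_right') (simp add: bnd_def mult_ac)
  finally show ?thesis .
qed

lemma norm_theta_le:
  assumes "0 < Re z"
  shows "norm (theta a lam z) \<le> bnd * Re z powr (- c) * exp (- (lam 1 / 2) * Re z)"
proof -
  have "norm (theta a lam z) \<le> (\<Sum>\<^sub>\<infinity>n\<in>{1..}. norm (a n * exp (- of_real (lam n) * z)))"
    unfolding theta_def by (rule norm_infsum_bound) (use theta_summable[OF assms] in auto)
  also have "\<dots> \<le> bnd * Re z powr (- c) * exp (- (lam 1 / 2) * Re z)"
    unfolding norm_theta_term using assms by (rule theta_abs_le)
  finally show ?thesis .
qed

lemma theta_holomorphic: "theta a lam holomorphic_on {z. 0 < Re z}"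
proof -
  have op: "open {z. 0 < Re z}" by (rule open_halfspace_Re_gt)
  show ?thesis
    unfolding holomorphic_on_open[OF op]
  proof
    fix z assume z: "z \<in> {z. 0 < Re z}"
    \<comment> \<open>Half the distance to the imaginary axis: on the closed disc of this radius the
      real part stays at least \<open>x\<close>, so the series at \<open>x\<close> is a Weierstrass
      majorant.\<close>
    define x where "x = Re z / 2"
    have x: "0 < x" using z by (simp add: x_def)
    have Re_ge: "Re w \<ge> x" if "w \<in> cball z x" for w
      using that abs_Re_le_cmod[of "z - w"] by (auto simp: dist_norm x_def)
    have le: "norm (a n * exp (- of_real (lam n) * w)) \<le> norm (a n) * exp (- lam n * x)"
      if "n \<in> {1..}" "w \<in> cball z x" for n w
      unfolding norm_theta_term using Re_ge[OF that(2)] lam_pos[of n] that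
      by (intro mult_left_mono) auto
    have "uniform_limit (cball z x) (\<lambda>X w. \<Sum>n\<in>X. a n * exp (- of_real (lam n) * w)) (theta a lam)
            (finite_subsets_at_top {1..})"
      unfolding theta_def[abs_def]
      by (rule Weierstrass_m_test_general[OF le theta_abs_summable[OF x]])
    then have "theta a lam holomorphic_on ball z x"
    proof (rule holomorphic_uniform_limit[rotated 1])
      show "\<forall>\<^sub>F X in finite_subsets_at_top {1..}.
          continuous_on (cball z x) (\<lambda>w. \<Sum>n\<in>X. a n * exp (- of_real (lam n) * w)) \<and>
          (\<lambda>w. \<Sum>n\<in>X. a n * exp (- of_real (lam n) * w)) holomorphic_on ball z x"
        by (intro always_eventually allI conjI continuous_intros holomorphic_intros)
    qed auto
    then show "\<exists>f'. (theta a lam has_field_derivative f') (at z)"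
      using x by (auto simp: holomorphic_on_open)
  qed
qed

lemma continuous_on_theta_exp: "continuous_on UNIV (\<lambda>t. theta a lam (of_real (exp t)))"
  by (rule continuous_on_compose2[OF holomorphic_on_imp_continuous_on[OF theta_holomorphic]])
     (auto intro!: continuous_intros)

lemma theta_exp_measurable [measurable]: "(\<lambda>t. theta a lam (of_real (exp t))) \<in> borel_measurable borel"
  by (rule borel_measurable_continuous_onI) (rule continuous_on_theta_exp)

lemma norm_theta_exp_le:
  "norm (theta a lam (of_real (exp t))) \<le> bnd * exp (- c * t) * exp (- (lam 1 / 2) * exp t)"
  using norm_theta_le[of "of_real (exp t)"] by (simp add: powr_def)

text \<open>Termwise integration. The integrals of the norms are \<open>Gamma (Re s)\<close> times
  the terms of the absolutely convergent series at \<open>Re s\<close>, which is what the exchange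
  asks for.\<close>

lemma laplace_theta:
  assumes "Re s \<ge> c"
  shows "integrable lborel (\<lambda>t. exp (s * of_real t) * theta a lam (of_real (exp t)))"
    and "laplace (\<lambda>t. theta a lam (of_real (exp t))) s = Gamma s * dirichlet_series a lam s"
proof -
  define f where "f n t = a n * (exp (s * of_real t) * of_real (exp (- lam n * exp t)))" for n t
  have s: "0 < Re s" using assms c_pos by linarith
  have fint: "integrable lborel (f n)" if "n \<in> {1..}" for n
    unfolding f_def using that lam_pos[of n] s
    by (intro integrable_mult_right integrable_exp_mult_exp_exp) auto
  have normf: "norm (f n t) = exp (Re s * t) * (norm (a n) * exp (- lam n * exp t))" for n t
    by (simp add: f_def norm_mult norm_exp_mult_of_real)
  have pw: "(\<lambda>n. norm (f n t)) summable_on {1..}" for t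
    unfolding normf by (intro summable_on_cmult_right theta_abs_summable) auto
  have nint: "(LINT t|lborel. norm (f n t)) = Gamma (Re s) * (norm (a n) * lam n powr (- Re s))"
    if "n \<in> {1..}" for n
  proof -
    \<comment> \<open>The real integral is read off from the complex transform at the real point
      \<open>Re s\<close>.\<close>
    have "complex_of_real (LINT t|lborel. exp (Re s * t) * exp (- lam n * exp t)) =
          (LINT t|lborel. complex_of_real (exp (Re s * t) * exp (- lam n * exp t)))"
      by (rule integral_complex_of_real[symmetric])
    also have "\<dots> = laplace (\<lambda>t. of_real (exp (- lam n * exp t))) (of_real (Re s))"
      by (simp add: laplace_def exp_of_real flip: of_real_mult)
    also have "\<dots> = of_real (lam n powr (- Re s) * Gamma (Re s))"
      using that lam_pos[of n] s
      by (subst laplace_exp_exp) (auto simp: Gamma_complex_of_real powr_of_real simp flip: of_real_minus)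
    finally have "(LINT t|lborel. exp (Re s * t) * exp (- lam n * exp t)) = lam n powr (- Re s) * Gamma (Re s)"
      using of_real_eq_iff by blast
    moreover have "(LINT t|lborel. norm (f n t)) = norm (a n) * (LINT t|lborel. exp (Re s * t) * exp (- lam n * exp t))"
      unfolding normf by (subst integral_mult_right_zero[symmetric]) (simp add: mult_ac)
    ultimately show ?thesis by (simp add: mult_ac)
  qed
  have "(\<lambda>n. norm (norm (a n) * lam n powr (- Re s))) summable_on {1..}"
  proof (rule Infinite_Sum.abs_summable_on_comparison_test'[OF summable_on_cmult_right[OF abs_summable]])
    fix n :: nat assume n: "n \<in> {1..}"
    \<comment> \<open>The surplus power has a nonpositive exponent, so it is largest at the smallest
      value \<open>lam 1\<close>.\<close>
    have "lam n powr (- Re s) = lam n powr (- (Re s - c)) * lam n powr (- c)"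
      by (simp flip: powr_add)
    also have "\<dots> \<le> lam 1 powr (- (Re s - c)) * lam n powr (- c)"
      using n assms lam1_pos lam1_le[of n] by (intro mult_right_mono powr_mono2') auto
    finally show "norm (norm (a n) * lam n powr (- Re s)) \<le> lam 1 powr (- (Re s - c)) * (norm (a n) * lam n powr (- c))"
      using mult_left_mono[of _ _ "norm (a n)"] by (fastforce simp: mult_ac)
  qed
  then have "(\<lambda>n. Gamma (Re s) * (norm (a n) * lam n powr (- Re s))) summable_on {1..}"
    by (intro summable_on_cmult_right) simp
  then have tot: "(\<lambda>n. LINT t|lborel. norm (f n t)) summable_on {1..}"
    by (subst summable_on_cong[OF nint])
  have th: "(\<Sum>\<^sub>\<infinity>n\<in>{1..}. f n t) = exp (s * of_real t) * theta a lam (of_real (exp t))" for t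
    unfolding theta_def f_def infsum_cmult_right'[symmetric]
    by (intro infsum_cong) (simp add: exp_of_real mult_ac flip: of_real_mult of_real_minus)
  have "infinite {1::nat..}" by (rule infinite_Ici)
  note swap = integral_infsum[OF countableI_type this fint pw tot]
  show "integrable lborel (\<lambda>t. exp (s * of_real t) * theta a lam (of_real (exp t)))"
    using swap(1) unfolding th by simp
  have "laplace (\<lambda>t. theta a lam (of_real (exp t))) s = (\<Sum>\<^sub>\<infinity>n\<in>{1..}. LINT t|lborel. f n t)"
    using swap(3) unfolding th laplace_def by simp
  also have "\<dots> = (\<Sum>\<^sub>\<infinity>n\<in>{1..}. Gamma s * dirichlet_term a lam s n)"
  proof (rule infsum_cong)
    fix n :: nat assume "n \<in> {1..}"
    then show "(LINT t|lborel. f n t) = Gamma s * dirichlet_term a lam s n"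
      using laplace_exp_exp[OF s lam_pos, of n]
      by (simp add: f_def laplace_def dirichlet_term_def mult_ac)
  qed
  also have "\<dots> = Gamma s * dirichlet_series a lam s"
    by (simp add: infsum_cmult_right' dirichlet_series_def)
  finally show "laplace (\<lambda>t. theta a lam (of_real (exp t))) s = Gamma s * dirichlet_series a lam s" .
qed

end

subsection \<open>Dirichlet series of class A\<close>

lemma not_nonpos_Int_if_Re: "0 < Re s \<Longrightarrow> s \<notin> \<int>\<^sub>\<le>\<^sub>0"
  by (auto elim!: nonpos_Ints_cases)

lemma not_nonpos_Int_if_Im: "Im s \<noteq> 0 \<Longrightarrow> s \<notin> \<int>\<^sub>\<le>\<^sub>0"
  by (auto elim!: nonpos_Ints_cases)

text \<open>A meromorphic function may carry stray values at removable singularities, so the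
  identity theorem is applied to \<open>remove_sings D\<close>; at a point of analyticity this
  agrees with \<open>D\<close>.\<close>

lemma meromorphic_eq_0I:
  assumes "D meromorphic_on UNIV" "open S" "S \<noteq> {}" "\<And>w. w \<in> S \<Longrightarrow> D w = 0" "D analytic_on {z}"
  shows "D z = 0"
proof -
  have *: "remove_sings D w = 0" if "w \<in> S" for w
  proof -
    have "D analytic_on S"
      unfolding analytic_on_open[OF assms(2)]
      by (rule holomorphic_transform[of "\<lambda>_. 0"]) (use assms(4) in auto)
    then show ?thesis using that assms(4) analytic_on_subset by fastforce
  qed
  have "remove_sings D constant_on UNIV"
  proof (rule constant_on_extend_nicely_meromorphic_on[where A = S])
    show "remove_sings D nicely_meromorphic_on UNIV"
      using assms(1) by (rule remove_sings_nicely_meromorphic)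
    show "remove_sings D constant_on S" using * by (auto simp: constant_on_def)
  qed (use assms in auto)
  then have "remove_sings D z = 0"
    using * assms(3) by (auto simp: constant_on_def)
  then show ?thesis using assms(5) by simp
qed

text \<open>Carries an identity across the one point that its derivation excludes.\<close>

lemma isCont_eqI:
  fixes f g :: "complex \<Rightarrow> complex"
  assumes "isCont f p" "isCont g p" "open S" "p \<in> S" "\<And>w. w \<in> S \<Longrightarrow> w \<noteq> p \<Longrightarrow> f w = g w"
  shows "f p = g p"
proof -
  have ev: "eventually (\<lambda>w. f w = g w) (at p)"
    using assms(3-5) unfolding eventually_at_topological by blast
  have "(f \<longlongrightarrow> g p) (at p)"
    using assms(2) unfolding isCont_def tendsto_cong[OF ev] .
  then show ?thesis using assms(1) LIM_unique unfolding isCont_def by blast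
qed

text \<open>Subtracting the principal part leaves an entire function. The residue of a genuine
  simple pole is nonzero, so the last clause concerns the case without a pole, where nice meromorphy
  rules out a stray value at \<open>p\<close>.\<close>

lemma simple_pole_decomposition:
  assumes "F nicely_meromorphic_on UNIV" "only_possible_pole_simple_at F p"
  obtains h where "h holomorphic_on UNIV" "\<And>s. s \<noteq> p \<Longrightarrow> F s = h s + residue F p / (s - p)"
    "residue F p = 0 \<Longrightarrow> F p = h p"
proof (cases "is_pole F p")
  case False
  have "F analytic_on {p}" using assms(1) False by (intro nicely_meromorphic_on_imp_analytic_at) auto
  then have "F analytic_on ({p} \<union> - {p})"
    using assms(2) by (subst analytic_on_Un) (auto simp: only_possible_pole_simple_at_def)
  then have hol: "F holomorphic_on UNIV" by (simp add: analytic_imp_holomorphic)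
  moreover have "residue F p = 0" using residue_holo[OF open_UNIV _ hol] by auto
  ultimately show ?thesis by (intro that[of F]) auto
next
  case True
  have an: "F analytic_on - {p}" and z: "zorder F p = - 1"
    using assms(2) True by (auto simp: only_possible_pole_simple_at_def)
  have hol: "F holomorphic_on UNIV - {p}"
    using analytic_imp_holomorphic[OF an] by (simp add: Compl_eq_Diff_UNIV)
  have iso: "isolated_singularity_at F p"
    using isolated_singularity_at_holomorphic[OF hol] by auto
  obtain e where e: "0 < e" "zor_poly F p p \<noteq> 0" "zor_poly F p holomorphic_on cball p e"
     "\<And>w. w \<in> cball p e - {p} \<Longrightarrow> F w = zor_poly F p w / (w - p)"
    using zorder_exist_pole[OF hol open_UNIV _ True] z by auto
  have res: "residue F p = zor_poly F p p"
    by (rule residue_simple_pole) fact+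
  \<comment> \<open>\<open>(s - p) * F s\<close> with its removable singularity filled by the
    residue; \<open>pole_theorem_open\<close> divides the increment of \<open>g\<close> by
    \<open>s - p\<close>.\<close>
  define g where "g s = (if s = p then residue F p else (s - p) * F s)" for s
  have "g holomorphic_on (- {p}) \<union> ball p e"
  proof (rule holomorphic_on_Un)
    have "(\<lambda>s. (s - p) * F s) holomorphic_on - {p}"
      using analytic_imp_holomorphic[OF an] by (intro holomorphic_intros)
    then show "g holomorphic_on - {p}"
      by (rule holomorphic_transform) (auto simp: g_def)
    have "zor_poly F p holomorphic_on ball p e" using e(3) by (rule holomorphic_on_subset) auto
    then show "g holomorphic_on ball p e"
      by (rule holomorphic_transform) (use e in \<open>auto simp: g_def res\<close>)
  qed auto
  also have "(- {p}) \<union> ball p e = UNIV" using e(1) by auto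
  finally have "(\<lambda>z. if z = p then deriv g p else F z - g p / (z - p)) holomorphic_on UNIV"
    by (rule pole_theorem_open) (auto simp: g_def)
  then show ?thesis
    by (rule that) (use e(2) res in \<open>auto simp: g_def\<close>)
qed

lemma Gamma_meromorphic [meromorphic_intros]: "Gamma meromorphic_on (A :: complex set)"
proof -
  have "(\<lambda>z :: complex. inverse (rGamma z)) meromorphic_on A"
    by (intro meromorphic_intros analytic_on_imp_meromorphic_on analytic_rGamma)
  also have "(\<lambda>z :: complex. inverse (rGamma z)) = Gamma"
    by (simp add: fun_eq_iff rGamma_inverse_Gamma)
  finally show ?thesis .
qed

lemma exponent_seq_ge:
  assumes "exponent_seq lam" "n \<ge> 1"
  shows "lam 1 \<le> lam n"
  using assms unfolding exponent_seq_def strict_mono_on_def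
  by (cases "n = 1") (auto intro!: less_imp_le)

text \<open>The abscissa is an infimum, so absolute convergence holds at some point left of
  \<open>c\<close>, and moving right multiplies the terms by a bounded factor.\<close>

lemma dirichlet_norm_summable:
  assumes lam: "exponent_seq lam" and fin: "\<bar>abs_conv_abscissa a lam\<bar> \<noteq> \<infinity>"
    and c: "abscissa a lam < c"
  shows "(\<lambda>n. norm (a n) * lam n powr (- c)) summable_on {1..}"
proof -
  have lam1: "0 < lam 1" using lam by (auto simp: exponent_seq_def)
  have le: "lam 1 \<le> lam n" if "n \<ge> 1" for n using lam that by (rule exponent_seq_ge)
  have "abs_conv_abscissa a lam < ereal c"
    using fin c unfolding abscissa_def by (cases "abs_conv_abscissa a lam") auto
  then obtain s where s: "(\<lambda>n. norm (dirichlet_term a lam s n)) summable_on {1..}" "Re s < c"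
    unfolding abs_conv_abscissa_def Inf_less_iff by auto
  have norm_term: "norm (dirichlet_term a lam s n) = norm (a n) * lam n powr (- Re s)" if "n \<ge> 1" for n
    using le[OF that] lam1 by (simp add: dirichlet_term_def norm_mult norm_powr_real_powr)
  have "(\<lambda>n. norm (norm (a n) * lam n powr (- c))) summable_on {1..}"
  proof (rule Infinite_Sum.abs_summable_on_comparison_test'[OF summable_on_cmult_right[OF s(1)]])
    fix n :: nat assume n: "n \<in> {1..}"
    have "lam n powr (- c) = lam n powr (- (c - Re s)) * lam n powr (- Re s)"
      by (simp flip: powr_add)
    also have "\<dots> \<le> lam 1 powr (- (c - Re s)) * lam n powr (- Re s)"
      using n s(2) lam1 le[of n] by (intro mult_right_mono powr_mono2') auto
    finally have "norm (a n) * lam n powr (- c) \<le> norm (a n) * (lam 1 powr (- (c - Re s)) * lam n powr (- Re s))"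
      by (intro mult_left_mono) auto
    then show "norm (norm (a n) * lam n powr (- c)) \<le> lam 1 powr (- (c - Re s)) * norm (dirichlet_term a lam s n)"
      using n by (simp add: norm_term mult_ac)
  qed
  then show ?thesis by simp
qed

lemma abs_dirichletI:
  assumes "exponent_seq lam" "\<bar>abs_conv_abscissa a lam\<bar> \<noteq> \<infinity>" "0 < c" "abscissa a lam < c"
  shows "abs_dirichlet a lam c"
proof
  show "0 < lam 1" using assms(1) by (auto simp: exponent_seq_def)
  show "lam 1 \<le> lam n" if "n \<ge> 1" for n using assms(1) that by (rule exponent_seq_ge)
  show "(\<lambda>n. norm (a n) * lam n powr (- c)) summable_on {1..}"
    using assms(1,2,4) by (rule dirichlet_norm_summable)
qed fact

section \<open>Duality and functional equation of a single series\<close>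

locale class_A_series =
  fixes r :: real and a :: "nat \<Rightarrow> complex" and lam :: "nat \<Rightarrow> real" and \<phi> :: "complex \<Rightarrow> complex"
    and b :: "nat \<Rightarrow> complex" and mu :: "nat \<Rightarrow> real" and \<psi> :: "complex \<Rightarrow> complex"
  assumes class_A: "class_A r a lam \<phi> b mu \<psi>"
begin

text \<open>The notion is symmetric under \<open>s \<mapsto> r - s\<close>: the reflected function
  \<open>Y\<close> witnesses the Hecke pair with the two series exchanged. Every fact about
  \<open>\<phi>\<close> thus becomes available for \<open>\<psi>\<close>.\<close>

lemma dual: "class_A_series r b mu \<psi> a lam \<phi>"
proof
  have hp: "hecke_pair r a lam b mu" using class_A by (simp add: class_A_def)
  then obtain X K where X: "X meromorphic_on UNIV"
     "\<And>s. Re s > abscissa a lam \<Longrightarrow> s \<notin> \<int>\<^sub>\<le>\<^sub>0 \<Longrightarrow> X s = Gamma s * dirichlet_series a lam s"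
     "\<And>s. Re s < r - abscissa b mu \<Longrightarrow> of_real r - s \<notin> \<int>\<^sub>\<le>\<^sub>0 \<Longrightarrow>
           X s = Gamma (of_real r - s) * dirichlet_series b mu (of_real r - s)"
     "\<And>\<sigma>1 \<sigma>2 \<epsilon>. \<epsilon>>0 \<Longrightarrow> \<exists>T. \<forall>s. \<sigma>1 \<le> Re s \<and> Re s \<le> \<sigma>2 \<and> T \<le> \<bar>Im s\<bar> \<longrightarrow> norm (X s) < \<epsilon>"
     "compact K" "X analytic_on (- K)"
    unfolding hecke_pair_def by blast
  define Y where "Y s = X (of_real r - s)" for s
  have refl_an: "(\<lambda>s. of_real r - s) analytic_on A" for A
    by (intro analytic_intros)
  have Y1: "Y meromorphic_on UNIV"
    unfolding Y_def by (rule meromorphic_on_compose[OF X(1) refl_an]) auto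
  have Y2: "\<exists>T. \<forall>s. \<sigma>1 \<le> Re s \<and> Re s \<le> \<sigma>2 \<and> T \<le> \<bar>Im s\<bar> \<longrightarrow> norm (Y s) < \<epsilon>" if eps: "0 < \<epsilon>" for \<sigma>1 \<sigma>2 \<epsilon>
  proof -
    obtain T where T: "\<And>s. r - \<sigma>2 \<le> Re s \<Longrightarrow> Re s \<le> r - \<sigma>1 \<Longrightarrow> T \<le> \<bar>Im s\<bar> \<Longrightarrow> norm (X s) < \<epsilon>"
      using X(4)[OF eps, of "r - \<sigma>2" "r - \<sigma>1"] by blast
    show ?thesis unfolding Y_def by (intro exI[of _ T] allI impI T) auto
  qed
  have Y3: "compact ((\<lambda>s. of_real r - s) ` K)"
    using X(5) by (intro compact_continuous_image continuous_intros)
  have Y4: "Y analytic_on - (\<lambda>s. of_real r - s) ` K"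
    unfolding Y_def
  proof (rule analytic_on_compose_gen[OF refl_an X(6), unfolded o_def])
    fix z assume z: "z \<in> - (\<lambda>s. of_real r - s) ` K"
    show "of_real r - z \<in> - K"
      using z by (auto simp: image_iff)
  qed
  have "hecke_pair r b mu a lam"
    unfolding hecke_pair_def
  proof (intro conjI exI[of _ Y])
  qed (use hp Y1 Y2 Y3 Y4 X(2,3) in \<open>auto simp: hecke_pair_def Y_def\<close>)
  then show "class_A r b mu \<psi> a lam \<phi>"
    using class_A by (auto simp: class_A_def)
qed

lemma hecke: "hecke_pair r a lam b mu"
  and \<phi>_series: "Re s > abscissa a lam \<Longrightarrow> \<phi> s = dirichlet_series a lam s"
  and \<psi>_series: "Re s > abscissa b mu \<Longrightarrow> \<psi> s = dirichlet_series b mu s"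
  and \<phi>_mero: "\<phi> nicely_meromorphic_on UNIV" and \<psi>_mero: "\<psi> nicely_meromorphic_on UNIV"
  and \<phi>_pole: "only_possible_pole_simple_at \<phi> (of_real r)"
  and \<psi>_pole: "only_possible_pole_simple_at \<psi> (of_real r)"
  and a0: "a 0 = - \<phi> 0" and b0: "b 0 = - \<psi> 0" and lam0: "lam 0 = 0" and mu0: "mu 0 = 0"
  using class_A by (auto simp: class_A_def meromorphic_continuation_def)

lemma r_pos: "0 < r" and lam_seq: "exponent_seq lam" and mu_seq: "exponent_seq mu"
  and a_abscissa_finite: "\<bar>abs_conv_abscissa a lam\<bar> \<noteq> \<infinity>"
  and b_abscissa_finite: "\<bar>abs_conv_abscissa b mu\<bar> \<noteq> \<infinity>"
  and b_nonzero: "\<exists>n\<ge>1. b n \<noteq> 0"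
  using hecke by (auto simp: hecke_pair_def)

lemma \<phi>_analytic: "s \<noteq> of_real r \<Longrightarrow> \<phi> analytic_on {s}"
  using \<phi>_pole by (auto simp: only_possible_pole_simple_at_def intro: analytic_on_subset)

lemma abs_dirichlet_a: "0 < c \<Longrightarrow> abscissa a lam < c \<Longrightarrow> abs_dirichlet a lam c"
  by (rule abs_dirichletI[OF lam_seq a_abscissa_finite])

lemma abs_dirichlet_b: "0 < c \<Longrightarrow> abscissa b mu < c \<Longrightarrow> abs_dirichlet b mu c"
  by (rule abs_dirichletI[OF mu_seq b_abscissa_finite])

lemma Gamma_\<phi>_analytic:
  assumes "s \<notin> \<int>\<^sub>\<le>\<^sub>0" "s \<noteq> of_real r"
  shows "(\<lambda>s. Gamma s * \<phi> s) analytic_on {s}"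
  using assms by (intro analytic_on_mult analytic_Gamma \<phi>_analytic) auto

text \<open>\<open>X\<close> is tied to the two products on a right and on a left half-plane.
  Uniqueness of meromorphic continuation equates it with each of them off \<open>K\<close> and the
  real axis. Hence they equal each other, and the decay of \<open>X\<close> in strips passes to
  \<open>Gamma s * \<phi> s\<close>.\<close>

lemma functional_equation:
  "s \<notin> \<int>\<^sub>\<le>\<^sub>0 \<Longrightarrow> of_real r - s \<notin> \<int>\<^sub>\<le>\<^sub>0 \<Longrightarrow>
     Gamma s * \<phi> s = Gamma (of_real r - s) * \<psi> (of_real r - s)"
  and completed_decay: "\<exists>T. \<forall>s. \<sigma>1 \<le> Re s \<and> Re s \<le> \<sigma>2 \<and> T \<le> \<bar>Im s\<bar> \<longrightarrow> norm (Gamma s * \<phi> s) < 1"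
proof -
  interpret dual: class_A_series r b mu \<psi> a lam \<phi> by (rule dual)
  obtain X K where X: "X meromorphic_on UNIV"
     "\<And>s. Re s > abscissa a lam \<Longrightarrow> s \<notin> \<int>\<^sub>\<le>\<^sub>0 \<Longrightarrow> X s = Gamma s * dirichlet_series a lam s"
     "\<And>s. Re s < r - abscissa b mu \<Longrightarrow> of_real r - s \<notin> \<int>\<^sub>\<le>\<^sub>0 \<Longrightarrow>
           X s = Gamma (of_real r - s) * dirichlet_series b mu (of_real r - s)"
     "\<And>\<sigma>1 \<sigma>2 \<epsilon>. \<epsilon>>0 \<Longrightarrow> \<exists>T. \<forall>s. \<sigma>1 \<le> Re s \<and> Re s \<le> \<sigma>2 \<and> T \<le> \<bar>Im s\<bar> \<longrightarrow> norm (X s) < \<epsilon>"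
     "compact K" "X analytic_on (- K)"
    using hecke unfolding hecke_pair_def by blast
  define D1 where "D1 s = X s - Gamma s * \<phi> s" for s
  define D2 where "D2 s = X s - Gamma (of_real r - s) * \<psi> (of_real r - s)" for s
  have refl_an: "(\<lambda>s. of_real r - s) analytic_on A" for A
    by (intro analytic_intros)
  have mero: "(\<lambda>s. Gamma s * \<phi> s) meromorphic_on UNIV" "(\<lambda>s. Gamma s * \<psi> s) meromorphic_on UNIV"
    using \<phi>_mero \<psi>_mero by (auto simp: nicely_meromorphic_on_def intro!: meromorphic_intros)
  have mero2: "(\<lambda>s. Gamma (of_real r - s) * \<psi> (of_real r - s)) meromorphic_on UNIV"
    using meromorphic_on_compose[OF mero(2) refl_an] by auto
  have D1m: "D1 meromorphic_on UNIV"
    unfolding D1_def using X(1) mero by (intro meromorphic_on_diff)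
  have D2m: "D2 meromorphic_on UNIV"
    unfolding D2_def using X(1) mero2 by (intro meromorphic_on_diff)
  \<comment> \<open>The upper half-plane avoids the poles of \<open>Gamma\<close>, where the
    identities for \<open>X\<close> assert nothing.\<close>
  define S1 where "S1 = {s. abscissa a lam < Re s} \<inter> {s. 0 < Im s}"
  define S2 where "S2 = {s. Re s < r - abscissa b mu} \<inter> {s. 0 < Im s}"
  have S: "open S1" "open S2" unfolding S1_def S2_def
    by (intro open_Int open_halfspace_Re_gt open_halfspace_Re_lt open_halfspace_Im_gt)+
  have ne: "S1 \<noteq> {}" "S2 \<noteq> {}"
  proof -
    have "Complex (abscissa a lam + 1) 1 \<in> S1" "Complex (r - abscissa b mu - 1) 1 \<in> S2"
      by (auto simp: S1_def S2_def)
    then show "S1 \<noteq> {}" "S2 \<noteq> {}" by blast+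
  qed
  have z1: "D1 s = 0" if "s \<in> S1" for s
    using that X(2)[of s] not_nonpos_Int_if_Im[of s] \<phi>_series[of s] by (auto simp: S1_def D1_def)
  have z2: "D2 s = 0" if "s \<in> S2" for s
    using that X(3)[of s] not_nonpos_Int_if_Im[of "of_real r - s"] \<psi>_series[of "of_real r - s"]
    by (auto simp: S2_def D2_def)
  define D where "D s = Gamma s * \<phi> s - Gamma (of_real r - s) * \<psi> (of_real r - s)" for s
  have Dm: "D meromorphic_on UNIV" unfolding D_def using mero mero2 by (intro meromorphic_on_diff)
  have an2: "(\<lambda>s. Gamma (of_real r - s) * \<psi> (of_real r - s)) analytic_on {s}"
    if "of_real r - s \<notin> \<int>\<^sub>\<le>\<^sub>0" "s \<noteq> 0" for s
  proof -
    have "(\<lambda>s. Gamma s * \<psi> s) analytic_on {of_real r - s}"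
      using that by (intro dual.Gamma_\<phi>_analytic) auto
    then show ?thesis
      using analytic_on_compose_gen[OF refl_an[of "{s}"], of "\<lambda>s. Gamma s * \<psi> s" "{of_real r - s}"]
      by (simp add: o_def)
  qed
  then have Dan: "D analytic_on {s}" if "s \<notin> \<int>\<^sub>\<le>\<^sub>0" "of_real r - s \<notin> \<int>\<^sub>\<le>\<^sub>0"
    unfolding D_def using that by (intro analytic_on_diff Gamma_\<phi>_analytic) auto
  \<comment> \<open>Here both comparisons with \<open>X\<close> are valid at once, so
    \<open>D\<close> vanishes on an open set; \<open>S\<close> is nonempty because \<open>K\<close>
    is bounded.\<close>
  define S where "S = - K \<inter> {s. 0 < Im s}"
  have So: "open S" unfolding S_def using X(5)
    by (intro open_Int open_halfspace_Im_gt open_Compl compact_imp_closed)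
  have Sne: "S \<noteq> {}"
  proof -
    obtain B where B: "\<And>z. z \<in> K \<Longrightarrow> norm z < B" "B > 0"
      using compact_imp_bounded[OF X(5)] by (auto simp: bounded_pos_less)
    then have "Complex 0 B \<in> S" by (auto simp: S_def complex_norm dest: B(1))
    then show ?thesis by blast
  qed
  have D1z: "D1 w = 0" if "w \<notin> K" "Im w \<noteq> 0" for w
  proof (rule meromorphic_eq_0I[OF D1m S(1) ne(1) z1])
    have "X analytic_on {w}" using X(6) that analytic_on_subset by blast
    then show "D1 analytic_on {w}" unfolding D1_def
      using that by (intro analytic_on_diff Gamma_\<phi>_analytic not_nonpos_Int_if_Im) auto
  qed
  have D2z: "D2 w = 0" if "w \<notin> K" "Im w \<noteq> 0" for w
  proof (rule meromorphic_eq_0I[OF D2m S(2) ne(2) z2])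
    have "X analytic_on {w}" using X(6) that analytic_on_subset by blast
    then show "D2 analytic_on {w}" unfolding D2_def
      using that by (intro analytic_on_diff an2 not_nonpos_Int_if_Im) auto
  qed
  have "D w = 0" if "w \<in> S" for w
    using D1z[of w] D2z[of w] that by (auto simp: S_def D_def D1_def D2_def)
  then have "D s = 0" if "D analytic_on {s}"
    using meromorphic_eq_0I[OF Dm So Sne _ that] by blast
  with Dan show "s \<notin> \<int>\<^sub>\<le>\<^sub>0 \<Longrightarrow> of_real r - s \<notin> \<int>\<^sub>\<le>\<^sub>0 \<Longrightarrow> Gamma s * \<phi> s = Gamma (of_real r - s) * \<psi> (of_real r - s)"
    by (simp add: D_def)
  show "\<exists>T. \<forall>s. \<sigma>1 \<le> Re s \<and> Re s \<le> \<sigma>2 \<and> T \<le> \<bar>Im s\<bar> \<longrightarrow> norm (Gamma s * \<phi> s) < 1"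
  proof -
    obtain B where B: "\<And>z. z \<in> K \<Longrightarrow> norm z < B" "B > 0"
      using compact_imp_bounded[OF X(5)] by (auto simp: bounded_pos_less)
    obtain T where T: "\<And>s. \<sigma>1 \<le> Re s \<Longrightarrow> Re s \<le> \<sigma>2 \<Longrightarrow> T \<le> \<bar>Im s\<bar> \<Longrightarrow> norm (X s) < 1"
      using X(4)[of 1 \<sigma>1 \<sigma>2] by auto
    \<comment> \<open>Beyond \<open>B\<close> the point lies outside \<open>K\<close> and off the
      real axis, so \<open>X\<close> and the product coincide there.\<close>
    have "norm (Gamma s * \<phi> s) < 1" if "\<sigma>1 \<le> Re s" "Re s \<le> \<sigma>2" "max T B \<le> \<bar>Im s\<bar>" for s
    proof -
      have "s \<notin> K" using B(1)[of s] abs_Im_le_cmod[of s] that by force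
      moreover have "Im s \<noteq> 0" using that B(2) by auto
      ultimately have "D1 s = 0" by (rule D1z)
      then show ?thesis using T[of s] that by (simp add: D1_def)
    qed
    then show ?thesis by blast
  qed
qed

end

section \<open>Entire and polar part of the completed series\<close>

context class_A_series
begin

text \<open>Multiplied by \<open>s * (s - r)\<close> the completed series is entire: its own formula
  shows this for \<open>Re s > -1\<close>, the dual one for \<open>Re s < r + 1\<close>, and both
  agree on the overlap. The values of this product at 0 and \<open>r\<close> give the polar
  coefficients; the one at \<open>r\<close>, computed from both sides, relates \<open>b 0\<close> to
  the residue of \<open>\<phi>\<close>. The identities are extended to \<open>s = r\<close> or
  \<open>s = 0\<close> when the pole there is absent, since such points can lie in the half-plane of
  convergence.\<close>

lemma regular_part_exists:
  obtains H where "H holomorphic_on UNIV"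
    "\<And>s. s \<notin> \<int>\<^sub>\<le>\<^sub>0 \<Longrightarrow> s \<noteq> of_real r \<or> b 0 = 0 \<Longrightarrow> Gamma s * \<phi> s = H s - a 0 / s + b 0 / (s - of_real r)"
    "\<And>s. of_real r - s \<notin> \<int>\<^sub>\<le>\<^sub>0 \<Longrightarrow> s \<noteq> 0 \<or> a 0 = 0 \<Longrightarrow>
       Gamma (of_real r - s) * \<psi> (of_real r - s) = H s - a 0 / s + b 0 / (s - of_real r)"
    "b 0 = Gamma (of_real r) * residue \<phi> (of_real r)"
proof -
  define R where "R = complex_of_real r"
  have R: "R \<noteq> 0" "Re R = r" "Im R = 0" using r_pos by (auto simp: R_def)
  define \<rho> where "\<rho> = residue \<phi> R"
  define \<rho>' where "\<rho>' = residue \<psi> R"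
  obtain h where h: "h holomorphic_on UNIV" "\<And>s. s \<noteq> R \<Longrightarrow> \<phi> s = h s + \<rho> / (s - R)" "\<rho> = 0 \<Longrightarrow> \<phi> R = h R"
    using simple_pole_decomposition[OF \<phi>_mero \<phi>_pole] unfolding R_def \<rho>_def by blast
  obtain k where k: "k holomorphic_on UNIV" "\<And>s. s \<noteq> R \<Longrightarrow> \<psi> s = k s + \<rho>' / (s - R)" "\<rho>' = 0 \<Longrightarrow> \<psi> R = k R"
    using simple_pole_decomposition[OF \<psi>_mero \<psi>_pole] unfolding R_def \<rho>'_def by blast
  \<comment> \<open>Forms that are analytic at the removed singularities: \<open>s * Gamma s\<close>
    becomes \<open>Gamma (s + 1)\<close>, and \<open>(s - R) * \<phi> s\<close> becomes
    \<open>(s - R) * h s + \<rho>\<close>; \<open>P2\<close> does the same on the dual side.\<close>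
  define P1 where "P1 s = Gamma (s + 1) * ((s - R) * h s + \<rho>)" for s
  define P2 where "P2 s = Gamma (R + 1 - s) * (\<rho>' - s * k (R - s))" for s
  have hR: "(\<lambda>s. h s) holomorphic_on A" "(\<lambda>s. k (R - s)) holomorphic_on A" for A
  proof -
    show "(\<lambda>s. h s) holomorphic_on A" using h(1) holomorphic_on_subset by blast
    have "k \<circ> (\<lambda>s. R - s) holomorphic_on A"
      by (rule holomorphic_on_compose_gen[OF _ k(1)]) (auto intro!: holomorphic_intros)
    then show "(\<lambda>s. k (R - s)) holomorphic_on A" by (simp add: o_def)
  qed
  have P1_hol: "P1 holomorphic_on {s. -1 < Re s}"
    unfolding P1_def by (intro holomorphic_intros hR) (auto intro!: not_nonpos_Int_if_Re)
  have P2_hol: "P2 holomorphic_on {s. Re s < r + 1}"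
    unfolding P2_def by (intro holomorphic_intros hR) (auto intro!: not_nonpos_Int_if_Re simp: R)
  have P1_eq: "P1 s = s * (s - R) * (Gamma s * \<phi> s)" if "s \<notin> \<int>\<^sub>\<le>\<^sub>0" "s \<noteq> R" for s
  proof -
    have "Gamma (s + 1) = s * Gamma s" using that Gamma_plus1[of s] by auto
    moreover have "(s - R) * h s + \<rho> = (s - R) * \<phi> s" using that h(2)[of s] by (simp add: field_simps)
    ultimately show ?thesis by (simp add: P1_def)
  qed
  have P2_eq: "P2 s = s * (s - R) * (Gamma (R - s) * \<psi> (R - s))" if "R - s \<notin> \<int>\<^sub>\<le>\<^sub>0" "s \<noteq> 0" for s
  proof -
    have g: "Gamma (R + 1 - s) = (R - s) * Gamma (R - s)"
      using that Gamma_plus1[of "R - s"] by (auto simp: algebra_simps)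
    have k': "\<rho>' - s * k (R - s) = - s * \<psi> (R - s)"
      using that k(2)[of "R - s"] by (simp add: field_simps)
    show ?thesis unfolding P2_def g k' by (simp add: algebra_simps)
  qed
  define S where "S = {s. -1 < Re s} \<inter> {s. Re s < r + 1}"
  have S: "open S" "connected S"
    unfolding S_def
    by (auto intro!: open_Int open_halfspace_Re_gt open_halfspace_Re_lt convex_connected convex_Int
        convex_halfspace_Re_gt convex_halfspace_Re_lt)
  \<comment> \<open>In the strip \<open>0 < Re s < r\<close> neither Gamma factor has a pole, so the
    functional equation applies at every point; the identity theorem extends the equality to the
    wider overlap \<open>S\<close>.\<close>
  define S' where "S' = {s. 0 < Re s} \<inter> {s. Re s < r}"
  have S': "open S'" "S' \<subseteq> S" unfolding S'_def S_def
    by (auto intro!: open_Int open_halfspace_Re_gt open_halfspace_Re_lt)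
  have "of_real (r / 2) \<in> S'" using r_pos by (auto simp: S'_def)
  then have "S' \<noteq> {}" by blast
  have P12: "P1 s = P2 s" if "s \<in> S" for s
  proof (rule analytic_continuation_open[OF S'(1) S(1) \<open>S' \<noteq> {}\<close> S(2) S'(2) _ _ _ that])
    show "P1 holomorphic_on S" "P2 holomorphic_on S"
      using P1_hol P2_hol by (auto simp: S_def intro: holomorphic_on_subset)
    fix z assume z: "z \<in> S'"
    then have *: "z \<notin> \<int>\<^sub>\<le>\<^sub>0" "R - z \<notin> \<int>\<^sub>\<le>\<^sub>0" by (auto intro!: not_nonpos_Int_if_Re simp: S'_def R)
    moreover have "z \<noteq> 0" "z \<noteq> R" using z by (auto simp: S'_def R)
    ultimately show "P1 z = P2 z"
      using functional_equation[of z] P1_eq[of z] P2_eq[of z] by (auto simp: R_def)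
  qed
  define P where "P s = (if 0 < Re s then P1 s else P2 s)" for s
  have P1: "P s = P1 s" if "-1 < Re s" for s
    using that P12[of s] r_pos by (auto simp: P_def S_def)
  have P2: "P s = P2 s" if "Re s < r + 1" for s
    using that P12[of s] by (auto simp: P_def S_def)
  have "P holomorphic_on {s. -1 < Re s} \<union> {s. Re s < r + 1}"
  proof (rule holomorphic_on_Un)
    show "P holomorphic_on {s. -1 < Re s}" using P1_hol by (rule holomorphic_transform) (use P1 in auto)
    show "P holomorphic_on {s. Re s < r + 1}" using P2_hol by (rule holomorphic_transform) (use P2 in auto)
  qed (auto intro: open_halfspace_Re_gt open_halfspace_Re_lt)
  also have "{s. -1 < Re s} \<union> {s. Re s < r + 1} = UNIV" using r_pos by auto
  finally have P_hol: "P holomorphic_on UNIV" .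
  have P_0: "P 0 = R * a 0"
    using h(2)[of 0] R by (simp add: P1 P1_def a0 field_simps)
  have "P R = P2 R" using R by (simp add: P2)
  also have "\<dots> = R * b 0"
    using k(2)[of 0] R by (simp add: P2_def b0 field_simps)
  finally have P_R: "P R = R * b 0" .
  \<comment> \<open>The same value from the other representation contains the residue, since
    \<open>Gamma (R + 1) = R * Gamma R\<close>.\<close>
  have "P R = P1 R" using R r_pos by (simp add: P1)
  also have "\<dots> = R * Gamma R * \<rho>"
    using Gamma_plus1[of R] not_nonpos_Int_if_Re[of R] R r_pos by (simp add: P1_def)
  finally have b0_eq: "b 0 = Gamma R * \<rho>" using P_R R by simp
  have "P 0 = P2 0" using r_pos by (simp add: P2)
  also have "\<dots> = R * Gamma R * \<rho>'"
    using Gamma_plus1[of R] not_nonpos_Int_if_Re[of R] R r_pos by (simp add: P2_def add.commute)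
  finally have a0_eq: "a 0 = Gamma R * \<rho>'" using P_0 R by simp
  \<comment> \<open>Two successive divided differences, at 0 and at \<open>R\<close>, take the polar
    part out of \<open>P s / (s * (s - R))\<close>; in partial fractions they subtract
    \<open>- a 0 / s + b 0 / (s - R)\<close>.\<close>
  define G where "G z = (if z = 0 then deriv P 0 else P z / z - P 0 / z)" for z
  have "(\<lambda>z. if z = 0 then deriv P 0 else P z / z - P 0 / (z - 0)) holomorphic_on UNIV"
    by (rule pole_theorem_open[OF P_hol]) auto
  then have G_hol: "G holomorphic_on UNIV" by (simp add: G_def[abs_def] cong: if_cong)
  have G_R: "G R = b 0 - a 0" using R by (simp add: G_def P_0 P_R)
  define H where "H z = (if z = R then deriv G R else G z / (z - R) - G R / (z - R))" for z
  have H_hol: "H holomorphic_on UNIV"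
    unfolding H_def by (rule pole_theorem_open[OF G_hol]) auto
  have H_eq: "P s / (s * (s - R)) = H s - a 0 / s + b 0 / (s - R)" if s: "s \<noteq> 0" "s \<noteq> R" for s
  proof -
    have "P s = s * (s - R) * H s + s * (b 0 - a 0) + R * a 0"
    proof -
      have "(s - R) * H s = G s - (b 0 - a 0)" using s by (simp add: H_def G_R flip: diff_divide_distrib)
      moreover have "s * G s = P s - R * a 0" using s by (simp add: G_def P_0 flip: diff_divide_distrib)
      ultimately show ?thesis by algebra
    qed
    then show ?thesis using s by (simp add: field_simps)
  qed
  have P\<phi>: "Gamma s * \<phi> s = H s - a 0 / s + b 0 / (s - R)" if s: "s \<notin> \<int>\<^sub>\<le>\<^sub>0" "s \<noteq> R" for s
  proof -
    have s0: "s \<noteq> 0" using s by auto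
    have "P s = s * (s - R) * (Gamma s * \<phi> s)"
    proof (cases "-1 < Re s")
      case True
      then show ?thesis using P1_eq[OF s] P1 by simp
    next
      case False
      then have nn: "R - s \<notin> \<int>\<^sub>\<le>\<^sub>0" using r_pos by (intro not_nonpos_Int_if_Re) (auto simp: R)
      then show ?thesis
        using P2_eq[of s] functional_equation[OF s(1)] s0 False r_pos by (auto simp: P2 R_def)
    qed
    then have "Gamma s * \<phi> s = P s / (s * (s - R))" using s s0 by (simp add: field_simps)
    then show ?thesis using H_eq s s0 by simp
  qed
  have P\<psi>: "Gamma (R - s) * \<psi> (R - s) = H s - a 0 / s + b 0 / (s - R)" if s: "R - s \<notin> \<int>\<^sub>\<le>\<^sub>0" "s \<noteq> 0" for s
  proof -
    have sR: "s \<noteq> R" using s by auto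
    have "P s = s * (s - R) * (Gamma (R - s) * \<psi> (R - s))"
    proof (cases "Re s < r + 1")
      case True
      then show ?thesis using P2_eq[OF s] P2 by simp
    next
      case False
      then have nn: "s \<notin> \<int>\<^sub>\<le>\<^sub>0" using r_pos by (intro not_nonpos_Int_if_Re) (auto simp: R)
      then show ?thesis
        using P1_eq[of s] functional_equation[of s] s sR False r_pos by (auto simp: P1 R_def)
    qed
    then have "Gamma (R - s) * \<psi> (R - s) = P s / (s * (s - R))" using s sR by (simp add: field_simps)
    then show ?thesis using H_eq s sR by simp
  qed
  have cont: "isCont f z" if "f holomorphic_on UNIV" for f z
    using holomorphic_on_imp_continuous_on[OF that] continuous_on_eq_continuous_at[of UNIV f] by simp
  have GR: "Gamma R \<noteq> 0" using not_nonpos_Int_if_Re[of R] R r_pos by (auto simp: Gamma_eq_zero_iff)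
  \<comment> \<open>If \<open>b 0 = 0\<close>, the residue vanishes, \<open>\<phi>\<close> is the
    entire function \<open>h\<close>, and continuity gives the identity at \<open>R\<close>.\<close>
  have at_R: "Gamma R * \<phi> R = H R - a 0 / R" if "b 0 = 0"
  proof -
    have "\<rho> = 0" using b0_eq GR that by simp
    then have "\<phi> = h" using h(2,3) by (metis add.right_neutral div_0 ext)
    have "Gamma R * h R = H R - a 0 / R"
    proof (rule isCont_eqI[where S = "{s. 0 < Re s}" and p = R
          and f = "\<lambda>s. Gamma s * h s" and g = "\<lambda>s. H s - a 0 / s"])
      show "isCont (\<lambda>s. Gamma s * h s) R"
        using cont[OF h(1)] not_nonpos_Int_if_Re[of R] R r_pos by (intro isCont_mult isCont_Gamma) auto
      show "isCont (\<lambda>s. H s - a 0 / s) R"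
        using cont[OF H_hol] R by (intro continuous_intros) auto
      fix w assume "w \<in> {s. 0 < Re s}" "w \<noteq> R"
      then show "Gamma w * h w = H w - a 0 / w"
        using P\<phi>[of w] not_nonpos_Int_if_Re[of w] that \<open>\<phi> = h\<close> by auto
    qed (use R r_pos in \<open>auto intro: open_halfspace_Re_gt\<close>)
    then show ?thesis by (simp add: \<open>\<phi> = h\<close>)
  qed
  have at_0: "Gamma R * \<psi> R = H 0 + b 0 / (- R)" if "a 0 = 0"
  proof -
    have "\<rho>' = 0" using a0_eq GR that by simp
    then have "\<psi> = k" using k(2,3) by (metis add.right_neutral div_0 ext)
    have "Gamma (R - 0) * k (R - 0) = H 0 + b 0 / (0 - R)"
    proof (rule isCont_eqI[where S = "{s. Re s < r}" and p = 0
          and f = "\<lambda>s. Gamma (R - s) * k (R - s)" and g = "\<lambda>s. H s + b 0 / (s - R)"])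
      have "isCont (\<lambda>s. k (R - s)) 0" using cont[OF hR(2)] .
      then show "isCont (\<lambda>s. Gamma (R - s) * k (R - s)) 0"
        using not_nonpos_Int_if_Re[of R] R r_pos by (intro isCont_mult isCont_Gamma continuous_intros) auto
      show "isCont (\<lambda>s. H s + b 0 / (s - R)) 0"
        using cont[OF H_hol] R by (intro continuous_intros) auto
      fix w assume "w \<in> {s. Re s < r}" "w \<noteq> 0"
      then show "Gamma (R - w) * k (R - w) = H w + b 0 / (w - R)"
        using P\<psi>[of w] not_nonpos_Int_if_Re[of "R - w"] that \<open>\<psi> = k\<close> R by auto
    qed (use r_pos in \<open>auto intro: open_halfspace_Re_lt\<close>)
    then show ?thesis by (simp add: \<open>\<psi> = k\<close>)
  qed
  show ?thesis
  proof (rule that[OF H_hol])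
    show "Gamma s * \<phi> s = H s - a 0 / s + b 0 / (s - of_real r)"
      if "s \<notin> \<int>\<^sub>\<le>\<^sub>0" "s \<noteq> of_real r \<or> b 0 = 0" for s
      using that P\<phi>[of s] at_R unfolding R_def[symmetric] by (cases "s = R") auto
    show "Gamma (of_real r - s) * \<psi> (of_real r - s) = H s - a 0 / s + b 0 / (s - of_real r)"
      if "of_real r - s \<notin> \<int>\<^sub>\<le>\<^sub>0" "s \<noteq> 0 \<or> a 0 = 0" for s
      using that P\<psi>[of s] at_0 unfolding R_def[symmetric] by (cases "s = 0") auto
    show "b 0 = Gamma (of_real r) * residue \<phi> (of_real r)"
      using b0_eq by (simp add: \<rho>_def R_def)
  qed
qed

lemma b0_eq_residue: "b 0 = Gamma (of_real r) * residue \<phi> (of_real r)"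
  using regular_part_exists by blast

text \<open>A nonzero \<open>b 0\<close> forces a pole of \<open>\<phi>\<close> at \<open>r\<close>,
  while the Dirichlet series is analytic to the right of its abscissa. In the Epstein formula this
  keeps \<open>s - r1\<close> in the half-plane where \<open>\<phi>2\<close> is given by its
  series.\<close>

lemma abscissa_ge_r:
  assumes "b 0 \<noteq> 0"
  shows "r \<le> abscissa a lam"
proof (rule ccontr)
  assume "\<not> r \<le> abscissa a lam"
  then have less: "abscissa a lam < r" by simp
  define c where "c = (max (abscissa a lam) 0 + r) / 2"
  have c: "0 < c" "abscissa a lam < c" "c < r" using less r_pos by (auto simp: c_def max_def)
  interpret A: abs_dirichlet a lam c by (rule abs_dirichlet_a[OF c(1,2)])
  define R where "R = complex_of_real r"
  obtain h where h: "h holomorphic_on UNIV" "\<And>s. s \<noteq> R \<Longrightarrow> \<phi> s = h s + residue \<phi> R / (s - R)"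
    using simple_pole_decomposition[OF \<phi>_mero \<phi>_pole] unfolding R_def by blast
  define L where "L = laplace (\<lambda>t. theta a lam (of_real (exp t)))"
  define f where "f s = (s - R) * (rGamma s * L s)" for s
  have op: "open {s. c < Re s \<and> Re s < r + 1}"
    using open_Int[OF open_halfspace_Re_gt[of c] open_halfspace_Re_lt[of "r+1"]] by (simp add: Int_def)
  have Rin: "R \<in> {s. c < Re s \<and> Re s < r + 1}" using c by (simp add: R_def)
  have "L holomorphic_on {s. c < Re s \<and> Re s < r + 1}"
    unfolding L_def
  proof (rule laplace_holomorphic)
    fix \<sigma> assume "c < \<sigma>"
    then have "integrable lborel (\<lambda>t. norm (exp (of_real \<sigma> * of_real t) * theta a lam (of_real (exp t))))"
      by (intro integrable_norm A.laplace_theta(1)) auto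
    then show "integrable lborel (\<lambda>t. exp (\<sigma> * t) * norm (theta a lam (of_real (exp t))))"
      by (simp add: norm_mult)
  qed simp
  then have "isCont L R"
    using op Rin holomorphic_on_imp_continuous_on continuous_on_eq_continuous_at by blast
  then have c1: "isCont f R" unfolding f_def
    by (intro isCont_mult isCont_rGamma continuous_intros)
  have "isCont h R" using h(1)
    by (metis UNIV_I continuous_on_eq_continuous_at holomorphic_on_imp_continuous_on open_UNIV)
  then have c2: "isCont (\<lambda>s. (s - R) * h s + residue \<phi> R) R"
    by (intro continuous_intros)
  \<comment> \<open>The factor \<open>s - R\<close> makes \<open>f R\<close> zero, so this equality
    says that the residue is 0.\<close>
  have "f R = (R - R) * h R + residue \<phi> R"
  proof (rule isCont_eqI[OF c1 c2 op Rin])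
    fix w assume w: "w \<in> {s. c < Re s \<and> Re s < r + 1}" "w \<noteq> R"
    then have "L w = Gamma w * \<phi> w"
      using A.laplace_theta(2)[of w] \<phi>_series[of w] c by (simp add: L_def)
    moreover have "w \<notin> \<int>\<^sub>\<le>\<^sub>0" using w c by (auto elim!: nonpos_Ints_cases)
    then have "rGamma w * Gamma w = 1" by (simp add: rGamma_inverse_Gamma Gamma_eq_zero_iff)
    ultimately have "f w = (w - R) * \<phi> w"
      by (metis f_def mult.assoc mult_1)
    then show "f w = (w - R) * h w + residue \<phi> R"
      unfolding h(2)[OF w(2)] using w(2) by (simp add: distrib_left)
  qed
  then have "residue \<phi> R = 0" by (simp add: f_def)
  then show False using assms b0_eq_residue by (simp add: R_def)
qed

end

subsection \<open>Uniqueness of exponential moments\<close>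

lemma exp_half_line:
  fixes x :: real
  assumes "0 < x"
  shows "integrable lborel (\<lambda>t. indicator {0..} t * exp (- x * t))"
    and "(LINT t|lborel. indicator {0..} t * exp (- x * t)) = 1 / x"
proof -
  have hk: "((\<lambda>t. exp (- x * t)) has_integral 1 / x) {0..}"
    using has_integral_exp_minus_to_infinity[OF assms, of 0] by simp
  then have "(\<lambda>t. exp (- x * t)) absolutely_integrable_on {0..}"
    by (intro nonnegative_absolutely_integrable_1) (auto simp: integrable_on_def)
  then have si: "set_integrable lborel {0..} (\<lambda>t. exp (- x * t))"
    using integrable_completion[of "\<lambda>t. indicator {0..} t *\<^sub>R exp (- x * t)" lborel]
    by (simp add: set_integrable_def)
  then show "integrable lborel (\<lambda>t. indicator {0..} t * exp (- x * t))"
    by (simp add: set_integrable_def)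
  show "(LINT t|lborel. indicator {0..} t * exp (- x * t)) = 1 / x"
    using set_borel_integral_eq_integral(2)[OF si] integral_unique[OF hk]
    by (simp add: set_lebesgue_integral_def)
qed

text \<open>In the variable \<open>u = exp (- t)\<close> the hypotheses make \<open>q\<close>
  orthogonal to all polynomials on \<open>{0..1}\<close>. By Weierstrass \<open>q\<close> is a
  uniform limit of such polynomials, so the integral of its square is 0.\<close>

lemma exp_moments_eq_0:
  fixes q :: "real \<Rightarrow> real"
  assumes cont: "continuous_on UNIV q"
    and bound: "\<And>t. 0 \<le> t \<Longrightarrow> \<bar>q t\<bar> \<le> M * exp (- t)"
    and moments: "\<And>n :: nat. (LINT t|lborel. indicator {0..} t * (exp (- real n * t) * q t)) = 0"
    and "0 \<le> t"
  shows "q t = 0"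
proof -
  have [measurable]: "q \<in> borel_measurable borel"
    using cont by (rule borel_measurable_continuous_onI)
  have M: "0 \<le> M" using bound[of 0] by simp
  have dom: "integrable lborel f"
    if [measurable]: "f \<in> borel_measurable borel" and "\<And>t. \<bar>f t\<bar> \<le> C * (indicator {0..} t * exp (- t))" for f and C :: real
    using integrable_mult_right[OF exp_half_line(1)[of 1], of C] 
    by (rule Bochner_Integration.integrable_bound)
       (auto intro!: AE_I2 order_trans[OF that(2) abs_ge_self])
  \<comment> \<open>The point \<open>u = 0\<close> corresponds to \<open>t = \<infinity>\<close>;
    the exponential bound makes 0 the continuous value there.\<close>
  define p where "p u = (if u = 0 then 0 else q (- ln u))" for u
  have p_exp: "p (exp (- t)) = q t" for t by (simp add: p_def)
  have "continuous_on {0..1} p"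
    unfolding continuous_on_eq_continuous_within
  proof
    fix u :: real assume u: "u \<in> {0..1}"
    show "continuous (at u within {0..1}) p"
    proof (cases "u = 0")
      case False
      have "continuous_on {0<..} (\<lambda>u. q (- ln u))"
        by (intro continuous_on_compose2[OF cont] continuous_intros) auto
      then have "continuous_on {0<..} p"
        by (rule continuous_on_eq) (auto simp: p_def)
      moreover have "u \<in> {0<..}" using False u by auto
      ultimately have "isCont p u"
        using continuous_on_eq_continuous_at open_greaterThan by blast
      then show ?thesis by (rule continuous_at_imp_continuous_within)
    next
      case True
      have "(p \<longlongrightarrow> 0) (at 0 within {0..1})"
      proof (rule Lim_null_comparison)
        show "\<forall>\<^sub>F u in at 0 within {0..1}. norm (p u) \<le> M * u"
        proof (rule eventually_at_topological[THEN iffD2], intro exI[of _ UNIV] conjI ballI impI)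
          fix u :: real assume "u \<noteq> 0" "u \<in> {0..1}"
          then show "norm (p u) \<le> M * u" using bound[of "- ln u"] by (auto simp: p_def)
        qed auto
        show "((\<lambda>u. M * u) \<longlongrightarrow> 0) (at 0 within {0..1})"
          by (auto intro!: tendsto_eq_intros)
      qed
      then show ?thesis using True by (simp add: continuous_within p_def)
    qed
  qed
  note weier = Stone_Weierstrass_real_polynomial_function[OF compact_Icc this]
  define J where "J = (LINT t|lborel. indicator {0..} t * (q t * q t))"
  have int_qq: "integrable lborel (\<lambda>t. indicator {0..} t * (q t * q t))"
  proof (rule dom[of _ "M * M"])
    fix t
    show "\<bar>indicator {0..} t * (q t * q t)\<bar> \<le> M * M * (indicator {0..} t * exp (- t))"
    proof (cases "0 \<le> t")
      case True
      have "\<bar>q t\<bar> * \<bar>q t\<bar> \<le> (M * exp (- t)) * (M * exp (- t))"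
        using bound[OF True] by (intro mult_mono) (use M in auto)
      also have "\<dots> \<le> M * M * exp (- t)"
        using True M by (simp add: mult_left_mono mult_left_le mult.left_commute mult.assoc)
      finally show ?thesis using True by (simp add: abs_mult)
    qed auto
  qed simp
  \<comment> \<open>The polynomial \<open>g\<close> is orthogonal to \<open>q\<close>, so
    \<open>J\<close> is the integral of \<open>(q - g) * q\<close>, which is at most
    \<open>e\<close> times the integral of \<open>M * exp (- t)\<close>.\<close>
  have J_le: "J \<le> e * M" if e: "0 < e" for e
  proof -
    obtain g where g: "real_polynomial_function g" "\<And>u. u \<in> {0..1} \<Longrightarrow> \<bar>p u - g u\<bar> < e"
      using weier[OF e] by blast
    obtain \<alpha> n where \<alpha>: "g = (\<lambda>u. \<Sum>i\<le>n. \<alpha> i * u ^ i)"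
      using g(1) real_polynomial_function_imp_sum by blast
    have int_mon: "integrable lborel (\<lambda>t. indicator {0..} t * (exp (- real i * t) * q t))" for i :: nat
    proof (rule dom[of _ M])
      fix t
      show "\<bar>indicator {0..} t * (exp (- real i * t) * q t)\<bar> \<le> M * (indicator {0..} t * exp (- t))"
      proof (cases "0 \<le> t")
        case True
        have "exp (- real i * t) * \<bar>q t\<bar> \<le> 1 * (M * exp (- t))"
          using bound[OF True] True by (intro mult_mono) auto
        then show ?thesis using True by (simp add: abs_mult)
      qed auto
    qed simp
    have gq: "indicator {0..} t * (g (exp (- t)) * q t) =
       (\<Sum>i\<le>n. \<alpha> i * (indicator {0..} t * (exp (- real i * t) * q t)))" for t
      unfolding \<alpha> sum_distrib_left sum_distrib_right
      by (intro sum.cong refl) (simp add: exp_of_nat_mult[symmetric] mult_ac)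
    have gq_int: "integrable lborel (\<lambda>t. indicator {0..} t * (g (exp (- t)) * q t))"
      unfolding gq by (intro Bochner_Integration.integrable_sum integrable_mult_right int_mon)
    have gq_0: "(LINT t|lborel. indicator {0..} t * (g (exp (- t)) * q t)) = 0"
      unfolding gq by (subst Bochner_Integration.integral_sum)
        (use int_mon moments in \<open>auto intro!: sum.neutral integrable_mult_right\<close>)
    have "J = (LINT t|lborel. indicator {0..} t * (q t * q t) - indicator {0..} t * (g (exp (- t)) * q t))"
      unfolding J_def by (subst Bochner_Integration.integral_diff[OF int_qq gq_int]) (simp add: gq_0)
    also have "\<dots> \<le> (LINT t|lborel. e * M * (indicator {0..} t * exp (- 1 * t)))"
    proof (rule integral_mono)
      show "integrable lborel (\<lambda>t. indicator {0..} t * (q t * q t) - indicator {0..} t * (g (exp (- t)) * q t))"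
        by (intro Bochner_Integration.integrable_diff int_qq gq_int)
      show "integrable lborel (\<lambda>t. e * M * (indicator {0..} t * exp (- 1 * t)))"
        using exp_half_line(1)[of 1] by (intro integrable_mult_right) simp
      fix t :: real
      show "indicator {0..} t * (q t * q t) - indicator {0..} t * (g (exp (- t)) * q t)
              \<le> e * M * (indicator {0..} t * exp (- 1 * t))"
      proof (cases "0 \<le> t")
        case True
        have "(q t - g (exp (- t))) * q t \<le> \<bar>q t - g (exp (- t))\<bar> * \<bar>q t\<bar>"
          by (metis abs_ge_self abs_mult)
        also have "\<dots> \<le> e * (M * exp (- t))"
          using g(2)[of "exp (- t)"] p_exp[of t] bound[OF True] True e by (intro mult_mono) auto
        finally show ?thesis using True by (simp add: algebra_simps)
      qed auto
    qed
    also have "\<dots> = e * M"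
      by (subst integral_mult_right_zero) (use exp_half_line(2)[of 1] in simp)
    finally show ?thesis .
  qed
  have "J \<le> 0"
  proof (rule field_le_epsilon)
    fix e :: real assume e: "0 < e"
    have "J \<le> e / (M + 1) * M" using e M by (intro J_le) auto
    also have "\<dots> \<le> 0 + e" using e M by (simp add: field_simps)
    finally show "J \<le> 0 + e" .
  qed
  \<comment> \<open>An interval of positive length that contains \<open>t\<close>, even for
    \<open>t = 0\<close>; on it a continuous nonnegative function with integral 0 vanishes.\<close>
  define T where "T = t + 1"
  have si: "set_integrable lborel {0..T} (\<lambda>t. q t * q t)"
    by (rule set_integrable_subset[of _ "{0..}"]) (use int_qq in \<open>auto simp: set_integrable_def\<close>)
  have "(LINT t:{0..T}|lborel. q t * q t) \<le> J"
    unfolding J_def set_lebesgue_integral_def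
    by (intro integral_mono int_qq) (use si in \<open>auto simp: set_integrable_def indicator_def\<close>)
  moreover have "0 \<le> (LINT t:{0..T}|lborel. q t * q t)"
    unfolding set_lebesgue_integral_def by (intro integral_nonneg_AE) auto
  ultimately have "integral {0..T} (\<lambda>t. q t * q t) = 0"
    using \<open>J \<le> 0\<close> set_borel_integral_eq_integral(2)[OF si] by simp
  then have "((\<lambda>t. q t * q t) has_integral 0) (cbox 0 T)"
    using set_borel_integral_eq_integral(1)[OF si] by (metis integrable_integral interval_cbox)
  then have "q t * q t = 0"
    by (rule has_integral_0_cbox_imp_0[rotated 2])
       (use \<open>0 \<le> t\<close> in \<open>auto simp: T_def intro!: continuous_intros continuous_on_subset[OF cont]\<close>)
  then show ?thesis by simp
qed

section \<open>The Mellin integral split at \<open>x = 1\<close>\<close>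

context abs_dirichlet
begin

text \<open>The cut separates the two ends: exponential decay makes the transform of
  \<open>upper\<close> entire, while that of \<open>lower\<close> is available for
  \<open>Re s \<ge> c\<close>.\<close>

definition upper :: "real \<Rightarrow> complex" where
  "upper t = indicator {0..} t * theta a lam (of_real (exp t))"

definition lower :: "real \<Rightarrow> complex" where
  "lower t = indicator {..<0} t * theta a lam (of_real (exp t))"

lemma upper_measurable [measurable]: "upper \<in> borel_measurable borel"
  and lower_measurable [measurable]: "lower \<in> borel_measurable borel"
  unfolding upper_def[abs_def] lower_def[abs_def] by measurable

lemma upper_integrable: "integrable lborel (\<lambda>t. exp (\<sigma> * t) * norm (upper t))"
proof -
  have "integrable lborel (\<lambda>t. bnd * (exp ((\<bar>\<sigma>\<bar> + 1) * t) * exp (- (lam 1 / 2) * exp t)))"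
    using lam1_pos by (intro integrable_mult_right integrable_exp_exp) auto
  then show ?thesis
  proof (rule Bochner_Integration.integrable_bound)
    show "AE t in lborel. norm (exp (\<sigma> * t) * norm (upper t)) \<le>
        norm (bnd * (exp ((\<bar>\<sigma>\<bar> + 1) * t) * exp (- (lam 1 / 2) * exp t)))"
    proof (rule AE_I2)
      fix t :: real
      show "norm (exp (\<sigma> * t) * norm (upper t)) \<le>
        norm (bnd * (exp ((\<bar>\<sigma>\<bar> + 1) * t) * exp (- (lam 1 / 2) * exp t)))"
      proof (cases "0 \<le> t")
        case True
        have "exp (\<sigma> * t) * norm (upper t) \<le> exp (\<sigma> * t) * (bnd * exp (- c * t) * exp (- (lam 1 / 2) * exp t))"
          using norm_theta_exp_le[of t] by (intro mult_left_mono) (auto simp: upper_def norm_mult True)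
        also have "\<dots> = exp ((\<sigma> - c) * t) * (bnd * exp (- (lam 1 / 2) * exp t))"
        proof -
          have "exp (\<sigma> * t) * exp (- c * t) = exp ((\<sigma> - c) * t)"
            by (simp add: mult_exp_exp left_diff_distrib)
          then show ?thesis by (metis mult.assoc mult.left_commute)
        qed
        also have "\<dots> \<le> exp ((\<bar>\<sigma>\<bar> + 1) * t) * (bnd * exp (- (lam 1 / 2) * exp t))"
        proof (rule mult_right_mono)
          have "(\<sigma> - c) * t \<le> (\<bar>\<sigma>\<bar> + 1) * t"
            using True c_pos by (intro mult_right_mono) linarith+
          then show "exp ((\<sigma> - c) * t) \<le> exp ((\<bar>\<sigma>\<bar> + 1) * t)" by simp
        qed (use bnd_nonneg in simp)
        finally show ?thesis using bnd_nonneg by (simp add: mult_ac)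
      qed (simp add: upper_def)
    qed
  qed measurable
qed

lemma lower_integrable:
  assumes "c \<le> \<sigma>"
  shows "integrable lborel (\<lambda>t. exp (\<sigma> * t) * norm (lower t))"
proof -
  have "integrable lborel (\<lambda>t. norm (exp (of_real \<sigma> * of_real t) * theta a lam (of_real (exp t))))"
    using assms by (intro integrable_norm laplace_theta(1)) auto
  then show ?thesis
    by (rule Bochner_Integration.integrable_bound)
       (measurable, auto simp: norm_mult lower_def indicator_def)
qed

lemma laplace_upper_entire: "laplace upper holomorphic_on UNIV"
  using upper_integrable by (intro laplace_entire) auto

text \<open>On \<open>t \<ge> 0\<close> the weight grows with \<open>Re s\<close>, so one bound
  serves a whole left half-plane. For \<open>lower\<close> the monotonicity is reversed and one
  bound serves a right half-plane.\<close>

lemma norm_laplace_upper_le: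
  assumes "Re s \<le> \<sigma>"
  shows "norm (laplace upper s) \<le> (LINT t|lborel. exp (\<sigma> * t) * norm (upper t))"
proof (rule order_trans[OF norm_laplace_le], rule integral_mono[OF upper_integrable upper_integrable])
  fix t :: real
  show "exp (Re s * t) * norm (upper t) \<le> exp (\<sigma> * t) * norm (upper t)"
  proof (cases "0 \<le> t")
    case True
    then have "exp (Re s * t) \<le> exp (\<sigma> * t)" using assms by (simp add: mult_right_mono)
    then show ?thesis by (rule mult_right_mono) simp
  qed (simp add: upper_def)
qed

lemma norm_laplace_lower_le:
  assumes "c \<le> \<sigma>" "\<sigma> \<le> Re s"
  shows "norm (laplace lower s) \<le> (LINT t|lborel. exp (\<sigma> * t) * norm (lower t))"
proof (rule order_trans[OF norm_laplace_le], rule integral_mono)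
  fix t :: real
  show "exp (Re s * t) * norm (lower t) \<le> exp (\<sigma> * t) * norm (lower t)"
  proof (cases "0 \<le> t")
    case False
    then have "exp (Re s * t) \<le> exp (\<sigma> * t)" using assms by (simp add: mult_right_mono_neg)
    then show ?thesis by (rule mult_right_mono) simp
  qed (simp add: lower_def)
qed (use assms in \<open>auto intro!: lower_integrable\<close>)

lemma laplace_theta_split:
  assumes "c \<le> Re s"
  shows "Gamma s * dirichlet_series a lam s = laplace upper s + laplace lower s"
proof -
  have "Gamma s * dirichlet_series a lam s = laplace (\<lambda>t. theta a lam (of_real (exp t))) s"
    using laplace_theta(2)[OF assms] by simp
  also have "(\<lambda>t. theta a lam (of_real (exp t))) = (\<lambda>t. upper t + lower t)"
    by (auto simp: fun_eq_iff upper_def lower_def indicator_def)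
  also have "laplace (\<lambda>t. upper t + lower t) s = laplace upper s + laplace lower s"
    unfolding laplace_def distrib_left
    by (rule Bochner_Integration.integral_add; rule integrable_laplace)
       (use assms upper_integrable lower_integrable in auto)
  finally show ?thesis .
qed

end

subsection \<open>The modular relation\<close>

lemma Re_one_divide_pos:
  fixes z :: complex
  assumes "0 < Re z"
  shows "0 < Re (1 / z)"
  using assms by (auto simp: Re_divide intro!: divide_pos_pos add_pos_nonneg)

context class_A_series
begin

text \<open>By Liouville's theorem \<open>laplace A.upper s + laplace B.upper (r - s) - H s\<close> is constant: it is
  bounded in vertical strips because \<open>Gamma s * \<phi> s\<close> decays there, and in the two remaining
  half-planes the functional equation rewrites it as a Laplace transform over a half-line.\<close>

lemma completed_constant:
  assumes A: "abs_dirichlet a lam c" and B: "abs_dirichlet b mu c"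
    and c: "abscissa a lam < c" "abscissa b mu < c"
  obtains C where "\<And>s. Re s \<le> - (c + r + 1) \<Longrightarrow>
    laplace (abs_dirichlet.upper a lam) s - laplace (abs_dirichlet.lower b mu) (of_real r - s)
      - a 0 / s + b 0 / (s - of_real r) = C"
proof -
  interpret A: abs_dirichlet a lam c by (rule A)
  interpret B: abs_dirichlet b mu c by (rule B)
  \<comment> \<open>\<open>K \<ge> c\<close> makes the \<open>lower\<close> transforms available;
    \<open>K \<ge> r + 1\<close> and \<open>K \<ge> 1\<close> keep the polar denominators of norm at
    least 1.\<close>
  define K where "K = c + r + 1"
  have K: "c \<le> K" "r + 1 \<le> K" "1 \<le> K" using A.c_pos r_pos by (auto simp: K_def)
  obtain H where H: "H holomorphic_on UNIV"
    "\<And>s. s \<notin> \<int>\<^sub>\<le>\<^sub>0 \<Longrightarrow> s \<noteq> of_real r \<or> b 0 = 0 \<Longrightarrow> Gamma s * \<phi> s = H s - a 0 / s + b 0 / (s - of_real r)"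
    "\<And>s. of_real r - s \<notin> \<int>\<^sub>\<le>\<^sub>0 \<Longrightarrow> s \<noteq> 0 \<or> a 0 = 0 \<Longrightarrow>
       Gamma (of_real r - s) * \<psi> (of_real r - s) = H s - a 0 / s + b 0 / (s - of_real r)"
    "b 0 = Gamma (of_real r) * residue \<phi> (of_real r)"
    by (rule regular_part_exists[OF that])
  define W where "W s = laplace A.upper s + laplace B.upper (of_real r - s) - H s" for s
  have "laplace B.upper \<circ> (\<lambda>s. of_real r - s) holomorphic_on UNIV"
    by (rule holomorphic_on_compose_gen[OF _ B.laplace_upper_entire]) (auto intro!: holomorphic_intros)
  then have "W holomorphic_on UNIV"
    unfolding W_def using A.laplace_upper_entire H(1) by (intro holomorphic_intros) (auto simp: o_def)
  \<comment> \<open>Splitting \<open>Gamma s * \<phi> s\<close> cancels the transform of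
    \<open>A.upper\<close>, which is not controlled for large \<open>Re s\<close>; every remaining
    term is bounded in this half-plane.\<close>
  have right: "W s = laplace B.upper (of_real r - s) - laplace A.lower s - a 0 / s + b 0 / (s - of_real r)"
    if s: "K \<le> Re s" for s
  proof -
    have "Gamma s * \<phi> s = laplace A.upper s + laplace A.lower s"
      using A.laplace_theta_split[of s] \<phi>_series[of s] s K c by simp
    moreover have "Gamma s * \<phi> s = H s - a 0 / s + b 0 / (s - of_real r)"
    proof (rule H(2))
      show "s \<notin> \<int>\<^sub>\<le>\<^sub>0" using s K by (intro not_nonpos_Int_if_Re) auto
      have "Re s \<noteq> r" using s K by auto
      then show "s \<noteq> of_real r \<or> b 0 = 0" by auto
    qed
    ultimately show ?thesis by (simp add: W_def algebra_simps)
  qed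
  have left: "W s = laplace A.upper s - laplace B.lower (of_real r - s) - a 0 / s + b 0 / (s - of_real r)"
    if s: "Re s \<le> - K" for s
  proof -
    have "Gamma (of_real r - s) * \<psi> (of_real r - s) = laplace B.upper (of_real r - s) + laplace B.lower (of_real r - s)"
      using B.laplace_theta_split[of "of_real r - s"] \<psi>_series[of "of_real r - s"] s K c r_pos by simp
    moreover have "Gamma (of_real r - s) * \<psi> (of_real r - s) = H s - a 0 / s + b 0 / (s - of_real r)"
    proof (rule H(3))
      show "of_real r - s \<notin> \<int>\<^sub>\<le>\<^sub>0" using s K r_pos by (intro not_nonpos_Int_if_Re) auto
      show "s \<noteq> 0 \<or> a 0 = 0" using s K by auto
    qed
    ultimately show ?thesis by (simp add: W_def algebra_simps)
  qed
  define Ua where "Ua \<sigma> = (LINT t|lborel. exp (\<sigma> * t) * norm (A.upper t))" for \<sigma>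
  define Ub where "Ub \<sigma> = (LINT t|lborel. exp (\<sigma> * t) * norm (B.upper t))" for \<sigma>
  define La where "La \<sigma> = (LINT t|lborel. exp (\<sigma> * t) * norm (A.lower t))" for \<sigma>
  define Lb where "Lb \<sigma> = (LINT t|lborel. exp (\<sigma> * t) * norm (B.lower t))" for \<sigma>
  have frac: "norm (x / y) \<le> norm x" if "1 \<le> norm y" for x y :: complex
    using that mult_left_mono[of 1 "norm y" "norm x"] by (auto simp: norm_divide divide_le_eq)
  have polar: "norm (a 0 / s) \<le> norm (a 0)" "norm (b 0 / (s - of_real r)) \<le> norm (b 0)"
    if "K \<le> \<bar>Re s\<bar> \<or> 1 \<le> \<bar>Im s\<bar>" for s
    using that K r_pos abs_Re_le_cmod[of s] abs_Im_le_cmod[of s]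
      abs_Re_le_cmod[of "s - of_real r"] abs_Im_le_cmod[of "s - of_real r"]
    by (auto intro!: frac)
  obtain T where T: "\<And>s. - K \<le> Re s \<Longrightarrow> Re s \<le> K \<Longrightarrow> T \<le> \<bar>Im s\<bar> \<Longrightarrow> norm (Gamma s * \<phi> s) < 1"
    using completed_decay[of "-K" K] by blast
  define T' where "T' = max T 1"
  have "compact (H ` cbox (Complex (- K) (- T')) (Complex K T'))"
    using H(1) by (intro compact_continuous_image compact_cbox holomorphic_on_imp_continuous_on)
      (auto intro: holomorphic_on_subset)
  then obtain Mh where Mh: "\<And>s. s \<in> cbox (Complex (- K) (- T')) (Complex K T') \<Longrightarrow> norm (H s) \<le> Mh"
    using compact_imp_bounded bounded_iff by (metis imageI)
  define M where "M = Ua K + Ub (r + K) + max Mh (1 + norm (a 0) + norm (b 0))"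
  \<comment> \<open>Compactness covers the central box, the decay of the completed series covers the
    rest of the strip.\<close>
  have mid: "norm (W s) \<le> M" if s: "\<bar>Re s\<bar> \<le> K" for s
  proof -
    have "norm (H s) \<le> max Mh (1 + norm (a 0) + norm (b 0))"
    proof (cases "\<bar>Im s\<bar> \<le> T'")
      case True
      then have "norm (H s) \<le> Mh" using s by (intro Mh) (auto simp: in_cbox_complex_iff)
      then show ?thesis by simp
    next
      case False
      then have im: "1 \<le> \<bar>Im s\<bar>" "T \<le> \<bar>Im s\<bar>" by (auto simp: T'_def)
      have "s \<noteq> of_real r" using im(1) by auto
      then have "H s = Gamma s * \<phi> s + a 0 / s - b 0 / (s - of_real r)"
        using H(2)[of s] not_nonpos_Int_if_Im[of s] im(1) by auto
      then have "norm (H s) \<le> norm (Gamma s * \<phi> s) + norm (a 0 / s) + norm (b 0 / (s - of_real r))"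
        by (metis norm_triangle_ineq norm_triangle_ineq4 add_right_mono order_trans)
      also have "\<dots> \<le> 1 + norm (a 0) + norm (b 0)"
        using T[of s] s im polar[of s] by (intro add_mono less_imp_le[OF T]) auto
      finally show ?thesis by simp
    qed
    moreover have "norm (laplace A.upper s) \<le> Ua K" "norm (laplace B.upper (of_real r - s)) \<le> Ub (r + K)"
      unfolding Ua_def Ub_def using s by (auto intro!: A.norm_laplace_upper_le B.norm_laplace_upper_le)
    ultimately show ?thesis unfolding W_def M_def
      using norm_triangle_ineq4[of "laplace A.upper s + laplace B.upper (of_real r - s)" "H s"]
        norm_triangle_ineq[of "laplace A.upper s" "laplace B.upper (of_real r - s)"] by linarith
  qed
  define M2 where "M2 = Ub (r - K) + La K + norm (a 0) + norm (b 0)"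
  define M3 where "M3 = Ua (- K) + Lb (r + K) + norm (a 0) + norm (b 0)"
  have tri: "norm (x - y - z + w) \<le> norm x + norm y + norm z + norm w" for x y z w :: complex
    using norm_triangle_ineq[of "x - y - z" w] norm_triangle_ineq4[of "x - y" z] norm_triangle_ineq4[of x y]
    by linarith
  have rb: "norm (W s) \<le> M2" if s: "K \<le> Re s" for s
  proof -
    have "norm (laplace B.upper (of_real r - s)) \<le> Ub (r - K)" "norm (laplace A.lower s) \<le> La K"
      unfolding La_def Ub_def using s K by (auto intro!: A.norm_laplace_lower_le B.norm_laplace_upper_le)
    then show ?thesis unfolding right[OF s] M2_def
      using polar[of s] s K by (intro order_trans[OF tri] add_mono) auto
  qed
  have lb: "norm (W s) \<le> M3" if s: "Re s \<le> - K" for s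
  proof -
    have "norm (laplace A.upper s) \<le> Ua (- K)" "norm (laplace B.lower (of_real r - s)) \<le> Lb (r + K)"
      unfolding Lb_def Ua_def using s K r_pos
      by (intro B.norm_laplace_lower_le A.norm_laplace_upper_le; simp)+
    then show ?thesis unfolding left[OF s] M3_def
      using polar[of s] s K by (intro order_trans[OF tri] add_mono) auto
  qed
  have "norm (W s) \<le> max M (max M2 M3)" for s
    using mid[of s] rb[of s] lb[of s] by (cases "\<bar>Re s\<bar> \<le> K") (auto simp: le_max_iff_disj abs_if split: if_splits)
  then have "bounded (range W)" by (auto simp: bounded_iff)
  with \<open>W holomorphic_on UNIV\<close> have "W constant_on UNIV" by (rule Liouville_theorem)
  then obtain C where "\<And>s. W s = C" by (auto simp: constant_on_def)
  then show ?thesis using left that[of C] unfolding K_def by metis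
qed

text \<open>The constant of the previous lemma is the Laplace transform over a half-line of the defect \<open>D\<close> of
  the modular relation. So the exponential moments of \<open>(1 - exp (- t)) * D t\<close> are differences of equal
  constants and vanish, which spares computing the constant.\<close>

lemma theta_modular_real:
  assumes "0 < t"
  shows "theta a lam (of_real (exp t)) + a 0 =
    of_real (exp (- r * t)) * (theta b mu (of_real (exp (- t))) + b 0)"
proof -
  define c where "c = max 0 (max (abscissa a lam) (abscissa b mu)) + 1"
  have c: "0 < c" "abscissa a lam < c" "abscissa b mu < c" by (auto simp: c_def)
  interpret A: abs_dirichlet a lam c by (rule abs_dirichlet_a[OF c(1,2)])
  interpret B: abs_dirichlet b mu c by (rule abs_dirichlet_b[OF c(1,3)])
  obtain C where C: "\<And>s. Re s \<le> - (c + r + 1) \<Longrightarrow>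
    laplace A.upper s - laplace B.lower (of_real r - s) - a 0 / s + b 0 / (s - of_real r) = C"
    using completed_constant[OF A.abs_dirichlet_axioms B.abs_dirichlet_axioms c(2,3)] by blast
  define K where "K = c + r + 1"
  \<comment> \<open>With the weight \<open>E x\<close> the transforms of the previous lemma at
    \<open>s = - x\<close> become integrals over \<open>t \<ge> 0\<close>.\<close>
  define E where "E x t = complex_of_real (indicator {0..} t * exp (- x * t))" for x t
  define \<theta>a where "\<theta>a t = theta a lam (of_real (exp t))" for t
  define \<theta>b where "\<theta>b t = theta b mu (of_real (exp (- t)))" for t
  define D where "D t = \<theta>a t + a 0 - of_real (exp (- r * t)) * (\<theta>b t + b 0)" for t
  have E_int: "integrable lborel (\<lambda>t. E x t * z)" and E_eq: "(LINT t|lborel. E x t * z) = z / of_real x"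
    if "0 < x" for x z
  proof -
    show "integrable lborel (\<lambda>t. E x t * z)"
      unfolding E_def by (intro integrable_mult_left integrable_of_real exp_half_line that)
    have "(LINT t|lborel. E x t * z) = (LINT t|lborel. E x t) * z" by (rule integral_mult_left_zero)
    also have "(LINT t|lborel. E x t) = of_real (1 / x)"
      unfolding E_def integral_complex_of_real exp_half_line(2)[OF that] ..
    finally show "(LINT t|lborel. E x t * z) = z / of_real x" by simp
  qed
  have up: "E x t * \<theta>a t = exp (of_real (- x) * of_real t) * A.upper t" for x t
    by (simp add: E_def \<theta>a_def A.upper_def indicator_def exp_of_real flip: of_real_mult of_real_minus)
  have Ua_int: "integrable lborel (\<lambda>t. E x t * \<theta>a t)" for x
    unfolding up by (intro integrable_laplace) (use A.upper_integrable[of "- x"] in auto)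
  have Ua_eq: "(LINT t|lborel. E x t * \<theta>a t) = laplace A.upper (of_real (- x))" for x
    unfolding up laplace_def ..
  have low: "E x t * \<theta>b t = exp (of_real x * of_real (0 + -1 * t)) * B.lower (0 + -1 * t)" if "t \<noteq> 0" for x t
    using that
    by (simp add: E_def \<theta>b_def B.lower_def indicator_def exp_of_real flip: of_real_mult of_real_minus)
  \<comment> \<open>\<open>lower\<close> vanishes at 0 but \<open>E x\<close> does not, so the
    reflected identity is claimed only away from \<open>t = 0\<close>.\<close>
  have ae: "AE t in lborel. E x t * \<theta>b t = exp (of_real x * of_real (0 + -1 * t)) * B.lower (0 + -1 * t)" for x
    using AE_lborel_singleton[of 0] by eventually_elim (rule low)
  have meas_a [measurable]: "\<theta>a \<in> borel_measurable borel" unfolding \<theta>a_def by measurable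
  have contb: "continuous_on UNIV \<theta>b" unfolding \<theta>b_def
    by (rule continuous_on_compose2[OF B.continuous_on_theta_exp]) (auto intro!: continuous_intros)
  have conta: "continuous_on UNIV \<theta>a" unfolding \<theta>a_def by (rule A.continuous_on_theta_exp)
  have meas_b [measurable]: "\<theta>b \<in> borel_measurable borel"
    using contb by (rule borel_measurable_continuous_onI)
  have meas_E [measurable]: "E x \<in> borel_measurable borel" for x unfolding E_def by measurable
  have low_int: "integrable lborel (\<lambda>t. exp (of_real x * of_real t) * B.lower t)" if "c \<le> x" for x
    by (intro integrable_laplace) (use B.lower_integrable that in auto)
  have meas_aff: "(\<lambda>t. exp (of_real x * of_real (0 + -1 * t)) * B.lower (0 + -1 * t)) \<in> borel_measurable lborel" for x
    by (auto intro!: borel_measurable_times borel_measurable_continuous_onI continuous_intros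
        simp: measurable_compose[OF _ B.lower_measurable])
  have Lb_int: "integrable lborel (\<lambda>t. E x t * \<theta>b t)" if "c \<le> x" for x
    using lborel_integrable_real_affine[OF low_int[OF that], of "-1" 0]
    by (rule integrable_cong_AE_imp) (use ae[of x] in auto)
  have Lb_eq: "(LINT t|lborel. E x t * \<theta>b t) = laplace B.lower (of_real x)" if "c \<le> x" for x
  proof -
    have "(LINT t|lborel. E x t * \<theta>b t) = (LINT t|lborel. exp (of_real x * of_real (0 + -1 * t)) * B.lower (0 + -1 * t))"
      by (rule integral_cong_AE[OF _ meas_aff ae]) simp
    also have "\<dots> = laplace B.lower (of_real x)"
      unfolding laplace_def by (subst (2) lborel_integral_real_affine[where c = "-1" and t = 0]) auto
    finally show ?thesis .
  qed
  \<comment> \<open>The factor \<open>exp (- r * t)\<close> raises the weight from \<open>x\<close>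
    to \<open>x + r\<close>, which is the argument \<open>r - s\<close> of the dual transform at
    \<open>s = - x\<close>.\<close>
  have ED: "E x t * D t = E x t * \<theta>a t - E (x + r) t * \<theta>b t + E x t * a 0 - E (x + r) t * b 0" for x t
  proof -
    have "E x t * of_real (exp (- r * t)) = E (x + r) t"
    proof -
      have "exp (- x * t) * exp (- r * t) = exp (- (x + r) * t)"
        by (simp add: mult_exp_exp algebra_simps)
      then show ?thesis unfolding E_def of_real_mult[symmetric] mult.assoc by (simp only:)
    qed
    then show ?thesis by (simp add: D_def right_diff_distrib distrib_left flip: mult.assoc)
  qed
  have ED_int: "integrable lborel (\<lambda>t. E x t * D t)" if "K \<le> x" for x
    unfolding ED using that c r_pos
    by (intro Bochner_Integration.integrable_add Bochner_Integration.integrable_diff Ua_int Lb_int E_int)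
       (auto simp: K_def)
  have ED_eq: "(LINT t|lborel. E x t * D t) = C" if "K \<le> x" for x
  proof -
    have x: "0 < x" "0 < x + r" "c \<le> x + r" using that c r_pos by (auto simp: K_def)
    have "(LINT t|lborel. E x t * D t) = laplace A.upper (of_real (- x)) - laplace B.lower (of_real (x + r))
        + a 0 / of_real x - b 0 / of_real (x + r)"
      unfolding ED Ua_eq[symmetric] Lb_eq[OF x(3), symmetric] E_eq[OF x(1), symmetric] E_eq[OF x(2), symmetric]
      by (simp add: Ua_int Lb_int[OF x(3)] E_int[OF x(1)] E_int[OF x(2)])
    also have "\<dots> = laplace A.upper (of_real (- x)) - laplace B.lower (of_real r - of_real (- x))
        - a 0 / of_real (- x) + b 0 / (of_real (- x) - of_real r)"
    proof -
      have "of_real (- x) - of_real r = (- of_real (x + r) :: complex)" by simp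
      then have "b 0 / (of_real (- x) - of_real r) = - (b 0 / of_real (x + r))"
        by (simp only: divide_minus_right)
      moreover have "of_real r - of_real (- x) = (of_real (x + r) :: complex)" by simp
      ultimately show ?thesis by (simp only: of_real_minus divide_minus_right) simp
    qed
    also have "\<dots> = C" using that by (intro C) (auto simp: K_def)
    finally show ?thesis .
  qed
  \<comment> \<open>\<open>exp (- K * t)\<close> moves all moments to where the constant applies and
    outweighs the growth \<open>exp (c * t)\<close> of \<open>D\<close>. The factor
    \<open>1 - exp (- t)\<close> turns each moment into a difference of two equal constants; it
    vanishes at \<open>t = 0\<close>, hence the assumption \<open>0 < t\<close>.\<close>
  define Q where "Q t = of_real (exp (- K * t) * (1 - exp (- t))) * D t" for t
  have contQ: "continuous_on UNIV Q"
    unfolding Q_def D_def by (intro continuous_intros conta contb)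
  have QE: "of_real (indicator {0..} t * exp (- real n * t)) * Q t = E (K + n) t * D t - E (K + n + 1) t * D t" for n :: nat and t
  proof -
    have "exp (- real n * t) * (exp (- K * t) * (1 - exp (- t))) = exp (- (K + n) * t) - exp (- (K + n + 1) * t)"
      by (simp add: right_diff_distrib mult_exp_exp algebra_simps)
    then have "indicator {0..} t * exp (- real n * t) * (exp (- K * t) * (1 - exp (- t))) =
      indicator {0..} t * exp (- (K + n) * t) - indicator {0..} t * exp (- (K + n + 1) * t)"
      by (metis mult.assoc right_diff_distrib)
    then have "complex_of_real (indicator {0..} t * exp (- real n * t)) * of_real (exp (- K * t) * (1 - exp (- t))) = E (K + n) t - E (K + n + 1) t"
      unfolding E_def of_real_mult[symmetric] of_real_diff[symmetric] by (simp only:)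
    then show ?thesis unfolding Q_def left_diff_distrib[symmetric] mult.assoc[symmetric] by (simp only:)
  qed
  have moments: "integrable lborel (\<lambda>t. of_real (indicator {0..} t * exp (- real n * t)) * Q t)"
    "(LINT t|lborel. of_real (indicator {0..} t * exp (- real n * t)) * Q t) = 0" for n :: nat
    unfolding QE using ED_int[of "K + n"] ED_int[of "K + n + 1"] ED_eq[of "K + n"] ED_eq[of "K + n + 1"]
    by auto
  define M where "M = A.bnd + norm (a 0) + (B.bnd + norm (b 0))"
  have Q_le: "norm (Q t) \<le> M * exp (- t)" if t: "0 \<le> t" for t
  proof -
    have ca: "exp (- (c * t)) \<le> 1" "1 \<le> exp (c * t)" using t c by auto
    have "norm (\<theta>a t) \<le> A.bnd * exp (- c * t) * exp (- (lam 1 / 2) * exp t)"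
      unfolding \<theta>a_def by (rule A.norm_theta_exp_le)
    also have "\<dots> \<le> A.bnd * 1 * 1"
      using ca A.bnd_nonneg A.lam1_pos by (intro mult_mono mult_nonneg_nonneg) auto
    finally have 1: "norm (\<theta>a t) \<le> A.bnd * exp (c * t)"
      using ca A.bnd_nonneg by (simp add: mult_le_cancel_left1 order_trans[OF _ mult_left_mono[of 1]])
    have "norm (\<theta>b t) \<le> B.bnd * exp (- c * - t) * exp (- (mu 1 / 2) * exp (- t))"
      unfolding \<theta>b_def by (rule B.norm_theta_exp_le)
    also have "\<dots> \<le> B.bnd * exp (c * t) * 1"
      using ca B.bnd_nonneg B.lam1_pos by (intro mult_mono mult_nonneg_nonneg) auto
    finally have 2: "norm (\<theta>b t) \<le> B.bnd * exp (c * t)" by simp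
    have er: "exp (- (r * t)) \<le> 1" using t r_pos by simp
    have "norm (D t) \<le> norm (\<theta>a t) + norm (a 0) + exp (- (r * t)) * (norm (\<theta>b t) + norm (b 0))"
      unfolding D_def
      by (intro norm_triangle_le_diff add_mono norm_triangle_ineq)
         (auto simp: norm_mult intro!: mult_left_mono norm_triangle_ineq)
    also have "\<dots> \<le> A.bnd * exp (c * t) + norm (a 0) * exp (c * t) + 1 * (B.bnd * exp (c * t) + norm (b 0) * exp (c * t))"
      using 1 2 ca er mult_left_mono[of 1 "exp (c * t)"] by (intro add_mono mult_mono) auto
    also have "\<dots> = M * exp (c * t)" by (simp add: M_def algebra_simps)
    finally have "norm (D t) \<le> M * exp (c * t)" .
    moreover have "norm (complex_of_real (exp (- K * t) * (1 - exp (- t)))) \<le> exp (- K * t) * 1"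
      unfolding norm_of_real abs_mult using t by (intro mult_mono) auto
    ultimately have "norm (Q t) \<le> exp (- K * t) * 1 * (M * exp (c * t))"
      unfolding Q_def norm_mult by (intro mult_mono) auto
    also have "\<dots> = M * exp (- (r + 1) * t)"
      by (simp add: K_def mult_exp_exp algebra_simps)
    also have "\<dots> \<le> M * exp (- t)"
      using t r_pos A.bnd_nonneg B.bnd_nonneg by (intro mult_left_mono) (auto simp: M_def algebra_simps)
    finally show ?thesis .
  qed
  \<comment> \<open>The uniqueness lemma concerns real functions, so real and imaginary part are
    treated separately.\<close>
  have "Re (Q t) = 0"
  proof (rule exp_moments_eq_0[where M = M and q = "\<lambda>t. Re (Q t)"])
    fix n :: nat
    have "(LINT t|lborel. Re (of_real (indicator {0..} t * exp (- real n * t)) * Q t)) = 0"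
      by (subst integral_Re) (use moments[of n] in simp_all)
    then show "(LINT t|lborel. indicator {0..} t * (exp (- real n * t) * Re (Q t))) = 0"
      by (simp add: mult.assoc)
  qed (use assms Q_le abs_Re_le_cmod in \<open>auto intro!: continuous_intros contQ intro: order_trans\<close>)
  moreover have "Im (Q t) = 0"
  proof (rule exp_moments_eq_0[where M = M and q = "\<lambda>t. Im (Q t)"])
    fix n :: nat
    have "(LINT t|lborel. Im (of_real (indicator {0..} t * exp (- real n * t)) * Q t)) = 0"
      by (subst integral_Im) (use moments[of n] in simp_all)
    then show "(LINT t|lborel. indicator {0..} t * (exp (- real n * t) * Im (Q t))) = 0"
      by (simp add: mult.assoc)
  qed (use assms Q_le abs_Im_le_cmod in \<open>auto intro!: continuous_intros contQ intro: order_trans\<close>)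
  ultimately have "Q t = 0" by (simp add: complex_eq_iff)
  then have "D t = 0" using assms by (simp add: Q_def)
  then show ?thesis by (simp add: D_def \<theta>a_def \<theta>b_def)
qed

text \<open>The map \<open>z \<mapsto> 1 / z\<close> preserves the right half-plane, so both sides
  are holomorphic there. The preceding lemma gives equality for real \<open>z > 1\<close>, a set
  with accumulation point 2.\<close>

lemma theta_modular:
  assumes "0 < Re z"
  shows "theta a lam z + a 0 = z powr (- of_real r) * (theta b mu (1 / z) + b 0)"
proof -
  define c where "c = max 0 (max (abscissa a lam) (abscissa b mu)) + 1"
  have c: "0 < c" "abscissa a lam < c" "abscissa b mu < c" by (auto simp: c_def)
  interpret A: abs_dirichlet a lam c by (rule abs_dirichlet_a[OF c(1,2)])
  interpret B: abs_dirichlet b mu c by (rule abs_dirichlet_b[OF c(1,3)])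
  define S where "S = {z :: complex. 0 < Re z}"
  define f where "f z = theta a lam z + a 0 - z powr (- of_real r) * (theta b mu (1 / z) + b 0)" for z
  have "open S" "connected S"
    by (auto simp: S_def open_halfspace_Re_gt convex_connected convex_halfspace_Re_gt)
  have "theta b mu \<circ> (\<lambda>z. 1 / z) holomorphic_on S"
    by (rule holomorphic_on_compose_gen[OF _ B.theta_holomorphic])
       (auto intro!: holomorphic_intros Re_one_divide_pos simp: S_def simp del: Re_divide)
  then have "f holomorphic_on S"
    unfolding f_def using A.theta_holomorphic
    by (intro holomorphic_intros) (auto simp: S_def o_def complex_nonpos_Reals_iff)
  moreover define U where "U = (of_real ` {1<..} :: complex set)"
  have "U \<subseteq> S" by (auto simp: U_def S_def)
  moreover have "2 \<in> S" "z \<in> S" using assms by (auto simp: S_def)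
  moreover have "(2::complex) islimpt U"
  proof -
    have "(\<lambda>n. complex_of_real (2 + inverse (real (Suc n)))) \<longlonglongrightarrow> of_real (2 + 0)"
      by (intro tendsto_intros LIMSEQ_inverse_real_of_nat)
    moreover have "complex_of_real (2 + inverse (real (Suc n))) \<in> U - {2}" for n
    proof -
      have pos: "0 < inverse (real (Suc n))" by simp
      then have "complex_of_real (2 + inverse (real (Suc n))) \<noteq> of_real 2"
        unfolding of_real_eq_iff by linarith
      moreover have "1 < 2 + inverse (real (Suc n))" using pos by linarith
      ultimately show ?thesis
        unfolding U_def by (intro DiffI imageI) auto
    qed
    ultimately show ?thesis
      unfolding islimpt_sequential
      by (intro exI[of _ "\<lambda>n. complex_of_real (2 + inverse (real (Suc n)))"]) simp
  qed
  moreover have "f w = 0" if "w \<in> U" for w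
  proof -
    obtain x where x: "w = of_real x" "1 < x" using \<open>w \<in> U\<close> by (auto simp: U_def)
    then have "w powr (- of_real r) = of_real (exp (- r * ln x))"
      using powr_of_real[of x "- r"] by (simp add: powr_def)
    then show ?thesis
      using theta_modular_real[of "ln x"] x by (simp add: f_def exp_minus divide_inverse)
  qed
  ultimately have "f z = 0"
    using analytic_continuation[OF _ \<open>open S\<close> \<open>connected S\<close>, of f U 2 z] by blast
  then show ?thesis by (simp add: f_def)
qed

end

subsection \<open>Nonnegativity of the abscissa\<close>

context class_A_series
begin

text \<open>The convention \<open>mu 0 = 0\<close> extends the order to index 0, so the constant
  \<open>b 0\<close> counts as the lowest exponential.\<close>

lemma mu_less:
  assumes "k < n"
  shows "mu k < mu n"
  using assms mu_seq mu0 unfolding exponent_seq_def strict_mono_on_def by (cases "k = 0") auto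

text \<open>If the abscissa were negative, \<open>theta a lam + a 0\<close> would be bounded on the right half-plane,
  so the modular relation would make \<open>theta b mu w + b 0\<close> tend to \<open>0\<close> as \<open>Im w\<close> grows. On a vertical
  line far to the right, however, its first nonvanishing term dominates the others.\<close>

lemma abscissa_nonneg: "0 \<le> abscissa a lam"
proof (rule ccontr)
  assume "\<not> 0 \<le> abscissa a lam"
  then have neg: "abscissa a lam < 0" by simp
  define c where "c = max 0 (max (abscissa a lam) (abscissa b mu)) + 1"
  have c: "0 < c" "abscissa a lam < c" "abscissa b mu < c" by (auto simp: c_def)
  interpret A: abs_dirichlet a lam c by (rule abs_dirichlet_a[OF c(1,2)])
  interpret B: abs_dirichlet b mu c by (rule abs_dirichlet_b[OF c(1,3)])
  \<comment> \<open>A negative abscissa gives absolute convergence at the exponent 0, hence a bound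
    that does not deteriorate near the imaginary axis.\<close>
  have suma: "(\<lambda>n. norm (a n)) summable_on {1..}"
  proof -
    have "(\<lambda>n. norm (a n) * lam n powr (- 0)) summable_on {1..}"
      by (rule dirichlet_norm_summable[OF lam_seq a_abscissa_finite neg])
    then show ?thesis
      by (rule summable_on_cong[THEN iffD1, rotated]) (use A.lam_pos in force)
  qed
  define M where "M = (\<Sum>\<^sub>\<infinity>n\<in>{1..}. norm (a n)) + norm (a 0)"
  have f_le: "norm (theta a lam z + a 0) \<le> M" if "0 < Re z" for z
  proof -
    have "norm (theta a lam z) \<le> (\<Sum>\<^sub>\<infinity>n\<in>{1..}. norm (a n * exp (- of_real (lam n) * z)))"
      unfolding theta_def by (rule norm_infsum_bound) (use A.theta_summable[OF that] in auto)
    also have "\<dots> \<le> (\<Sum>\<^sub>\<infinity>n\<in>{1..}. norm (a n))"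
    proof (rule infsum_mono[OF A.theta_summable[OF that] suma])
      fix n :: nat assume "n \<in> {1..}"
      then have "exp (- lam n * Re z) \<le> 1" using A.lam_pos[of n] that by simp
      then show "norm (a n * exp (- of_real (lam n) * z)) \<le> norm (a n)"
        unfolding A.norm_theta_term by (rule mult_left_le) simp
    qed
    finally show ?thesis unfolding M_def by (intro norm_triangle_le add_mono) auto
  qed
  have g_le: "norm (theta b mu w + b 0) \<le> M * norm w powr (- r)" if w: "0 < Re w" for w
  proof -
    have w0: "0 < norm w" using w by auto
    have "norm (theta a lam (1 / w) + a 0) = norm ((1 / w) powr (- of_real r)) * norm (theta b mu (1 / (1 / w)) + b 0)"
      unfolding theta_modular[OF Re_one_divide_pos[OF w]] by (simp add: norm_mult)
    also have "norm ((1 / w) powr (- of_real r)) = norm w powr r"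
      using w0 by (subst norm_powr_real_powr') (auto simp: norm_divide powr_divide powr_minus)
    finally have "norm w powr r * norm (theta b mu w + b 0) \<le> M"
      using f_le[OF Re_one_divide_pos[OF w]] by simp
    then have "norm w powr (- r) * (norm w powr r * norm (theta b mu w + b 0)) \<le> norm w powr (- r) * M"
      by (rule mult_left_mono) simp
    moreover have "norm w powr (- r) * norm w powr r = 1" using w0 by (simp flip: powr_add)
    ultimately show ?thesis by (metis mult.assoc mult.commute mult_1)
  qed
  \<comment> \<open>The search includes index 0: if \<open>b 0\<close> is nonzero, the constant term
    is the leading one.\<close>
  define k where "k = (LEAST n. b n \<noteq> 0)"
  have bk: "b k \<noteq> 0" using b_nonzero unfolding k_def by (metis (mono_tags, lifting) LeastI)
  have b_less: "b n = 0" if "n < k" for n using not_less_Least[of n] that unfolding k_def by blast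
  \<comment> \<open>The size of the \<open>n\<close>-th term on the line \<open>Re w = u\<close>,
    relative to the exponential of the leading term.\<close>
  define h where "h u n = norm (b n) * exp (- (mu n - mu k) * u)" for u n
  have h_sum: "h u summable_on {k<..}" if "0 < u" for u
  proof -
    have "(\<lambda>n. exp (mu k * u) * (norm (b n) * exp (- mu n * u))) summable_on {1..}"
      by (intro summable_on_cmult_right B.theta_abs_summable that)
    then have "h u summable_on {1..}"
      by (rule summable_on_cong[THEN iffD1, rotated])
         (simp add: h_def left_diff_distrib exp_diff exp_minus field_simps)
    then show ?thesis by (rule summable_on_subset_banach) auto
  qed
  define S where "S = (\<Sum>\<^sub>\<infinity>n\<in>{k<..}. h 1 n)"
  define \<delta> where "\<delta> = mu (Suc k) - mu k"
  have \<delta>: "0 < \<delta>" using mu_less[of k "Suc k"] by (simp add: \<delta>_def)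
  have tail: "(\<Sum>\<^sub>\<infinity>n\<in>{k<..}. h u n) \<le> exp (- \<delta> * (u - 1)) * S" if "1 \<le> u" for u
  proof -
    have "(\<Sum>\<^sub>\<infinity>n\<in>{k<..}. h u n) \<le> (\<Sum>\<^sub>\<infinity>n\<in>{k<..}. exp (- \<delta> * (u - 1)) * h 1 n)"
    proof (rule infsum_mono)
      fix n assume n: "n \<in> {k<..}"
      have "mu (Suc k) \<le> mu n"
        using n mu_less[of "Suc k" n] by (cases "n = Suc k") auto
      then have "\<delta> * (u - 1) \<le> (mu n - mu k) * (u - 1)"
        using that by (intro mult_right_mono) (auto simp: \<delta>_def)
      then have "exp (- (mu n - mu k) * u) \<le> exp (- \<delta> * (u - 1)) * exp (- (mu n - mu k))"
        by (simp add: mult_exp_exp algebra_simps)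
      then have "norm (b n) * exp (- (mu n - mu k) * u) \<le> norm (b n) * (exp (- \<delta> * (u - 1)) * exp (- (mu n - mu k)))"
        by (rule mult_left_mono) simp
      then show "h u n \<le> exp (- \<delta> * (u - 1)) * h 1 n" by (simp add: h_def mult_ac)
    qed (use that in \<open>auto intro!: h_sum summable_on_cmult_right\<close>)
    then show ?thesis by (simp add: S_def infsum_cmult_right')
  qed
  have S: "0 \<le> S" unfolding S_def h_def by (intro infsum_nonneg) auto
  \<comment> \<open>Chosen so that \<open>\<delta> * (u - 1)\<close> is
    \<open>y = 2 * S / norm (b k)\<close>; the inequality \<open>1 + y \<le> exp y\<close> then
    makes the tail smaller than half the leading coefficient.\<close>
  define u where "u = 1 + 2 * S / norm (b k) / \<delta>"
  have u: "exp (- \<delta> * (u - 1)) * S < norm (b k) / 2" "1 \<le> u"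
  proof -
    define y where "y = 2 * S / norm (b k)"
    have y: "0 \<le> y" "\<delta> * (u - 1) = y" "norm (b k) * y = 2 * S"
      using S \<delta> bk by (auto simp: y_def u_def)
    have "2 * S < norm (b k) * (1 + y)" using y(3) bk by (simp add: distrib_left)
    also have "\<dots> \<le> norm (b k) * exp y" by (intro mult_left_mono) auto
    finally have "2 * S * exp (- y) < norm (b k) * exp y * exp (- y)" by (intro mult_strict_right_mono) auto
    moreover have "norm (b k) * exp y * exp (- y) = norm (b k)" by (simp add: mult_exp_exp mult.assoc)
    ultimately have "2 * S * exp (- y) < norm (b k)" by (simp only:)
    then have "exp (- y) * S < norm (b k) / 2" by (simp add: field_simps)
    then show "exp (- \<delta> * (u - 1)) * S < norm (b k) / 2" using y(2) by simp
    show "1 \<le> u" using S \<delta> by (simp add: u_def)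
  qed
  \<comment> \<open>This lower bound is independent of \<open>Im w\<close>, whereas the upper bound
    \<open>g_le\<close> tends to 0 along the same line.\<close>
  have low: "norm (b k) / 2 \<le> exp (mu k * u) * norm (theta b mu w + b 0)" if w: "Re w = u" for w
  proof -
    define F where "F n = b n * exp (- of_real (mu n) * w)" for n
    have normF: "norm (F n) = exp (- mu k * u) * h u n" for n
      by (simp add: F_def h_def norm_mult norm_exp_eq_Re w left_diff_distrib mult_exp_exp)
    have sumF: "(\<lambda>n. norm (F n)) summable_on {k<..}"
      unfolding normF using u by (intro summable_on_cmult_right h_sum) auto
    have sumF1: "F summable_on {1..}"
    proof (rule Infinite_Sum.abs_summable_summable)
      show "(\<lambda>n. norm (F n)) summable_on {1..}"
        unfolding F_def by (rule B.theta_summable) (use u w in simp)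
    qed
    have "theta b mu w + b 0 = infsum F (insert 0 {1..})"
      by (subst infsum_insert[OF sumF1]) (auto simp: theta_def F_def[abs_def] mu0)
    also have "\<dots> = infsum F (insert k {k<..})"
    proof (rule infsum_cong_neutral)
      fix n assume "n \<in> insert 0 {1..} - insert k {k<..}"
      then have "n < k" by auto
      then show "F n = 0" by (simp add: F_def b_less)
    qed auto
    also have "\<dots> = F k + infsum F {k<..}"
      by (rule infsum_insert[OF Infinite_Sum.abs_summable_summable[OF sumF]]) simp
    finally have "norm (F k) - norm (infsum F {k<..}) \<le> norm (theta b mu w + b 0)"
      using norm_diff_ineq[of "F k"] by simp
    moreover have "norm (infsum F {k<..}) \<le> exp (- mu k * u) * (\<Sum>\<^sub>\<infinity>n\<in>{k<..}. h u n)"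
      using norm_infsum_bound[of F "{k<..}"] sumF by (simp add: normF infsum_cmult_right')
    moreover have "norm (F k) = exp (- mu k * u) * norm (b k)" by (simp add: normF h_def)
    ultimately have "exp (- mu k * u) * (norm (b k) - (\<Sum>\<^sub>\<infinity>n\<in>{k<..}. h u n)) \<le> norm (theta b mu w + b 0)"
      by (simp add: right_diff_distrib)
    moreover have "norm (b k) / 2 \<le> norm (b k) - (\<Sum>\<^sub>\<infinity>n\<in>{k<..}. h u n)"
      using tail[OF u(2)] u(1) by linarith
    ultimately have "exp (- mu k * u) * (norm (b k) / 2) \<le> norm (theta b mu w + b 0)"
      by (meson exp_ge_zero mult_left_mono order_trans)
    then have "exp (mu k * u) * (exp (- mu k * u) * (norm (b k) / 2)) \<le> exp (mu k * u) * norm (theta b mu w + b 0)"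
      by (rule mult_left_mono) simp
    then show ?thesis by (simp add: mult_exp_exp flip: mult.assoc)
  qed
  have M: "0 \<le> M" unfolding M_def by (intro add_nonneg_nonneg infsum_nonneg) auto
  have "((\<lambda>v. exp (mu k * u) * (M * v powr (- r))) \<longlongrightarrow> 0) at_top"
    using r_pos by (intro tendsto_mult_right_zero tendsto_neg_powr filterlim_ident) auto
  then have "eventually (\<lambda>v. exp (mu k * u) * (M * v powr (- r)) < norm (b k) / 2) at_top"
    by (rule order_tendstoD) (use bk in simp)
  then have "eventually (\<lambda>v. exp (mu k * u) * (M * v powr (- r)) < norm (b k) / 2 \<and> 0 < v) at_top"
    using eventually_gt_at_top by (rule eventually_conj)
  then obtain v where v: "exp (mu k * u) * (M * v powr (- r)) < norm (b k) / 2" "0 < v"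
    using eventually_happens trivial_limit_at_top_linorder by blast
  define w where "w = Complex u v"
  have w: "Re w = u" "0 < Re w" "v \<le> norm w"
    using u abs_Im_le_cmod[of w] by (auto simp: w_def)
  have "norm (b k) / 2 \<le> exp (mu k * u) * (M * norm w powr (- r))"
    by (rule order_trans[OF low[OF w(1)] mult_left_mono[OF g_le[OF w(2)]]]) simp
  also have "\<dots> \<le> exp (mu k * u) * (M * v powr (- r))"
    using w(3) v(2) M r_pos by (intro mult_left_mono powr_mono2') auto
  finally show False using v(1) by simp
qed

end

subsection \<open>Bessel functions\<close>

text \<open>Doubly exponential decay at both ends beats every weight. The exponent
  \<open>\<bar>\<sigma>\<bar> + 1\<close> is positive, as \<open>integrable_exp_exp\<close> demands,
  and dominates the weight on either half-line.\<close>

lemma kernel_integrable: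
  fixes l m \<sigma> :: real
  assumes "0 < l" "0 < m"
  shows "integrable lborel (\<lambda>t. exp (\<sigma> * t) * (exp (- m * exp (- t)) * exp (- l * exp t)))"
proof -
  define \<kappa> where "\<kappa> = \<bar>\<sigma>\<bar> + 1"
  have i1: "integrable lborel (\<lambda>t. exp (\<kappa> * t) * exp (- l * exp t))"
    using assms by (intro integrable_exp_exp) (auto simp: \<kappa>_def)
  have "integrable lborel (\<lambda>t. exp (\<kappa> * t) * exp (- m * exp t))"
    using assms by (intro integrable_exp_exp) (auto simp: \<kappa>_def)
  from lborel_integrable_real_affine[OF this, of "-1" 0]
  have i2: "integrable lborel (\<lambda>t. exp (\<kappa> * - t) * exp (- m * exp (- t)))" by simp
  show ?thesis
  proof (rule Bochner_Integration.integrable_bound[OF Bochner_Integration.integrable_add[OF i1 i2]])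
    show "AE t in lborel. norm (exp (\<sigma> * t) * (exp (- m * exp (- t)) * exp (- l * exp t))) \<le>
        norm (exp (\<kappa> * t) * exp (- l * exp t) + exp (\<kappa> * - t) * exp (- m * exp (- t)))"
    proof (rule AE_I2)
      fix t :: real
      have e: "exp (- m * exp (- t)) \<le> 1" "exp (- l * exp t) \<le> 1" using assms by auto
      have "exp (\<sigma> * t) * (exp (- m * exp (- t)) * exp (- l * exp t)) \<le>
          exp (\<kappa> * t) * exp (- l * exp t) + exp (\<kappa> * - t) * exp (- m * exp (- t))"
      proof (cases "0 \<le> t")
        case True
        have "\<sigma> * t \<le> \<kappa> * t" using True by (intro mult_right_mono) (auto simp: \<kappa>_def)
        then have "exp (\<sigma> * t) * (exp (- m * exp (- t)) * exp (- l * exp t)) \<le> exp (\<kappa> * t) * (1 * exp (- l * exp t))"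
          using e by (intro mult_mono) auto
        moreover have "0 \<le> exp (\<kappa> * - t) * exp (- m * exp (- t))" by simp
        ultimately show ?thesis by linarith
      next
        case False
        have "(- \<sigma>) * (- t) \<le> \<kappa> * - t" using False by (intro mult_right_mono) (auto simp: \<kappa>_def)
        then have "exp (\<sigma> * t) * (exp (- m * exp (- t)) * exp (- l * exp t)) \<le> exp (\<kappa> * - t) * (exp (- m * exp (- t)) * 1)"
          using e by (intro mult_mono) auto
        moreover have "0 \<le> exp (\<kappa> * t) * exp (- l * exp t)" by simp
        ultimately show ?thesis by linarith
      qed
      then show "norm (exp (\<sigma> * t) * (exp (- m * exp (- t)) * exp (- l * exp t))) \<le>
        norm (exp (\<kappa> * t) * exp (- l * exp t) + exp (\<kappa> * - t) * exp (- m * exp (- t)))"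
        by simp
    qed
  qed measurable
qed

lemma bessel_K_minus: "bessel_K (- \<nu>) x = bessel_K \<nu> x"
  by (simp add: bessel_K_def)

text \<open>Folding the line at 0: \<open>cosh\<close> is even, so the exponential weights at
  \<open>t\<close> and \<open>- t\<close> add up to \<open>2 * cosh (s * t)\<close>.\<close>

lemma laplace_exp_cosh:
  fixes x :: real
  assumes "0 < x"
  shows "laplace (\<lambda>t. of_real (exp (- x * cosh t))) s = 2 * bessel_K s x"
proof -
  define f where "f t = exp (s * of_real t) * complex_of_real (exp (- x * cosh t))" for t
  have "integrable lborel (\<lambda>t. exp (Re s * t) * (exp (- (x / 2) * exp (- t)) * exp (- (x / 2) * exp t)))"
    using assms by (intro kernel_integrable) auto
  also have "(\<lambda>t. exp (Re s * t) * (exp (- (x / 2) * exp (- t)) * exp (- (x / 2) * exp t))) =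
     (\<lambda>t. exp (Re s * t) * norm (complex_of_real (exp (- x * cosh t))))"
    by (simp add: fun_eq_iff cosh_def mult_exp_exp algebra_simps)
  finally have f_int: "integrable lborel f"
    unfolding f_def by (intro integrable_laplace) (auto simp: cosh_def)
  have f_int': "integrable lborel (\<lambda>t. f (- t))"
    using lborel_integrable_real_affine[OF f_int, of "-1" 0] by simp
  have [measurable]: "f \<in> borel_measurable borel" using f_int by auto
  define p where "p t = complex_of_real (indicator {0..} t) * f t" for t
  define n where "n t = complex_of_real (indicator {..<0} t) * f t" for t
  have [measurable]: "p \<in> borel_measurable borel" "n \<in> borel_measurable borel"
    unfolding p_def n_def by measurable
  have pn_int: "integrable lborel p" "integrable lborel n"
    by (rule Bochner_Integration.integrable_bound[OF f_int], simp,
        simp add: p_def n_def indicator_def norm_mult)+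
  have flip_int: "integrable lborel (\<lambda>t. complex_of_real (indicator {0..} t) * f (- t))"
    by (rule Bochner_Integration.integrable_bound[OF f_int']) (auto simp: indicator_def norm_mult)
  have "laplace (\<lambda>t. of_real (exp (- x * cosh t))) s = (LINT t|lborel. p t + n t)"
    unfolding laplace_def by (intro Bochner_Integration.integral_cong) (auto simp: p_def n_def f_def indicator_def)
  also have "\<dots> = (LINT t|lborel. p t) + (LINT t|lborel. n t)"
    using pn_int by (rule Bochner_Integration.integral_add)
  also have "(LINT t|lborel. n t) = (LINT t|lborel. n (0 + -1 * t))"
    by (subst lborel_integral_real_affine[where c = "-1" and t = 0]) auto
  also have "\<dots> = (LINT t|lborel. complex_of_real (indicator {0..} t) * f (- t))"
  proof (rule integral_cong_AE)
    show "AE t in lborel. n (0 + -1 * t) = complex_of_real (indicator {0..} t) * f (- t)"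
      using AE_lborel_singleton[of 0] by eventually_elim (auto simp: n_def indicator_def)
  qed (auto simp: n_def)
  also have "(LINT t|lborel. p t) + (LINT t|lborel. complex_of_real (indicator {0..} t) * f (- t)) =
     (LINT t|lborel. p t + complex_of_real (indicator {0..} t) * f (- t))"
    using pn_int(1) flip_int by (rule Bochner_Integration.integral_add[symmetric])
  also have "\<dots> = (LINT t|lborel. 2 * (indicator {0..} t *\<^sub>R (of_real (exp (- x * cosh t)) * cosh (s * of_real t))))"
    by (intro Bochner_Integration.integral_cong)
       (auto simp: p_def f_def indicator_def cosh_def scaleR_conv_of_real algebra_simps)
  also have "\<dots> = 2 * bessel_K s x"
    unfolding bessel_K_def set_lebesgue_integral_def by (rule integral_mult_right_zero)
  finally show ?thesis .
qed

text \<open>The translation by \<open>ln (m / l) / 2\<close> balances the two exponents at the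
  common coefficient \<open>sqrt (m * l)\<close> and contributes the power of \<open>m / l\<close>.
  The order is written as \<open>- s\<close> to match \<open>bessel_term\<close>, where
  \<open>s - r1\<close> is inserted.\<close>

lemma laplace_kernel:
  fixes l m :: real
  assumes "0 < l" "0 < m"
  shows "laplace (\<lambda>t. of_real (exp (- m * exp (- t)) * exp (- l * exp t))) s =
    2 * (of_real (m / l) powr (s / 2) * bessel_K (- s) (2 * sqrt (m * l)))"
proof -
  define h where "h = ln (m / l) / 2"
  define x where "x = sqrt (m * l)"
  have sq: "exp h ^ 2 = m / l" "exp (- h) ^ 2 = l / m"
    using assms by (simp_all add: h_def exp_minus power_inverse flip: exp_double)
  have hl: "l * exp h = x" unfolding x_def
    using assms by (intro real_sqrt_unique[symmetric]) (unfold power_mult_distrib sq, simp_all add: power2_eq_square)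
  have hm: "m * exp (- h) = x" unfolding x_def
    using assms by (intro real_sqrt_unique[symmetric]) (unfold power_mult_distrib sq, simp_all add: power2_eq_square)
  have "laplace (\<lambda>t. of_real (exp (- m * exp (- t)) * exp (- l * exp t))) s =
    (LINT t|lborel. exp (s * of_real (h + 1 * t)) * of_real (exp (- m * exp (- (h + 1 * t))) * exp (- l * exp (h + 1 * t))))"
    unfolding laplace_def by (subst lborel_integral_real_affine[where c = 1 and t = h]) auto
  also have "\<dots> = (LINT t|lborel. exp (s * of_real h) * (exp (s * of_real t) * of_real (exp (- (2 * x) * cosh t))))"
  proof (rule Bochner_Integration.integral_cong[OF refl])
    fix t :: real
    have "exp (- m * exp (- (h + 1 * t))) * exp (- l * exp (h + 1 * t)) = exp (- (m * exp (- h)) * exp (- t) - (l * exp h) * exp t)"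
    proof -
      have split: "exp (- (h + 1 * t)) = exp (- h) * exp (- t)" "exp (h + 1 * t) = exp h * exp t"
        by (simp_all add: exp_add exp_diff exp_minus divide_inverse)
      have "exp (- m * exp (- (h + 1 * t))) * exp (- l * exp (h + 1 * t)) =
          exp (- m * exp (- (h + 1 * t)) + - l * exp (h + 1 * t))" by (rule mult_exp_exp)
      also have "- m * exp (- (h + 1 * t)) + - l * exp (h + 1 * t) = - (m * exp (- h)) * exp (- t) - (l * exp h) * exp t"
        unfolding split by (simp add: mult.assoc)
      finally show ?thesis .
    qed
    also have "\<dots> = exp (- (2 * x) * cosh t)"
      unfolding hl hm by (simp add: cosh_def algebra_simps)
    finally show "exp (s * of_real (h + 1 * t)) * of_real (exp (- m * exp (- (h + 1 * t))) * exp (- l * exp (h + 1 * t))) =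
      exp (s * of_real h) * (exp (s * of_real t) * of_real (exp (- (2 * x) * cosh t)))"
      by (simp add: distrib_left exp_add)
  qed
  also have "\<dots> = exp (s * of_real h) * laplace (\<lambda>t. of_real (exp (- (2 * x) * cosh t))) s"
    unfolding laplace_def by (rule integral_mult_right_zero)
  also have "\<dots> = exp (s * of_real h) * (2 * bessel_K s (2 * x))"
    using assms by (subst laplace_exp_cosh) (auto simp: x_def)
  also have "exp (s * of_real h) = of_real (m / l) powr (s / 2)"
  proof -
    have "of_real (m / l) powr (s / 2) = exp (s / 2 * of_real (ln (m / l)))"
      using assms unfolding powr_def by (subst Ln_of_real) auto
    also have "s / 2 * of_real (ln (m / l)) = s * of_real h" by (simp add: h_def)
    finally show ?thesis ..
  qed
  finally show ?thesis by (simp add: x_def bessel_K_minus)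
qed

subsection \<open>The Epstein zeta function of a pair\<close>

locale class_A_pair =
  S1: class_A_series r1 a1 lam \<phi>1 b1 mu \<psi>1 + S2: class_A_series r2 a2 lam' \<phi>2 b2 mu' \<psi>2
  for r1 a1 lam \<phi>1 b1 mu \<psi>1 r2 a2 lam' \<phi>2 b2 mu' \<psi>2
begin

text \<open>The two series also change places: \<open>kernel\<close> joins the dual of the first
  series with the second one, and only this order turns it into its own reflection.\<close>

lemma dual: "class_A_pair r2 b2 mu' \<psi>2 a2 lam' \<phi>2 r1 b1 mu \<psi>1 a1 lam \<phi>1"
  using S1.dual S2.dual by (rule class_A_pair.intro[rotated])

text \<open>The modular relation supplies the factor with \<open>b1\<close>. One factor decays as
  \<open>t\<close> tends to minus infinity and the other at plus infinity, so the Laplace transform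
  is entire; products of single exponentials give the Bessel integrals.\<close>

definition kernel :: "real \<Rightarrow> complex" where
  "kernel t = theta b1 mu (of_real (exp (- t))) * theta a2 lam' (of_real (exp t))"

lemma kernel_abs_dirichlet:
  obtains c where "abs_dirichlet b1 mu c" "abs_dirichlet a2 lam' c"
proof (rule that)
  define c where "c = max 0 (max (abscissa b1 mu) (abscissa a2 lam')) + 1"
  have c: "0 < c" "abscissa b1 mu < c" "abscissa a2 lam' < c" by (auto simp: c_def)
  show "abs_dirichlet b1 mu c" by (rule S1.abs_dirichlet_b[OF c(1,2)])
  show "abs_dirichlet a2 lam' c" by (rule S2.abs_dirichlet_a[OF c(1,3)])
qed

lemma kernel_measurable [measurable]: "kernel \<in> borel_measurable borel"
proof -
  obtain c where B: "abs_dirichlet b1 mu c" and A: "abs_dirichlet a2 lam' c" by (rule kernel_abs_dirichlet)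
  have "continuous_on UNIV (\<lambda>t. theta b1 mu (of_real (exp (- t))))"
    by (rule continuous_on_compose2[OF abs_dirichlet.continuous_on_theta_exp[OF B]])
       (auto intro!: continuous_intros)
  then show ?thesis
    unfolding kernel_def
    by (intro borel_measurable_continuous_onI continuous_intros abs_dirichlet.continuous_on_theta_exp[OF A])
qed

lemma kernel_weight_integrable: "integrable lborel (\<lambda>t. exp (\<sigma> * t) * norm (kernel t))"
proof -
  obtain c where B': "abs_dirichlet b1 mu c" and A': "abs_dirichlet a2 lam' c" by (rule kernel_abs_dirichlet)
  interpret B: abs_dirichlet b1 mu c by (rule B')
  interpret A: abs_dirichlet a2 lam' c by (rule A')
  have "integrable lborel (\<lambda>t. (B.bnd * A.bnd) * (exp (\<sigma> * t) * (exp (- (mu 1 / 2) * exp (- t)) * exp (- (lam' 1 / 2) * exp t))))"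
    using A.lam1_pos B.lam1_pos by (intro integrable_mult_right kernel_integrable) auto
  then show ?thesis
  proof (rule Bochner_Integration.integrable_bound)
    show "AE t in lborel. norm (exp (\<sigma> * t) * norm (kernel t)) \<le>
      norm ((B.bnd * A.bnd) * (exp (\<sigma> * t) * (exp (- (mu 1 / 2) * exp (- t)) * exp (- (lam' 1 / 2) * exp t))))"
    proof (rule AE_I2)
      fix t :: real
      \<comment> \<open>Both bounds use the same \<open>c\<close>, so the factors
        \<open>exp (c * t)\<close> and \<open>exp (- c * t)\<close> cancel.\<close>
      have "norm (kernel t) \<le> (B.bnd * exp (- c * - t) * exp (- (mu 1 / 2) * exp (- t))) *
          (A.bnd * exp (- c * t) * exp (- (lam' 1 / 2) * exp t))"
        unfolding kernel_def norm_mult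
        using B.bnd_nonneg by (intro mult_mono A.norm_theta_exp_le B.norm_theta_exp_le) auto
      also have "\<dots> = (exp (- c * - t) * exp (- c * t)) * ((B.bnd * A.bnd) * (exp (- (mu 1 / 2) * exp (- t)) * exp (- (lam' 1 / 2) * exp t)))"
        by (simp only: mult_ac)
      also have "exp (- c * - t) * exp (- c * t) = 1" by (simp add: mult_exp_exp)
      finally have "exp (\<sigma> * t) * norm (kernel t) \<le> exp (\<sigma> * t) * ((B.bnd * A.bnd) * (exp (- (mu 1 / 2) * exp (- t)) * exp (- (lam' 1 / 2) * exp t)))"
        by (intro mult_left_mono) auto
      then show "norm (exp (\<sigma> * t) * norm (kernel t)) \<le>
        norm ((B.bnd * A.bnd) * (exp (\<sigma> * t) * (exp (- (mu 1 / 2) * exp (- t)) * exp (- (lam' 1 / 2) * exp t))))"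
        using A.bnd_nonneg B.bnd_nonneg by (simp add: mult_ac)
    qed
  qed measurable
qed

lemma laplace_kernel_entire: "laplace kernel holomorphic_on UNIV"
  using kernel_weight_integrable by (intro laplace_entire) auto

text \<open>Termwise integration over pairs. Half of each exponential is traded for
  \<open>mu m powr (- c)\<close> and \<open>lam' n powr (- c)\<close>; the other half leaves the
  integral \<open>J\<close>, which does not depend on the pair. So a product of two convergent
  series dominates the integrals of the norms.\<close>

lemma bessel_sum:
  shows "bessel_term r1 b1 a2 mu lam' s summable_on {1..} \<times> {1..}"
    and "2 * (\<Sum>\<^sub>\<infinity>p\<in>{1..} \<times> {1..}. bessel_term r1 b1 a2 mu lam' s p) = laplace kernel (s - of_real r1)"
proof -
  obtain c where B': "abs_dirichlet b1 mu c" and A': "abs_dirichlet a2 lam' c" by (rule kernel_abs_dirichlet)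
  interpret B: abs_dirichlet b1 mu c by (rule B')
  interpret A: abs_dirichlet a2 lam' c by (rule A')
  define z where "z = s - of_real r1"
  define e where "e = (\<lambda>(m, n) t. exp (- mu m * exp (- t)) * exp (- lam' n * exp t))"
  define f where "f = (\<lambda>(m, n) t. (b1 m * a2 n) * (exp (z * of_real t) * of_real (e (m, n) t)))"
  let ?I = "{1::nat..} \<times> {1::nat..}"
  have normf: "norm (f (m, n) t) = exp (Re z * t) * ((norm (b1 m) * exp (- mu m * exp (- t))) * (norm (a2 n) * exp (- lam' n * exp t)))" for m n t
    by (simp add: f_def e_def norm_mult norm_exp_mult_of_real mult_ac)
  have f_int: "integrable lborel (f p)" if pI: "p \<in> ?I" for p
  proof -
    obtain m n where p: "p = (m, n)" "m \<ge> 1" "n \<ge> 1" using pI by auto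
    have "integrable lborel (\<lambda>t. exp (z * of_real t) * complex_of_real (e (m, n) t))"
    proof (rule integrable_laplace)
      show "(\<lambda>t. complex_of_real (e (m, n) t)) \<in> borel_measurable lborel" by (simp add: e_def)
      show "integrable lborel (\<lambda>t. exp (Re z * t) * norm (complex_of_real (e (m, n) t)))"
        using kernel_integrable[OF A.lam_pos[OF p(3)] B.lam_pos[OF p(2)], of "Re z"]
        by (simp add: e_def norm_mult)
    qed
    then show ?thesis unfolding p(1) f_def by (simp add: integrable_mult_right)
  qed
  have pointwise: "(\<lambda>p. norm (f p t)) summable_on ?I" for t
  proof -
    have "(\<lambda>(m, n). (norm (b1 m) * exp (- mu m * exp (- t))) * (norm (a2 n) * exp (- lam' n * exp t))) summable_on ?I"
      by (intro summable_on_product_real A.theta_abs_summable B.theta_abs_summable) auto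
    then have "(\<lambda>p. exp (Re z * t) * (case p of (m, n) \<Rightarrow> (norm (b1 m) * exp (- mu m * exp (- t))) * (norm (a2 n) * exp (- lam' n * exp t)))) summable_on ?I"
      by (rule summable_on_cmult_right)
    then show ?thesis by (rule summable_on_cong[THEN iffD1, rotated]) (auto simp: normf)
  qed
  define J where "J = (LINT t|lborel. exp (Re z * t) * (exp (- (mu 1 / 2) * exp (- t)) * exp (- (lam' 1 / 2) * exp t)))"
  define k where "k = (2 * c) powr c"
  have total: "(\<lambda>p. LINT t|lborel. norm (f p t)) summable_on ?I"
  proof -
    have "(\<lambda>p. norm (LINT t|lborel. norm (f p t))) summable_on ?I"
    proof (rule Infinite_Sum.abs_summable_on_comparison_test')
      show "(\<lambda>p. (k * k * J) * (case p of (m, n) \<Rightarrow> (norm (b1 m) * mu m powr (- c)) * (norm (a2 n) * lam' n powr (- c)))) summable_on ?I"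
        by (intro summable_on_cmult_right summable_on_product_real A.abs_summable B.abs_summable) auto
      fix p assume pI: "p \<in> ?I"
      then obtain m n where p: "p = (m, n)" "m \<ge> 1" "n \<ge> 1" by auto
      define C where "C = k * k * ((norm (b1 m) * mu m powr (- c)) * (norm (a2 n) * lam' n powr (- c)))"
      have "(LINT t|lborel. norm (f p t)) \<le> (LINT t|lborel. C * (exp (Re z * t) * (exp (- (mu 1 / 2) * exp (- t)) * exp (- (lam' 1 / 2) * exp t))))"
      proof (rule integral_mono)
        show "integrable lborel (\<lambda>t. norm (f p t))" using f_int[OF pI] by (rule integrable_norm)
        show "integrable lborel (\<lambda>t. C * (exp (Re z * t) * (exp (- (mu 1 / 2) * exp (- t)) * exp (- (lam' 1 / 2) * exp t))))"
          using A.lam1_pos B.lam1_pos by (intro integrable_mult_right kernel_integrable) auto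
        fix t :: real
        have le1: "norm (b1 m) * exp (- mu m * exp (- t)) \<le> k * exp (- t) powr (- c) * exp (- (mu 1 / 2) * exp (- t)) * (norm (b1 m) * mu m powr (- c))"
          unfolding k_def using p by (intro B.theta_term_le) auto
        have le2: "norm (a2 n) * exp (- lam' n * exp t) \<le> k * exp t powr (- c) * exp (- (lam' 1 / 2) * exp t) * (norm (a2 n) * lam' n powr (- c))"
          unfolding k_def using p by (intro A.theta_term_le) auto
        have "norm (f p t) \<le> exp (Re z * t) *
            ((k * exp (- t) powr (- c) * exp (- (mu 1 / 2) * exp (- t)) * (norm (b1 m) * mu m powr (- c))) *
             (k * exp t powr (- c) * exp (- (lam' 1 / 2) * exp t) * (norm (a2 n) * lam' n powr (- c))))"
          unfolding p(1) normf by (intro mult_left_mono mult_mono[OF le1 le2]) (auto simp: k_def)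
        also have "\<dots> = (exp (- t) powr (- c) * exp t powr (- c)) * (C * (exp (Re z * t) * (exp (- (mu 1 / 2) * exp (- t)) * exp (- (lam' 1 / 2) * exp t))))"
          unfolding C_def by (simp only: mult_ac)
        also have "exp (- t) powr (- c) * exp t powr (- c) = 1"
          by (simp add: powr_def mult_exp_exp)
        finally show "norm (f p t) \<le> C * (exp (Re z * t) * (exp (- (mu 1 / 2) * exp (- t)) * exp (- (lam' 1 / 2) * exp t)))"
          by simp
      qed
      also have "\<dots> = C * J" unfolding J_def by (rule integral_mult_right_zero)
      finally show "norm (LINT t|lborel. norm (f p t)) \<le> (k * k * J) * (case p of (m, n) \<Rightarrow> (norm (b1 m) * mu m powr (- c)) * (norm (a2 n) * lam' n powr (- c)))"
        by (simp add: p(1) C_def mult_ac)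
    qed
    then show ?thesis by (rule summable_on_cong[THEN iffD1, rotated]) auto
  qed
  have "infinite ?I" by (simp add: infinite_cartesian_product infinite_Ici)
  note swap = integral_infsum[OF countableI_type this f_int pointwise total]
  have term_eq: "(LINT t|lborel. f p t) = 2 * bessel_term r1 b1 a2 mu lam' s p" if pI: "p \<in> ?I" for p
  proof -
    obtain m n where p: "p = (m, n)" "m \<ge> 1" "n \<ge> 1" using pI by auto
    have "(LINT t|lborel. f p t) = b1 m * a2 n * laplace (\<lambda>t. of_real (exp (- mu m * exp (- t)) * exp (- lam' n * exp t))) z"
      unfolding p(1) f_def laplace_def e_def by simp
    also have "\<dots> = b1 m * a2 n * (2 * (of_real (mu m / lam' n) powr (z / 2) * bessel_K (- z) (2 * sqrt (mu m * lam' n))))"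
      using laplace_kernel[OF A.lam_pos[OF p(3)] B.lam_pos[OF p(2)]] by simp
    finally show ?thesis by (simp add: p(1) bessel_term_def z_def)
  qed
  have "(\<lambda>p. LINT t|lborel. f p t) summable_on ?I" by (rule swap(2))
  then have "(\<lambda>p. 2 * bessel_term r1 b1 a2 mu lam' s p) summable_on ?I"
    by (rule summable_on_cong[THEN iffD1, rotated]) (rule term_eq)
  from summable_on_cmult_right[OF this, of "1 / 2"]
  show "bessel_term r1 b1 a2 mu lam' s summable_on ?I" by simp
  have "(\<Sum>\<^sub>\<infinity>p\<in>?I. f p t) = exp (z * of_real t) * kernel t" for t
  proof -
    have "(\<Sum>\<^sub>\<infinity>p\<in>?I. f p t) = (\<Sum>\<^sub>\<infinity>p\<in>?I. exp (z * of_real t) * (case p of (m, n) \<Rightarrow>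
        (b1 m * exp (- of_real (mu m) * of_real (exp (- t)))) * (a2 n * exp (- of_real (lam' n) * of_real (exp t)))))"
      by (intro infsum_cong) (auto simp: f_def e_def exp_of_real simp flip: of_real_mult of_real_minus)
    also have "\<dots> = exp (z * of_real t) * kernel t"
      unfolding infsum_cmult_right' kernel_def theta_def
      by (subst infsum_product_abs[OF B.theta_summable A.theta_summable]) auto
    finally show ?thesis .
  qed
  then have "laplace kernel z = (LINT t|lborel. (\<Sum>\<^sub>\<infinity>p\<in>?I. f p t))"
    by (simp add: laplace_def)
  also have "\<dots> = (\<Sum>\<^sub>\<infinity>p\<in>?I. LINT t|lborel. f p t)" by (rule swap(3))
  also have "\<dots> = (\<Sum>\<^sub>\<infinity>p\<in>?I. 2 * bessel_term r1 b1 a2 mu lam' s p)"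
    by (intro infsum_cong term_eq)
  finally show "2 * (\<Sum>\<^sub>\<infinity>p\<in>?I. bessel_term r1 b1 a2 mu lam' s p) = laplace kernel (s - of_real r1)"
    by (simp add: infsum_cmult_right' z_def)
qed

text \<open>The terms with second index 0 are \<open>a2 0\<close> times the first Dirichlet series.
  Among the others \<open>m = 0\<close> is retained, so that the sum over \<open>m\<close> is the
  full \<open>a1 0 + theta a1 lam\<close>, to which the modular relation applies; its constant
  \<open>b1 0\<close> yields the shifted \<open>\<phi>2\<close>, its theta part the kernel.\<close>

lemma epstein_formula:
  assumes s: "Re s > 2 * max (abscissa a1 lam) (abscissa a2 lam')"
  shows "epstein_term a1 a2 lam lam' s summable_on UNIV - {(0, 0)}"
    and "Gamma s * epstein_series a1 a2 lam lam' s =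
      a2 0 * (Gamma s * \<phi>1 s) + b1 0 * (Gamma (s - of_real r1) * \<phi>2 (s - of_real r1))
        + laplace kernel (s - of_real r1)"
proof -
  \<comment> \<open>Half of \<open>Re s\<close> goes to each series, as
    \<open>(x + y) powr (- 2 * c)\<close> is at most \<open>x powr (- c) * y powr (- c)\<close>;
    nonnegative abscissas make \<open>c\<close> positive.\<close>
  define c where "c = Re s / 2"
  have c: "0 < c" "abscissa a1 lam < c" "abscissa a2 lam' < c" "Re s = 2 * c"
    using s S1.abscissa_nonneg S2.abscissa_nonneg by (auto simp: c_def)
  have s0: "0 < Re s" using c by simp
  interpret A1: abs_dirichlet a1 lam c by (rule S1.abs_dirichlet_a[OF c(1,2)])
  interpret A2: abs_dirichlet a2 lam' c by (rule S2.abs_dirichlet_a[OF c(1,3)])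
  let ?T = "epstein_term a1 a2 lam lam' s"
  define U where "U = {1::nat..} \<times> {0::nat}"
  define V where "V = (UNIV :: nat set) \<times> {1::nat..}"
  have UV: "UNIV - {(0, 0)} = U \<union> V" "U \<inter> V = {}"
    by (auto simp: U_def V_def not_less_eq_eq Suc_le_eq)
  have lam_nonneg: "0 \<le> lam m" for m
    using A1.lam_pos[of m] S1.lam0 by (cases "m = 0") (auto intro: less_imp_le)
  have L_pos: "0 < lam m + lam' n" if "n \<ge> 1" for m n
    using lam_nonneg[of m] A2.lam_pos[OF that] by linarith
  have T_U: "?T (m, 0) = a2 0 * dirichlet_term a1 lam s m" if "m \<ge> 1" for m
    using S2.lam0 A1.lam_pos[OF that]
    by (simp add: epstein_term_def dirichlet_term_def powr_minus divide_inverse)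
  have U_bij: "bij_betw (\<lambda>m. (m, 0)) {1::nat..} U"
    by (auto simp: U_def bij_betw_def inj_on_def)
  have "(\<lambda>m. norm (dirichlet_term a1 lam s m)) summable_on {1..}"
  proof -
    have "(\<lambda>n. norm (a1 n) * lam n powr (- Re s)) summable_on {1..}"
      using dirichlet_norm_summable[OF S1.lam_seq S1.a_abscissa_finite, of "Re s"] c by auto
    then show ?thesis
    proof (rule summable_on_cong[THEN iffD1, rotated])
      fix m :: nat assume "m \<in> {1..}"
      then show "norm (a1 m) * lam m powr (- Re s) = norm (dirichlet_term a1 lam s m)"
        using A1.lam_pos[of m] by (simp add: dirichlet_term_def norm_mult norm_powr_real_powr)
    qed
  qed
  then have "(\<lambda>m. a2 0 * dirichlet_term a1 lam s m) summable_on {1..}"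
    by (rule summable_on_cmult_right[OF Infinite_Sum.abs_summable_summable])
  then have "(\<lambda>m. ?T (m, 0)) summable_on {1..}"
    by (rule summable_on_cong[THEN iffD1, rotated]) (simp add: T_U)
  then have sumU: "?T summable_on U"
    using summable_on_reindex_bij_betw[OF U_bij, of ?T] by simp
  have "infsum ?T U = (\<Sum>\<^sub>\<infinity>m\<in>{1..}. ?T (m, 0))"
    using infsum_reindex_bij_betw[OF U_bij, of ?T] by simp
  also have "\<dots> = (\<Sum>\<^sub>\<infinity>m\<in>{1..}. a2 0 * dirichlet_term a1 lam s m)"
    by (intro infsum_cong) (simp add: T_U)
  also have "\<dots> = a2 0 * \<phi>1 s"
    using S1.\<phi>_series[of s] c by (simp add: infsum_cmult_right' dirichlet_series_def)
  finally have infU: "infsum ?T U = a2 0 * \<phi>1 s" .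

  \<comment> \<open>Since \<open>lam 0 = 0\<close>, index 0 needs a positive substitute in the
    majorant; \<open>lam' 1\<close> is at most \<open>lam 0 + lam' n\<close> for every
    \<open>n \<ge> 1\<close>.\<close>
  define lamh where "lamh m = (if m = 0 then lam' 1 else lam m)" for m
  have lamh: "0 < lamh m" for m using A1.lam_pos[of m] A2.lam1_pos by (auto simp: lamh_def)
  have sum_lamh: "(\<lambda>m. norm (a1 m) * lamh m powr (- c)) summable_on UNIV"
  proof -
    have "(\<lambda>m. norm (a1 m) * lamh m powr (- c)) summable_on {1..}"
      using A1.abs_summable by (rule summable_on_cong[THEN iffD1, rotated]) (auto simp: lamh_def)
    then have "(\<lambda>m. norm (a1 m) * lamh m powr (- c)) summable_on insert 0 {1..}"
      by (simp only: summable_on_insert_iff)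
    also have "insert 0 {1..} = (UNIV :: nat set)" by auto
    finally show ?thesis .
  qed
  have norm_T: "norm (?T (m, n)) = norm (a1 m) * norm (a2 n) * (lam m + lam' n) powr (- Re s)" if "n \<ge> 1" for m n
    using L_pos[OF that, of m]
    by (simp add: epstein_term_def norm_divide norm_mult norm_powr_real_powr powr_minus_divide del: of_real_add)
  have absV: "(\<lambda>p. norm (?T p)) summable_on V"
  proof (rule Infinite_Sum.abs_summable_on_comparison_test')
    show "(\<lambda>(m, n). (norm (a1 m) * lamh m powr (- c)) * (norm (a2 n) * lam' n powr (- c))) summable_on V"
      unfolding V_def by (intro summable_on_product_real sum_lamh A2.abs_summable) auto
    fix p assume "p \<in> V"
    then obtain m n where p: "p = (m, n)" "n \<ge> 1" by (auto simp: V_def)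
    have "lamh m \<le> lam m + lam' n" "lam' n \<le> lam m + lam' n"
      using A2.lam1_le[OF p(2)] A2.lam_pos[OF p(2)] lam_nonneg[of m] by (auto simp: lamh_def)
    then have "(lam m + lam' n) powr (- c) \<le> lamh m powr (- c)" "(lam m + lam' n) powr (- c) \<le> lam' n powr (- c)"
      using c lamh[of m] A2.lam_pos[OF p(2)] by (auto intro!: powr_mono2')
    then have "(lam m + lam' n) powr (- c) * (lam m + lam' n) powr (- c) \<le> lamh m powr (- c) * lam' n powr (- c)"
      by (intro mult_mono) auto
    also have "(lam m + lam' n) powr (- c) * (lam m + lam' n) powr (- c) = (lam m + lam' n) powr (- Re s)"
      using c(4) by (simp flip: powr_add)
    finally have "norm (?T p) \<le> norm (a1 m) * norm (a2 n) * (lamh m powr (- c) * lam' n powr (- c))"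
      unfolding p(1) norm_T[OF p(2)] by (intro mult_left_mono) auto
    then show "norm (?T p) \<le> (case p of (m, n) \<Rightarrow> (norm (a1 m) * lamh m powr (- c)) * (norm (a2 n) * lam' n powr (- c)))"
      by (simp add: p(1) mult_ac)
  qed
  then have sumV: "?T summable_on V" by (rule Infinite_Sum.abs_summable_summable)
  show "?T summable_on UNIV - {(0, 0)}"
    unfolding UV(1) by (rule summable_on_Un_disjoint[OF sumU sumV UV(2)])
  have series: "epstein_series a1 a2 lam lam' s = a2 0 * \<phi>1 s + infsum ?T V"
    unfolding epstein_series_def UV(1) infsum_Un_disjoint[OF sumU sumV UV(2)] infU ..

  define f where "f = (\<lambda>(m, n) t. (a1 m * a2 n) * (exp (s * of_real t) * of_real (exp (- (lam m + lam' n) * exp t))))"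
  have f_int: "integrable lborel (f p)" if pV: "p \<in> V" for p
  proof -
    obtain m n where p: "p = (m, n)" "n \<ge> 1" using pV by (auto simp: V_def)
    show ?thesis
      using integrable_mult_right[OF integrable_exp_mult_exp_exp[OF s0 L_pos[OF p(2)]], of "a1 m * a2 n" m]
      unfolding p(1) f_def prod.case .
  qed
  have term_V: "(LINT t|lborel. f p t) = Gamma s * ?T p" if "p \<in> V" for p
  proof -
    obtain m n where p: "p = (m, n)" "n \<ge> 1" using \<open>p \<in> V\<close> by (auto simp: V_def)
    have "(LINT t|lborel. f p t) = a1 m * a2 n * laplace (\<lambda>t. of_real (exp (- (lam m + lam' n) * exp t))) s"
      unfolding p(1) f_def laplace_def by simp
    also have "\<dots> = a1 m * a2 n * (of_real (lam m + lam' n) powr (- s) * Gamma s)"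
      using laplace_exp_exp[OF s0 L_pos[OF p(2)]] by simp
    finally show ?thesis
      by (simp add: p(1) epstein_term_def powr_minus divide_inverse)
  qed
  have norm_f: "norm (f (m, n) t) = exp (Re s * t) * (norm (a1 m) * exp (- lam m * exp t)) * (norm (a2 n) * exp (- lam' n * exp t))" for m n t
  proof -
    have "exp (- (lam m + lam' n) * exp t) = exp (- lam m * exp t) * exp (- lam' n * exp t)"
      by (simp add: mult_exp_exp algebra_simps)
    then show ?thesis unfolding f_def by (simp add: norm_mult norm_exp_mult_of_real mult_ac)
  qed
  have th1_sum: "(\<lambda>m. norm (a1 m) * exp (- lam m * x)) summable_on UNIV" if "0 < x" for x
  proof -
    have "(\<lambda>m. norm (a1 m) * exp (- lam m * x)) summable_on insert 0 {1..}"
      unfolding summable_on_insert_iff by (rule A1.theta_abs_summable[OF that])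
    also have "insert 0 {1..} = (UNIV :: nat set)" by auto
    finally show ?thesis .
  qed
  have pointwise: "(\<lambda>p. norm (f p t)) summable_on V" for t
  proof -
    have "(\<lambda>(m, n). (norm (a1 m) * exp (- lam m * exp t)) * (norm (a2 n) * exp (- lam' n * exp t))) summable_on V"
      unfolding V_def by (intro summable_on_product_real th1_sum A2.theta_abs_summable) auto
    then have "(\<lambda>p. exp (Re s * t) * (case p of (m, n) \<Rightarrow> (norm (a1 m) * exp (- lam m * exp t)) * (norm (a2 n) * exp (- lam' n * exp t)))) summable_on V"
      by (rule summable_on_cmult_right)
    then show ?thesis
      by (rule summable_on_cong[THEN iffD1, rotated]) (auto simp: norm_f V_def)
  qed
  have total: "(\<lambda>p. LINT t|lborel. norm (f p t)) summable_on V"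
  proof -
    have "(\<lambda>p. Gamma (Re s) * norm (?T p)) summable_on V"
      using absV by (rule summable_on_cmult_right)
    then show ?thesis
    proof (rule summable_on_cong[THEN iffD1, rotated])
      fix p assume "p \<in> V"
      then obtain m n where p: "p = (m, n)" "n \<ge> 1" by (auto simp: V_def)
      have "complex_of_real (LINT t|lborel. exp (Re s * t) * exp (- (lam m + lam' n) * exp t)) =
          (LINT t|lborel. complex_of_real (exp (Re s * t) * exp (- (lam m + lam' n) * exp t)))"
        by (rule integral_complex_of_real[symmetric])
      also have "\<dots> = laplace (\<lambda>t. of_real (exp (- (lam m + lam' n) * exp t))) (of_real (Re s))"
        by (simp add: laplace_def exp_of_real flip: of_real_mult)
      also have "\<dots> = of_real ((lam m + lam' n) powr (- Re s) * Gamma (Re s))"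
        using L_pos[OF p(2), of m] s0
        by (subst laplace_exp_exp) (auto simp: Gamma_complex_of_real powr_of_real simp flip: of_real_minus of_real_add)
      finally have "(LINT t|lborel. exp (Re s * t) * exp (- (lam m + lam' n) * exp t)) = (lam m + lam' n) powr (- Re s) * Gamma (Re s)"
        using of_real_eq_iff by blast
      moreover have "(LINT t|lborel. norm (f p t)) = norm (a1 m) * norm (a2 n) * (LINT t|lborel. exp (Re s * t) * exp (- (lam m + lam' n) * exp t))"
        by (subst integral_mult_right_zero[symmetric])
           (simp add: p(1) f_def norm_mult norm_exp_mult_of_real)
      ultimately show "Gamma (Re s) * norm (?T p) = (LINT t|lborel. norm (f p t))"
        by (simp add: p(1) norm_T[OF p(2)] mult_ac)
    qed
  qed
  have "infinite V" by (simp add: V_def finite_cartesian_product_iff infinite_Ici)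
  note swap = integral_infsum[OF countableI_type this f_int pointwise total]
  have inf_f: "(\<Sum>\<^sub>\<infinity>p\<in>V. f p t) = exp ((s - of_real r1) * of_real t) * (b1 0 * theta a2 lam' (of_real (exp t))) +
     exp ((s - of_real r1) * of_real t) * kernel t" for t
  proof -
    let ?x = "complex_of_real (exp t)"
    have "(\<Sum>\<^sub>\<infinity>p\<in>V. f p t) = (\<Sum>\<^sub>\<infinity>p\<in>V. exp (s * of_real t) * (case p of (m, n) \<Rightarrow>
        (a1 m * exp (- of_real (lam m) * ?x)) * (a2 n * exp (- of_real (lam' n) * ?x))))"
    proof (intro infsum_cong)
      fix p assume "p \<in> V"
      obtain m n where p: "p = (m, n)" by (cases p)
      have "exp (- (lam m + lam' n) * exp t) = exp (- lam m * exp t) * exp (- lam' n * exp t)"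
        by (simp add: mult_exp_exp algebra_simps)
      then show "f p t = exp (s * of_real t) * (case p of (m, n) \<Rightarrow>
        (a1 m * exp (- of_real (lam m) * ?x)) * (a2 n * exp (- of_real (lam' n) * ?x)))"
        by (simp add: f_def p exp_of_real mult_ac flip: of_real_mult of_real_minus)
    qed
    also have "\<dots> = exp (s * of_real t) * ((\<Sum>\<^sub>\<infinity>m. a1 m * exp (- of_real (lam m) * ?x)) * theta a2 lam' ?x)"
      unfolding infsum_cmult_right' V_def theta_def
      by (subst infsum_product_abs[OF _ A2.theta_summable])
         (use th1_sum[of "exp t"] in \<open>auto simp: norm_mult\<close>)
    also have "(\<Sum>\<^sub>\<infinity>m. a1 m * exp (- of_real (lam m) * ?x)) = (\<Sum>\<^sub>\<infinity>m\<in>insert 0 {1..}. a1 m * exp (- of_real (lam m) * ?x))"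
      by (rule arg_cong[where f = "infsum _"]) auto
    also have "\<dots> = a1 0 + theta a1 lam ?x"
      unfolding theta_def
      by (subst infsum_insert[OF Infinite_Sum.abs_summable_summable[OF A1.theta_summable]])
         (auto simp: S1.lam0)
    also have "a1 0 + theta a1 lam ?x = ?x powr (- of_real r1) * (theta b1 mu (1 / ?x) + b1 0)"
      using S1.theta_modular[of ?x] by (simp add: add.commute)
    also have "?x powr (- of_real r1) = exp (- of_real r1 * of_real t)"
      unfolding powr_def by (subst Ln_of_real) auto
    also have "1 / ?x = of_real (exp (- t))" by (simp add: exp_minus divide_inverse)
    also have "exp (s * of_real t) * (exp (- of_real r1 * of_real t) * (theta b1 mu (of_real (exp (- t))) + b1 0) * theta a2 lam' ?x) =
      (exp (s * of_real t) * exp (- of_real r1 * of_real t)) * (b1 0 * theta a2 lam' ?x + kernel t)"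
      by (simp add: kernel_def algebra_simps)
    also have "exp (s * of_real t) * exp (- of_real r1 * of_real t) = exp ((s - of_real r1) * of_real t)"
      by (simp add: mult_exp_exp algebra_simps)
    finally show ?thesis by (simp add: distrib_left)
  qed
  \<comment> \<open>If \<open>b1 0\<close> is nonzero, then \<open>r1 \<le> abscissa a1 lam\<close>,
    and \<open>Re s\<close> exceeds the sum of the two abscissas; hence \<open>s - r1\<close> lies
    to the right of the abscissa of the second series.\<close>
  have main: "integrable lborel (\<lambda>t. exp ((s - of_real r1) * of_real t) * (b1 0 * theta a2 lam' (of_real (exp t))))"
    "(LINT t|lborel. exp ((s - of_real r1) * of_real t) * (b1 0 * theta a2 lam' (of_real (exp t)))) =
       b1 0 * (Gamma (s - of_real r1) * \<phi>2 (s - of_real r1))"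
  proof -
    have "integrable lborel (\<lambda>t. exp ((s - of_real r1) * of_real t) * (b1 0 * theta a2 lam' (of_real (exp t)))) \<and>
      (LINT t|lborel. exp ((s - of_real r1) * of_real t) * (b1 0 * theta a2 lam' (of_real (exp t)))) =
       b1 0 * (Gamma (s - of_real r1) * \<phi>2 (s - of_real r1))"
    proof (cases "b1 0 = 0")
      case False
      define d where "d = Re (s - of_real r1)"
      have d: "0 < d" "abscissa a2 lam' < d"
        using S1.abscissa_ge_r[OF False] s S2.abscissa_nonneg S1.abscissa_nonneg by (auto simp: d_def)
      interpret D: abs_dirichlet a2 lam' d by (rule S2.abs_dirichlet_a[OF d])
      have i: "integrable lborel (\<lambda>t. b1 0 * (exp ((s - of_real r1) * of_real t) * theta a2 lam' (of_real (exp t))))"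
        by (intro integrable_mult_right D.laplace_theta(1)) (simp add: d_def)
      have "(LINT t|lborel. b1 0 * (exp ((s - of_real r1) * of_real t) * theta a2 lam' (of_real (exp t)))) =
          b1 0 * laplace (\<lambda>t. theta a2 lam' (of_real (exp t))) (s - of_real r1)"
        unfolding laplace_def by (rule integral_mult_right_zero)
      also have "\<dots> = b1 0 * (Gamma (s - of_real r1) * \<phi>2 (s - of_real r1))"
        using D.laplace_theta(2)[of "s - of_real r1"] S2.\<phi>_series[of "s - of_real r1"] d
        by (simp add: d_def)
      finally show ?thesis using i by (simp add: mult.left_commute)
    qed simp
    then show "integrable lborel (\<lambda>t. exp ((s - of_real r1) * of_real t) * (b1 0 * theta a2 lam' (of_real (exp t))))"
      "(LINT t|lborel. exp ((s - of_real r1) * of_real t) * (b1 0 * theta a2 lam' (of_real (exp t)))) =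
       b1 0 * (Gamma (s - of_real r1) * \<phi>2 (s - of_real r1))" by auto
  qed
  have k_int: "integrable lborel (\<lambda>t. exp ((s - of_real r1) * of_real t) * kernel t)"
    using kernel_weight_integrable[of "Re (s - of_real r1)"] by (intro integrable_laplace) auto
  have "Gamma s * infsum ?T V = (\<Sum>\<^sub>\<infinity>p\<in>V. LINT t|lborel. f p t)"
    unfolding infsum_cmult_right'[symmetric] by (intro infsum_cong term_V[symmetric])
  also have "\<dots> = (LINT t|lborel. (\<Sum>\<^sub>\<infinity>p\<in>V. f p t))" by (rule swap(3)[symmetric])
  also have "\<dots> = b1 0 * (Gamma (s - of_real r1) * \<phi>2 (s - of_real r1)) + laplace kernel (s - of_real r1)"
    unfolding inf_f Bochner_Integration.integral_add[OF main(1) k_int] main(2) laplace_def ..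
  finally show "Gamma s * epstein_series a1 a2 lam lam' s =
      a2 0 * (Gamma s * \<phi>1 s) + b1 0 * (Gamma (s - of_real r1) * \<phi>2 (s - of_real r1))
        + laplace kernel (s - of_real r1)"
    unfolding series by (simp add: algebra_simps)
qed

end

subsection \<open>Analytic continuation and functional equation\<close>

text \<open>The prescribed value at \<open>p\<close> is the one that nice meromorphy demands: 0 at a
  genuine pole, the value of \<open>E\<close> otherwise.\<close>

lemma entire_plus_simple_pole:
  assumes E: "E holomorphic_on UNIV"
    and F: "\<And>s. s \<noteq> p \<Longrightarrow> F s = E s + c / (s - p)" "F p = (if c = 0 then E p else 0)"
  shows "F nicely_meromorphic_on UNIV" "only_possible_pole_simple_at F p" "residue F p = c"
proof -
  define g where "g s = (s - p) * E s + c" for s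
  have g: "g holomorphic_on UNIV" unfolding g_def using E by (intro holomorphic_intros)
  have Fg: "F s = g s / (s - p)" if "s \<noteq> p" for s
    using that F(1)[OF that] by (simp add: g_def field_simps)
  have "(\<lambda>s. E s + c / (s - p)) holomorphic_on - {p}"
    using holomorphic_on_subset[OF E] by (intro holomorphic_intros) auto
  then have hol: "F holomorphic_on - {p}"
    by (rule holomorphic_transform) (use F(1) in auto)
  have an: "F analytic_on - {p}"
    using hol by (simp add: analytic_on_open open_Compl)
  have ent: "F holomorphic_on UNIV" if "c = 0"
    using E by (rule holomorphic_transform) (use F that in \<open>metis add.right_neutral div_0\<close>)
  have "eventually (\<lambda>s. F s = g s / (s - p)) (at p)"
    using Fg by (auto simp: eventually_at_filter)
  then have "residue F p = residue (\<lambda>s. g s / (s - p)) p"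
    by (rule residue_cong) simp
  also have "\<dots> = g p" by (rule residue_simple[OF open_UNIV _ g]) simp
  finally show "residue F p = c" by (simp add: g_def)
  have pole: "is_pole F p \<and> zorder F p = - 1" if "c \<noteq> 0"
  proof -
    have gp: "g p \<noteq> 0" using that by (simp add: g_def)
    have "zorder F p = - 1"
    proof (rule zorder_eqI[OF open_UNIV _ g gp])
      fix w assume "w \<noteq> p"
      then show "F w = g w * (w - p) powi - 1" using Fg[of w] by (simp add: field_simps)
    qed auto
    moreover have "is_pole F p"
    proof -
      have "is_pole (\<lambda>s. g s / (s - p)) p"
      proof (rule is_pole_divide)
        show "isCont g p"
          using g holomorphic_on_imp_continuous_on continuous_on_eq_continuous_at by blast
        show "filterlim (\<lambda>s. s - p) (at 0) (at p)"
          unfolding filterlim_at by (auto intro!: tendsto_eq_intros simp: eventually_at_filter)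
      qed (use gp in auto)
      then show ?thesis
        by (rule is_pole_cong[THEN iffD1, rotated 2])
           (use Fg in \<open>auto simp: eventually_at_filter\<close>)
    qed
    ultimately show ?thesis by blast
  qed
  show "only_possible_pole_simple_at F p"
    unfolding only_possible_pole_simple_at_def
  proof (intro conjI impI an)
    assume "is_pole F p"
    moreover have "\<not> is_pole F p" if "c = 0"
      using ent[OF that] not_is_pole_holomorphic[of UNIV p F] by auto
    ultimately show "zorder F p = - 1" using pole by blast
  qed
  show "F nicely_meromorphic_on UNIV"
  proof (cases "c = 0")
    case True
    then show ?thesis
      using ent by (intro analytic_on_imp_nicely_meromorphic_on) (simp add: analytic_on_open)
  next
    case False
    show ?thesis
    proof (rule nicely_meromorphic_onI_open[where pts = "{p}"])
      show "F analytic_on UNIV - {p}" using an unfolding Compl_eq_Diff_UNIV .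
      show "is_pole F x \<and> F x = 0" if "x \<in> {p}" for x using pole F(2) False that by auto
      show "isolated_singularity_at F x" for x
      proof (cases "x = p")
        case True
        then show ?thesis
          using isolated_singularity_at_holomorphic[OF hol[unfolded Compl_eq_Diff_UNIV] open_UNIV] by simp
      next
        case False
        then show ?thesis
          by (intro isolated_singularity_at_analytic analytic_on_subset[OF an]) auto
      qed
    qed auto
  qed
qed

text \<open>The polar coefficients are parameters, so that the dual series satisfies the same
  predicate with \<open>x\<close> and \<open>y\<close> exchanged.\<close>

definition regular_part ::
  "real \<Rightarrow> complex \<Rightarrow> complex \<Rightarrow> (complex \<Rightarrow> complex) \<Rightarrow> (complex \<Rightarrow> complex) \<Rightarrow> bool" where
  "regular_part r x y \<phi> H \<longleftrightarrow> H holomorphic_on UNIV \<and>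
     (\<forall>s. s \<notin> \<int>\<^sub>\<le>\<^sub>0 \<and> (s \<noteq> of_real r \<or> y = 0) \<longrightarrow> Gamma s * \<phi> s = H s - x / s + y / (s - of_real r))"

text \<open>One function serves both series, up to reflection. This common choice reduces the
  functional equation of the Epstein function to a comparison of terms.\<close>

lemma (in class_A_series) regular_parts:
  obtains H where "regular_part r (a 0) (b 0) \<phi> H"
    "regular_part r (b 0) (a 0) \<psi> (\<lambda>s. H (of_real r - s))"
proof (rule regular_part_exists)
  fix H
  assume H: "H holomorphic_on UNIV"
    "\<And>s. s \<notin> \<int>\<^sub>\<le>\<^sub>0 \<Longrightarrow> s \<noteq> of_real r \<or> b 0 = 0 \<Longrightarrow> Gamma s * \<phi> s = H s - a 0 / s + b 0 / (s - of_real r)"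
    "\<And>s. of_real r - s \<notin> \<int>\<^sub>\<le>\<^sub>0 \<Longrightarrow> s \<noteq> 0 \<or> a 0 = 0 \<Longrightarrow>
       Gamma (of_real r - s) * \<psi> (of_real r - s) = H s - a 0 / s + b 0 / (s - of_real r)"
  have "H \<circ> (\<lambda>s. of_real r - s) holomorphic_on UNIV"
    by (rule holomorphic_on_compose_gen[OF _ H(1)]) (auto intro!: holomorphic_intros)
  then have "regular_part r (b 0) (a 0) \<psi> (\<lambda>s. H (of_real r - s))"
    unfolding regular_part_def
  proof (intro conjI allI impI)
    fix s :: complex assume s: "s \<notin> \<int>\<^sub>\<le>\<^sub>0 \<and> (s \<noteq> of_real r \<or> a 0 = 0)"
    have "Gamma s * \<psi> s = H (of_real r - s) - a 0 / (of_real r - s) + b 0 / (- s)"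
      using H(3)[of "of_real r - s"] s by auto
    moreover have "a 0 / (of_real r - s) = - (a 0 / (s - of_real r))"
      by (metis minus_diff_eq divide_minus_right)
    ultimately show "Gamma s * \<psi> s = H (of_real r - s) - b 0 / s + a 0 / (s - of_real r)"
      by simp
  qed (simp add: o_def)
  moreover have "regular_part r (a 0) (b 0) \<phi> H"
    unfolding regular_part_def using H(1,2) by blast
  ultimately show ?thesis using that by blast
qed

context class_A_pair
begin

text \<open>What remains of the formula once the polar parts are split off. At \<open>r1\<close>
  these cancel: the two terms contribute \<open>a2 0 * b1 0 / (s - r1)\<close> and its negative,
  which leaves poles at 0 and \<open>r1 + r2\<close> only.\<close>

definition reg :: "(complex \<Rightarrow> complex) \<Rightarrow> (complex \<Rightarrow> complex) \<Rightarrow> complex \<Rightarrow> complex" where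
  "reg H1 H2 s = a2 0 * H1 s + b1 0 * H2 (s - of_real r1) + laplace kernel (s - of_real r1)"

text \<open>Dividing by \<open>Gamma s\<close> turns \<open>1 / s\<close> into
  \<open>rGamma (s + 1)\<close>, so the pole at 0 disappears, and the one at \<open>r1 + r2\<close>
  acquires the factor \<open>rGamma (r1 + r2)\<close> in its residue.\<close>

lemma epstein_continuation:
  assumes H1: "regular_part r1 (a1 0) (b1 0) \<phi>1 H1" and H2: "regular_part r2 (a2 0) (b2 0) \<phi>2 H2"
  obtains Z where
    "meromorphic_continuation Z (epstein_series a1 a2 lam lam') (2 * max (abscissa a1 lam) (abscissa a2 lam'))"
    "only_possible_pole_simple_at Z (of_real (r1 + r2))"
    "residue Z (of_real (r1 + r2)) = b1 0 * b2 0 * rGamma (of_real (r1 + r2))"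
    "\<And>s. s \<notin> \<int>\<^sub>\<le>\<^sub>0 \<Longrightarrow> s \<noteq> of_real (r1 + r2) \<Longrightarrow>
      Gamma s * Z s = reg H1 H2 s - a1 0 * a2 0 / s + b1 0 * b2 0 / (s - of_real (r1 + r2))"
proof -
  define R where "R = complex_of_real (r1 + r2)"
  define A where "A = a1 0 * a2 0"
  define B where "B = b1 0 * b2 0"
  \<comment> \<open>The divided difference of \<open>rGamma\<close> at \<open>R\<close>, that is,
    \<open>rGamma s / (s - R)\<close> without its polar part.\<close>
  define G where "G s = (if s = R then deriv rGamma R else rGamma s / (s - R) - rGamma R / (s - R))" for s
  have G_hol: "G holomorphic_on UNIV"
    unfolding G_def
    by (rule pole_theorem_open[where g = rGamma]) (auto intro: holomorphic_rGamma)
  define E where "E s = rGamma s * reg H1 H2 s - A * rGamma (s + 1) + B * G s" for s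
  define Z where "Z s = (if s = R then (if B * rGamma R = 0 then E s else 0) else E s + B * rGamma R / (s - R))" for s
  have shift: "(\<lambda>s. f (s - of_real r1)) holomorphic_on UNIV" if "f holomorphic_on UNIV" for f
  proof -
    have "f \<circ> (\<lambda>s. s - of_real r1) holomorphic_on UNIV"
      by (rule holomorphic_on_compose_gen[OF _ that]) (auto intro!: holomorphic_intros)
    then show ?thesis by (simp add: o_def)
  qed
  have reg_hol: "reg H1 H2 holomorphic_on UNIV"
    unfolding reg_def using H1 H2 laplace_kernel_entire
    by (intro holomorphic_intros shift) (auto simp: regular_part_def)
  have E_hol: "E holomorphic_on UNIV"
    unfolding E_def using reg_hol G_hol by (intro holomorphic_intros)
  note pole = entire_plus_simple_pole[OF E_hol, of R Z "B * rGamma R"]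
  have Z: "Z nicely_meromorphic_on UNIV" "only_possible_pole_simple_at Z R" "residue Z R = B * rGamma R"
    by (rule pole; simp add: Z_def)+
  have GR: "rGamma R \<noteq> 0"
  proof -
    have "0 < Re R" using S1.r_pos S2.r_pos by (simp add: R_def)
    then show ?thesis by (auto simp: rGamma_eq_zero_iff elim!: nonpos_Ints_cases)
  qed
  have Z_eq: "Z s = rGamma s * (reg H1 H2 s - A / s + B / (s - R))" if s: "s \<noteq> 0" "s \<noteq> R \<or> B = 0" for s
  proof -
    have "rGamma (s + 1) = rGamma s / s" using rGamma_plus1[of s] s by (simp add: field_simps)
    then have "rGamma s * (reg H1 H2 s - A / s + B / (s - R)) =
        rGamma s * reg H1 H2 s - A * rGamma (s + 1) + B * (rGamma s / (s - R))"
      by (simp add: algebra_simps)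
    also have "\<dots> = Z s"
      using s by (auto simp: Z_def E_def G_def right_diff_distrib)
    finally show ?thesis ..
  qed
  have "Z s = epstein_series a1 a2 lam lam' s"
    if s: "2 * max (abscissa a1 lam) (abscissa a2 lam') < Re s" for s
  proof -
    note nonneg = S1.abscissa_nonneg S2.abscissa_nonneg
    have s0: "0 < Re s" using s nonneg by auto
    then have sn: "s \<notin> \<int>\<^sub>\<le>\<^sub>0" "s \<noteq> 0" by (auto elim!: nonpos_Ints_cases)
    \<comment> \<open>In the half-plane of convergence the points \<open>r1\<close> and
      \<open>r1 + r2\<close> can occur only if the corresponding polar coefficient vanishes, which
      is the case that \<open>regular_part\<close> admits.\<close>
    have b1: "r1 < Re s" "0 < Re (s - of_real r1)" if "b1 0 \<noteq> 0"
      using S1.abscissa_ge_r[OF that] s nonneg S1.r_pos by auto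
    have b12: "r1 + r2 < Re s" if "b1 0 \<noteq> 0" "b2 0 \<noteq> 0"
      using S1.abscissa_ge_r[OF that(1)] S2.abscissa_ge_r[OF that(2)] s by auto
    have "s \<noteq> R" if "B \<noteq> 0"
    proof -
      have "b1 0 \<noteq> 0" "b2 0 \<noteq> 0" using that by (auto simp: B_def)
      from b12[OF this] show ?thesis by (auto simp: R_def)
    qed
    then have sR: "s \<noteq> R \<or> B = 0" by blast
    have e1: "Gamma s * \<phi>1 s = H1 s - a1 0 / s + b1 0 / (s - of_real r1)"
      using H1 sn b1 unfolding regular_part_def by fastforce
    have e2: "b1 0 * (Gamma (s - of_real r1) * \<phi>2 (s - of_real r1)) =
       b1 0 * (H2 (s - of_real r1) - a2 0 / (s - of_real r1) + b2 0 / (s - R))"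
    proof (cases "b1 0 = 0")
      case False
      have 1: "s - of_real r1 \<notin> \<int>\<^sub>\<le>\<^sub>0" by (rule not_nonpos_Int_if_Re[OF b1(2)[OF False]])
      have 2: "s - of_real r1 \<noteq> of_real r2 \<or> b2 0 = 0"
      proof (rule disjCI)
        assume "b2 0 \<noteq> 0"
        then have "Re (s - of_real r1) \<noteq> r2" using b12[OF False] by simp
        then show "s - of_real r1 \<noteq> of_real r2" by (metis Re_complex_of_real)
      qed
      show ?thesis
        using H2 1 2 unfolding regular_part_def by (simp add: R_def diff_diff_eq)
    qed simp
    have "Gamma s * epstein_series a1 a2 lam lam' s = reg H1 H2 s - A / s + B / (s - R)"
      unfolding epstein_formula(2)[OF s] reg_def A_def B_def e1 e2 by (simp add: algebra_simps)
    then have "Z s = rGamma s * Gamma s * epstein_series a1 a2 lam lam' s"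
      using Z_eq[OF sn(2) sR] by simp
    then show ?thesis using sn(1) by (simp add: rGamma_inverse_Gamma Gamma_eq_zero_iff)
  qed
  then have "meromorphic_continuation Z (epstein_series a1 a2 lam lam') (2 * max (abscissa a1 lam) (abscissa a2 lam'))"
    using Z(1) by (simp add: meromorphic_continuation_def)
  then show ?thesis
  proof (rule that)
    show "only_possible_pole_simple_at Z (of_real (r1 + r2))" using Z(2) by (simp only: R_def)
    show "residue Z (of_real (r1 + r2)) = b1 0 * b2 0 * rGamma (of_real (r1 + r2))"
      using Z(3) by (simp only: R_def B_def)
    fix s :: complex assume s: "s \<notin> \<int>\<^sub>\<le>\<^sub>0" "s \<noteq> of_real (r1 + r2)"
    then have "s \<noteq> 0" by auto
    then have "Gamma s * Z s = (Gamma s * rGamma s) * (reg H1 H2 s - A / s + B / (s - R))"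
      using Z_eq[of s] s by (simp add: R_def)
    also have "Gamma s * rGamma s = 1" using s by (simp add: rGamma_inverse_Gamma Gamma_eq_zero_iff)
    finally show "Gamma s * Z s = reg H1 H2 s - a1 0 * a2 0 / s + b1 0 * b2 0 / (s - of_real (r1 + r2))"
      by (simp only: A_def B_def R_def mult_1)
  qed
qed

end

section \<open>Exchange of the two series, and reflection\<close>

lemma epstein_term_swap: "epstein_term a1 a2 lam lam' s (prod.swap p) = epstein_term a2 a1 lam' lam s p"
  by (cases p) (simp add: epstein_term_def add.commute mult.commute)

text \<open>Duality delivers the coefficients in the order \<open>b2\<close>, \<open>b1\<close>;
  this restores the order of the theorem.\<close>

lemma epstein_swap:
  shows "epstein_term a1 a2 lam lam' s summable_on UNIV - {(0, 0)} \<longleftrightarrow>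
      epstein_term a2 a1 lam' lam s summable_on UNIV - {(0, 0)}"
    and "epstein_series a1 a2 lam lam' s = epstein_series a2 a1 lam' lam s"
proof -
  have bij: "bij_betw prod.swap (UNIV - {(0, 0)}) (UNIV - {(0::nat, 0::nat)})"
    by (rule bij_betwI[where g = prod.swap]) auto
  show "epstein_term a1 a2 lam lam' s summable_on UNIV - {(0, 0)} \<longleftrightarrow>
      epstein_term a2 a1 lam' lam s summable_on UNIV - {(0, 0)}"
    using summable_on_reindex_bij_betw[OF bij, of "epstein_term a1 a2 lam lam' s"]
    by (simp add: epstein_term_swap)
  show "epstein_series a1 a2 lam lam' s = epstein_series a2 a1 lam' lam s"
    using infsum_reindex_bij_betw[OF bij, of "epstein_term a1 a2 lam lam' s"]
    by (simp add: epstein_term_swap epstein_series_def)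
qed

lemma laplace_reflect: "laplace (\<lambda>t. h (- t)) s = laplace h (- s)"
  unfolding laplace_def
  by (subst lborel_integral_real_affine[where c = "-1" and t = 0]) auto

theorem corollary2p1:
  fixes r1 r2 :: real
    and a1 a2 b1 b2 :: "nat \<Rightarrow> complex"
    and lam lam' mu mu' :: "nat \<Rightarrow> real"
    and \<phi>1 \<phi>2 \<psi>1 \<psi>2 :: "complex \<Rightarrow> complex"
    and \<rho>1 \<rho>2 :: complex
  assumes "class_A r1 a1 lam \<phi>1 b1 mu \<psi>1"
    and "class_A r2 a2 lam' \<phi>2 b2 mu' \<psi>2"
    and "\<rho>1 = residue \<phi>1 (of_real r1)"
    and "\<rho>2 = residue \<phi>2 (of_real r2)"
  shows
    "(\<forall>s. Re s > 2 * max (abscissa a1 lam) (abscissa a2 lam') \<longrightarrow>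
        epstein_term a1 a2 lam lam' s summable_on (UNIV - {(0, 0)})) \<and>
     (\<forall>s. Re s > 2 * max (abscissa b1 mu) (abscissa b2 mu') \<longrightarrow>
        epstein_term b1 b2 mu mu' s summable_on (UNIV - {(0, 0)})) \<and>
     (\<forall>s. bessel_term r1 b1 a2 mu lam' s summable_on ({1..} \<times> {1..})) \<and>
     (\<exists>Z Z'.
        meromorphic_continuation Z (epstein_series a1 a2 lam lam')
          (2 * max (abscissa a1 lam) (abscissa a2 lam')) \<and>
        meromorphic_continuation Z' (epstein_series b1 b2 mu mu')
          (2 * max (abscissa b1 mu) (abscissa b2 mu')) \<and>
        (\<forall>s. s \<notin> \<int>\<^sub>\<le>\<^sub>0 \<and> s - of_real r1 \<notin> \<int>\<^sub>\<le>\<^sub>0 \<and> s \<noteq> of_real (r1 + r2) \<longrightarrow>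
           Gamma s * Z s =
             - \<phi>2 0 * Gamma s * \<phi>1 s
             + \<rho>1 * Gamma (of_real r1) * Gamma (s - of_real r1) * \<phi>2 (s - of_real r1)
             + 2 * (\<Sum>\<^sub>\<infinity>p \<in> {1..} \<times> {1..}. bessel_term r1 b1 a2 mu lam' s p)) \<and>
        only_possible_pole_simple_at Z (of_real (r1 + r2)) \<and>
        residue Z (of_real (r1 + r2)) =
          Gamma (of_real r1) * Gamma (of_real r2) / Gamma (of_real (r1 + r2)) * \<rho>1 * \<rho>2 \<and>
        only_possible_pole_simple_at Z' (of_real (r1 + r2)) \<and>
        (\<forall>s. s \<notin> \<int>\<^sub>\<le>\<^sub>0 \<and> of_real (r1 + r2) - s \<notin> \<int>\<^sub>\<le>\<^sub>0 \<longrightarrow>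
           Gamma s * Z s = Gamma (of_real (r1 + r2) - s) * Z' (of_real (r1 + r2) - s)))"
proof -
  interpret P: class_A_pair r1 a1 lam \<phi>1 b1 mu \<psi>1 r2 a2 lam' \<phi>2 b2 mu' \<psi>2
    by (intro class_A_pair.intro class_A_series.intro assms(1,2))
  interpret Q: class_A_pair r2 b2 mu' \<psi>2 a2 lam' \<phi>2 r1 b1 mu \<psi>1 a1 lam \<phi>1
    by (rule P.dual)
  \<comment> \<open>The same \<open>H1\<close> and \<open>H2\<close> enter both continuations,
    reflected for the dual pair.\<close>
  obtain H1 where H1: "regular_part r1 (a1 0) (b1 0) \<phi>1 H1"
    "regular_part r1 (b1 0) (a1 0) \<psi>1 (\<lambda>s. H1 (of_real r1 - s))" by (rule P.S1.regular_parts)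
  obtain H2 where H2: "regular_part r2 (a2 0) (b2 0) \<phi>2 H2"
    "regular_part r2 (b2 0) (a2 0) \<psi>2 (\<lambda>s. H2 (of_real r2 - s))" by (rule P.S2.regular_parts)
  define R where "R = complex_of_real (r1 + r2)"
  obtain Z where Z:
    "meromorphic_continuation Z (epstein_series a1 a2 lam lam') (2 * max (abscissa a1 lam) (abscissa a2 lam'))"
    "only_possible_pole_simple_at Z R" "residue Z R = b1 0 * b2 0 * rGamma R"
    "\<And>s. s \<notin> \<int>\<^sub>\<le>\<^sub>0 \<Longrightarrow> s \<noteq> R \<Longrightarrow> Gamma s * Z s = P.reg H1 H2 s - a1 0 * a2 0 / s + b1 0 * b2 0 / (s - R)"
    by (rule P.epstein_continuation[OF H1(1) H2(1), folded R_def, OF that])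
  obtain Z' where Z':
    "meromorphic_continuation Z' (epstein_series b2 b1 mu' mu) (2 * max (abscissa b2 mu') (abscissa b1 mu))"
    "only_possible_pole_simple_at Z' R"
    "\<And>s. s \<notin> \<int>\<^sub>\<le>\<^sub>0 \<Longrightarrow> s \<noteq> R \<Longrightarrow>
       Gamma s * Z' s = Q.reg (\<lambda>s. H2 (of_real r2 - s)) (\<lambda>s. H1 (of_real r1 - s)) s
         - b2 0 * b1 0 / s + a2 0 * a1 0 / (s - R)"
    by (rule Q.epstein_continuation[OF H2(2) H1(2), unfolded add.commute[of r2 r1], folded R_def, OF that])
  have b0: "b1 0 = \<rho>1 * Gamma (of_real r1)" "b2 0 = \<rho>2 * Gamma (of_real r2)"
    using P.S1.b0_eq_residue P.S2.b0_eq_residue assms(3,4) by simp_all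
  have kernel: "Q.kernel = (\<lambda>t. P.kernel (- t))"
    by (simp add: fun_eq_iff P.kernel_def Q.kernel_def)
  have bessel: "Gamma s * Z s = - \<phi>2 0 * Gamma s * \<phi>1 s
      + \<rho>1 * Gamma (of_real r1) * Gamma (s - of_real r1) * \<phi>2 (s - of_real r1)
      + 2 * (\<Sum>\<^sub>\<infinity>p \<in> {1..} \<times> {1..}. bessel_term r1 b1 a2 mu lam' s p)"
    if s: "s \<notin> \<int>\<^sub>\<le>\<^sub>0" "s - of_real r1 \<notin> \<int>\<^sub>\<le>\<^sub>0" "s \<noteq> R" for s
  proof -
    have "s \<noteq> of_real r1" using s(2) by auto
    then have 1: "Gamma s * \<phi>1 s = H1 s - a1 0 / s + b1 0 / (s - of_real r1)"
      using H1(1) s(1) unfolding regular_part_def by blast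
    have "s - of_real r1 \<noteq> of_real r2" using s(3) by (auto simp: R_def algebra_simps)
    then have 2: "Gamma (s - of_real r1) * \<phi>2 (s - of_real r1) =
        H2 (s - of_real r1) - a2 0 / (s - of_real r1) + b2 0 / (s - R)"
      using H2(1) s(2) unfolding regular_part_def by (simp add: R_def diff_diff_eq)
    have "Gamma s * Z s = a2 0 * (Gamma s * \<phi>1 s) + b1 0 * (Gamma (s - of_real r1) * \<phi>2 (s - of_real r1))
        + laplace P.kernel (s - of_real r1)"
      unfolding Z(4)[OF s(1,3)] P.reg_def 1 2 by (simp add: algebra_simps)
    then show ?thesis
      unfolding P.bessel_sum(2) P.S2.a0 b0(1) by (simp add: mult.assoc)
  qed
  have fe: "Gamma s * Z s = Gamma (R - s) * Z' (R - s)" if s: "s \<notin> \<int>\<^sub>\<le>\<^sub>0" "R - s \<notin> \<int>\<^sub>\<le>\<^sub>0" for s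
  proof -
    have ne: "s \<noteq> R" "R - s \<noteq> R" using s by auto
    \<comment> \<open>As \<open>R - s - r2 = r1 - s\<close>, the reflections return the arguments
      \<open>s\<close> of \<open>H1\<close> and \<open>s - r1\<close> of \<open>H2\<close> and of
      the kernel transform, and the two simple terms change places. The polar terms at 0 and
      \<open>R\<close> are exchanged in the same way.\<close>
    have "Q.reg (\<lambda>s. H2 (of_real r2 - s)) (\<lambda>s. H1 (of_real r1 - s)) (R - s) = P.reg H1 H2 s"
      unfolding P.reg_def Q.reg_def kernel laplace_reflect by (simp add: R_def)
    moreover have "b2 0 * b1 0 / (R - s) = - (b1 0 * b2 0 / (s - R))"
      by (metis minus_diff_eq divide_minus_right mult.commute)
    ultimately show ?thesis
      unfolding Z(4)[OF s(1) ne(1)] Z'(3)[OF s(2) ne(2)] by (simp add: mult.commute)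
  qed
  have res: "residue Z R = Gamma (of_real r1) * Gamma (of_real r2) / Gamma R * \<rho>1 * \<rho>2"
    unfolding Z(3) b0 by (simp add: rGamma_inverse_Gamma divide_inverse mult_ac)
  have mero: "meromorphic_continuation Z' (epstein_series b1 b2 mu mu') (2 * max (abscissa b1 mu) (abscissa b2 mu'))"
    using Z'(1) by (simp add: meromorphic_continuation_def max.commute epstein_swap(2)[of b1 b2 mu mu'])
  have sum1: "epstein_term a1 a2 lam lam' s summable_on UNIV - {(0, 0)}"
    if "Re s > 2 * max (abscissa a1 lam) (abscissa a2 lam')" for s
    using that by (rule P.epstein_formula(1))
  have sum2: "epstein_term b1 b2 mu mu' s summable_on UNIV - {(0, 0)}"
    if "Re s > 2 * max (abscissa b1 mu) (abscissa b2 mu')" for s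
    using Q.epstein_formula(1)[of s] that by (simp add: max.commute epstein_swap(1)[of b1 b2 mu mu'])
  show ?thesis
    unfolding R_def[symmetric]
  proof (intro conjI; (rule exI[of _ Z], rule exI[of _ Z'], intro conjI)?)
  qed (blast intro: sum1 sum2 P.bessel_sum(1) Z(1,2) Z'(2) bessel fe res mero)+
qed

end
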